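(* For every $\delta>0$ there exists a universal constant $c_\delta>0$, depending only on $\delta$, such that the following holds. Let $P_1$ and $P_2$ be two probability measures on the positive integers such that $P_1$ stochastically dominates $P_2$ and $P_1\neq P_2$. Let $Z_1,Z_2$ be independent random variables with laws $P_1$ and $P_2$ respectively, and let $(Z_1',Z_2')$ be jointly distributed random variables with marginal laws $P_1$ and $P_2$ respectively such that $Z_1'\ge Z_2'$ almost surely. Put $$\beta_1:=c_\delta\cdot\min\left\{\frac{E\left[\left(\frac1{Z_1}-\frac1{Z_2}\right)1_{Z_1<Z_2}\right]}{E\left[\frac1{Z_2'}-\frac1{Z_1'}\right]},\ \frac{E\left[Z_2'\left(\frac1{Z_2'}-\frac1{Z_1'}\right)\right]}{E\left[\frac1{Z_2'}-\frac1{Z_1'}\right]}+1\right\}$$ and $\beta_0:=\max\{\beta_1,\frac{23}{4}+\delta\}$. Then for every $\beta>\beta_0$, $$v(\beta,P_1)>v(\beta,P_2).$$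
   Context: For a probability measure $P$ on the positive integers, $GW(P)$ denotes the Galton-Watson tree (random rooted tree) in which the numbers of children of all individuals are i.i.d. with law $P$; it has no leaves. For $\beta>0$ and a rooted tree, the $\beta$-biased random walk $(X_n)_{n\ge0}$ starts at the root; from the root it moves to each child of the root with equal probability; from a non-root vertex $x$ with $k$ children it moves to the parent of $x$ with probability $\frac{1}{1+\beta k}$ and to each given child of $x$ with probability $\frac{\beta}{1+\beta k}$. Write $|x|$ for the distance of $x$ from the root. The speed $v(\beta,P):=\lim_{n\to\infty}|X_n|/n$ of the $\beta$-biased walk on $GW(P)$ is the almost sure limit under the averaged law (choose the tree according to $GW(P)$, then run the walk on it); for $\beta>1/E_P[Z]$, with $Z$ having law $P$, this limit is known to exist almost surely and to be a non-random constant. $P_1$ stochastically dominates $P_2$ if $P_1([k,\infty))\ge P_2([k,\infty))$ for all $k$; equivalently there is a coupling $(Z_1',Z_2')$ of $P_1$ and $P_2$ with $Z_1'\ge Z_2'$ almost surely. The convention is that stochastic domination also includes $P_1\ne P_2$. *)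

theory Defs
  imports "HOL-Probability.Probability"
begin

text \<open>
  Trees are coded in the Ulam-Harris way: a vertex is a finite list of natural numbers, the root
  is \<^term>\<open>[]\<close>, the parent of a non-root vertex \<open>x\<close> is \<open>butlast x\<close>, and \<open>|x| = length x\<close>.
  A tree is given by the function \<open>\<omega>\<close> of numbers of children: a vertex \<open>x\<close> of the tree has the
  children \<open>x @ [i]\<close> with \<open>i < \<omega> x\<close>. The values of \<open>\<omega>\<close> at lists that are not vertices of the tree
  are irrelevant, since a walk started at the root never visits them.
\<close>

type_synonym vertex = "nat list"

definition children :: "(vertex \<Rightarrow> nat) \<Rightarrow> vertex \<Rightarrow> vertex set" where
  "children \<omega> x = {x @ [i] | i. i < \<omega> x}"

definition GW :: "nat pmf \<Rightarrow> (vertex \<Rightarrow> nat) measure" where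
  "GW P = PiM UNIV (\<lambda>_. measure_pmf P)"

definition step :: "real \<Rightarrow> (vertex \<Rightarrow> nat) \<Rightarrow> vertex \<Rightarrow> vertex pmf" where
  "step \<beta> \<omega> x =
    (if x = [] then pmf_of_set (children \<omega> [])
     else embed_pmf (\<lambda>y. if y = butlast x then 1 / (1 + \<beta> * real (\<omega> x))
                         else if y \<in> children \<omega> x then \<beta> / (1 + \<beta> * real (\<omega> x))
                         else 0))"

text \<open>The weights used in \<^const>\<open>step\<close> do define a probability measure.\<close>

lemma finite_children [simp]: "finite (children \<omega> x)"
  and card_children: "card (children \<omega> x) = \<omega> x"
proof -
  have *: "children \<omega> x = (\<lambda>i. x @ [i]) ` {..<\<omega> x}"
    by (auto simp: children_def)
  show "finite (children \<omega> x)" unfolding * by simp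
  show "card (children \<omega> x) = \<omega> x" unfolding * by (subst card_image) (auto simp: inj_on_def)
qed

lemma pmf_step_root:
  assumes "\<omega> [] > 0"
  shows "pmf (step \<beta> \<omega> []) y = (if y \<in> children \<omega> [] then 1 / real (\<omega> []) else 0)"
proof -
  have "children \<omega> [] \<noteq> {}"
    using assms card_children[of \<omega> "[]"] by auto
  then show ?thesis
    by (simp add: step_def pmf_of_set card_children indicator_def)
qed

lemma pmf_step:
  assumes "\<beta> > 0" and "x \<noteq> []"
  shows "pmf (step \<beta> \<omega> x) y =
    (if y = butlast x then 1 / (1 + \<beta> * real (\<omega> x))
     else if y \<in> children \<omega> x then \<beta> / (1 + \<beta> * real (\<omega> x)) else 0)"
proof -
  define D where "D = 1 + \<beta> * real (\<omega> x)"
  have D: "D > 0" unfolding D_def using assms by (simp add: add_pos_nonneg)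
  define f where "f y = (if y = butlast x then 1 / D
                         else if y \<in> children \<omega> x then \<beta> / D else 0)" for y
  have f_nonneg: "f y \<ge> 0" for y
    using assms D by (auto simp: f_def)
  have parent: "butlast x \<notin> children \<omega> x"
  proof
    assume "butlast x \<in> children \<omega> x"
    then obtain i where "butlast x = x @ [i]"
      by (auto simp: children_def)
    then have "length (butlast x) = length (x @ [i])"
      by (rule arg_cong)
    then show False by simp
  qed
  have "(\<integral>\<^sup>+y. ennreal (f y) \<partial>count_space UNIV)
      = (\<Sum>y\<in>insert (butlast x) (children \<omega> x). ennreal (f y))"
    by (rule nn_integral_count_space') (auto simp: f_def)
  also have "\<dots> = ennreal (\<Sum>y\<in>insert (butlast x) (children \<omega> x). f y)"
    by (rule sum_ennreal) (simp add: f_nonneg)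
  also have "(\<Sum>y\<in>insert (butlast x) (children \<omega> x). f y) = 1 / D + (\<Sum>y\<in>children \<omega> x. f y)"
    using parent by (simp add: f_def)
  also have "(\<Sum>y\<in>children \<omega> x. f y) = (\<Sum>y\<in>children \<omega> x. \<beta> / D)"
    using parent by (intro sum.cong) (auto simp: f_def)
  also have "1 / D + \<dots> = 1"
    using D by (simp add: card_children field_simps) (simp add: D_def)
  finally have "pmf (embed_pmf f) y = f y"
    by (intro pmf_embed_pmf f_nonneg) simp
  moreover have "step \<beta> \<omega> x = embed_pmf f"
    using assms by (simp add: step_def f_def[abs_def] D_def cong: if_cong)
  ultimately show ?thesis
    by (simp add: f_def D_def)
qed

text \<open>
  The law of the whole trajectory of the walk on a fixed tree: the coordinate \<open>X 0\<close> is the root,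
  and \<open>X (Suc n)\<close> is drawn from \<open>step \<beta> \<omega> (X n)\<close>.
\<close>

definition walk_kernel :: "real \<Rightarrow> (vertex \<Rightarrow> nat) \<Rightarrow> nat \<Rightarrow> (nat \<Rightarrow> vertex) \<Rightarrow> vertex measure" where
  "walk_kernel \<beta> \<omega> n X =
    measure_pmf (case n of 0 \<Rightarrow> return_pmf [] | Suc m \<Rightarrow> step \<beta> \<omega> (X m))"

interpretation biased_walk: Ionescu_Tulcea "walk_kernel \<beta> \<omega>" "\<lambda>_. count_space UNIV" for \<beta> \<omega>
proof (rule Ionescu_Tulcea.intro, goal_cases)
  case (1 n)
  show ?case
  proof (cases n)
    case 0
    then show ?thesis
      by (simp add: walk_kernel_def[abs_def] space_subprob_algebra measure_pmf.subprob_space_axioms)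
  next
    case (Suc m)
    have "(\<lambda>X. X m) \<in> PiM {0..<n} (\<lambda>_. count_space UNIV) \<rightarrow>\<^sub>M count_space (UNIV :: vertex set)"
      using Suc by (intro measurable_component_singleton) auto
    moreover have "(\<lambda>x. measure_pmf (step \<beta> \<omega> x)) \<in>
        count_space UNIV \<rightarrow>\<^sub>M subprob_algebra (count_space UNIV)"
      by (auto simp: space_subprob_algebra measure_pmf.subprob_space_axioms)
    ultimately show ?thesis
      unfolding walk_kernel_def[abs_def] Suc by (simp add: measurable_compose)
  qed
next
  case 2
  show ?case
    unfolding walk_kernel_def by (rule measure_pmf.prob_space_axioms)
qed

definition walk :: "real \<Rightarrow> (vertex \<Rightarrow> nat) \<Rightarrow> (nat \<Rightarrow> vertex) measure" where
  "walk \<beta> \<omega> = biased_walk.PF.lim \<beta> \<omega>"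

text \<open>
  The law of the walk depends measurably on the tree, so that the monadic composition in
  \<open>averaged_walk\<close> below is the averaged law: first the tree, then the walk on it.
\<close>

lemma measurable_walk_kernel:
  "(\<lambda>(\<omega>, X). walk_kernel \<beta> \<omega> n X) \<in>
    GW P \<Otimes>\<^sub>M PiM {0..<n} (\<lambda>_. count_space UNIV) \<rightarrow>\<^sub>M subprob_algebra (count_space UNIV)"
proof (cases n)
  case 0
  then show ?thesis
    by (simp add: walk_kernel_def[abs_def] space_subprob_algebra measure_pmf.subprob_space_axioms)
next
  case (Suc m)
  have 1: "(\<lambda>\<omega>. measure_pmf (step \<beta> \<omega> x)) \<in> GW P \<rightarrow>\<^sub>M subprob_algebra (count_space UNIV)" for x
  proof -
    have eq: "(\<lambda>\<omega>. measure_pmf (step \<beta> \<omega> x)) = (\<lambda>k. measure_pmf (step \<beta> (\<lambda>_. k) x)) \<circ> (\<lambda>\<omega>. \<omega> x)"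
      by (auto simp: fun_eq_iff step_def children_def cong: if_cong)
    show ?thesis unfolding eq
    proof (rule measurable_comp)
      show "(\<lambda>\<omega>. \<omega> x) \<in> GW P \<rightarrow>\<^sub>M measure_pmf P"
        unfolding GW_def by (rule measurable_component_singleton) simp
    qed (auto simp: space_subprob_algebra measure_pmf.subprob_space_axioms)
  qed
  have m: "(\<lambda>z. snd z m) \<in>
      GW P \<Otimes>\<^sub>M PiM {0..<n} (\<lambda>_. count_space UNIV) \<rightarrow>\<^sub>M count_space (UNIV :: vertex set)"
    using Suc by (intro measurable_compose[OF measurable_snd] measurable_component_singleton) auto
  have "(\<lambda>z. measure_pmf (step \<beta> (fst z) (snd z m))) \<in>
      GW P \<Otimes>\<^sub>M PiM {0..<n} (\<lambda>_. count_space UNIV) \<rightarrow>\<^sub>M subprob_algebra (count_space UNIV)"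
    by (rule measurable_compose_countable[OF measurable_compose[OF measurable_fst 1] m])
  then show ?thesis
    by (simp add: walk_kernel_def Suc case_prod_beta)
qed

lemma measurable_walk_C:
  "(\<lambda>\<omega>. biased_walk.C \<beta> \<omega> 0 n (\<lambda>_. undefined)) \<in>
    GW P \<rightarrow>\<^sub>M subprob_algebra (PiM {0..<n} (\<lambda>_. count_space UNIV))"
proof (induction n)
  case 0
  have "(\<lambda>_. undefined) \<in> space (PiM {} (\<lambda>_. count_space (UNIV :: vertex set)))"
    by (simp add: space_PiM)
  then show ?case
    using measurable_space[OF return_measurable] by simp
next
  case (Suc n)
  have "(\<lambda>z. biased_walk.eP \<beta> (fst z) n (snd z)) \<in>
      GW P \<Otimes>\<^sub>M PiM {0..<n} (\<lambda>_. count_space UNIV) \<rightarrow>\<^sub>M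
        subprob_algebra (PiM {0..<Suc n} (\<lambda>_. count_space UNIV))"
    unfolding biased_walk.eP_def
  proof (rule measurable_distr2[where M="count_space UNIV"])
    show "(\<lambda>z. walk_kernel \<beta> (fst z) n (snd z)) \<in>
      GW P \<Otimes>\<^sub>M PiM {0..<n} (\<lambda>_. count_space UNIV) \<rightarrow>\<^sub>M subprob_algebra (count_space UNIV)"
      using measurable_walk_kernel[of \<beta> n P] by (simp add: case_prod_beta)
    show "(\<lambda>(z, y). (snd z)(n := y)) \<in> (GW P \<Otimes>\<^sub>M PiM {0..<n} (\<lambda>_. count_space UNIV))
        \<Otimes>\<^sub>M count_space UNIV \<rightarrow>\<^sub>M PiM {0..<Suc n} (\<lambda>_. count_space UNIV)"
      unfolding case_prod_beta
      by (intro measurable_fun_upd[where J="{0..<n}"]) (auto simp: measurable_compose[OF measurable_fst measurable_snd])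
  qed
  then show ?case
    using measurable_bind[OF Suc.IH, of "\<lambda>\<omega> X. biased_walk.eP \<beta> \<omega> n X"]
    by (simp add: case_prod_beta)
qed

lemma prob_space_walk: "prob_space (walk \<beta> \<omega>)"
  and sets_walk: "sets (walk \<beta> \<omega>) = sets (PiM UNIV (\<lambda>_. count_space UNIV))"
  and space_walk: "space (walk \<beta> \<omega>) = UNIV"
proof -
  have 1: "emeasure (walk \<beta> \<omega>) (prod_emb UNIV (\<lambda>_. count_space UNIV) {} (PiM_space))
       = 1" if "PiM_space = space (PiM {} (\<lambda>_. count_space UNIV))" for PiM_space :: "(nat \<Rightarrow> vertex) set"
    unfolding walk_def using that biased_walk.lim[of "{}" "PiM_space"]
      prob_space.emeasure_space_1[OF biased_walk.PF.prob_space_P[of "{}" \<beta> \<omega>]]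
    by (simp add: biased_walk.PF.space_P)
  show "sets (walk \<beta> \<omega>) = sets (PiM UNIV (\<lambda>_. count_space UNIV))"
    by (simp add: walk_def)
  show sp: "space (walk \<beta> \<omega>) = UNIV"
    by (simp add: walk_def space_PiM)
  show "prob_space (walk \<beta> \<omega>)"
  proof (rule prob_spaceI)
    have "prod_emb UNIV (\<lambda>_. count_space UNIV) {} (space (PiM {} (\<lambda>_. count_space UNIV)))
        = (UNIV :: (nat \<Rightarrow> vertex) set)"
      by (auto simp: prod_emb_def space_PiM restrict_def)
    then show "emeasure (walk \<beta> \<omega>) (space (walk \<beta> \<omega>)) = 1"
      using 1[OF refl] by (simp add: sp)
  qed
qed

lemma measurable_walk:
  "walk \<beta> \<in> GW P \<rightarrow>\<^sub>M subprob_algebra (PiM UNIV (\<lambda>_. count_space UNIV))"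
proof (rule measurable_subprob_algebra_generated[OF sets_PiM Int_stable_prod_algebra prod_algebra_sets_into_space])
  fix \<omega> assume "\<omega> \<in> space (GW P)"
  show "subprob_space (walk \<beta> \<omega>)"
    by (rule prob_space_imp_subprob_space[OF prob_space_walk])
  show "sets (walk \<beta> \<omega>) = sets (PiM UNIV (\<lambda>_. count_space UNIV))"
    by (rule sets_walk)
next
  fix A :: "(nat \<Rightarrow> vertex) set" assume "A \<in> prod_algebra UNIV (\<lambda>_. count_space UNIV)"
  then obtain J :: "nat set" and X where J: "finite J" and A: "A = prod_emb UNIV (\<lambda>_. count_space UNIV) J X"
    and X: "X \<in> sets (PiM J (\<lambda>_. count_space UNIV))"
    by (elim prod_algebraE) (blast intro: sets_PiM_I_finite)
  define n where "n = Suc (Max (insert 0 J))"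
  have n: "J \<subseteq> {0..<n}" using J by (auto simp: n_def less_Suc_eq_le)
  have "emeasure (walk \<beta> \<omega>) A = emeasure (biased_walk.C \<beta> \<omega> 0 n (\<lambda>_. undefined))
      (prod_emb {0..<n} (\<lambda>_. count_space UNIV) J X)" for \<omega>
    unfolding A walk_def by (simp add: biased_walk.lim[OF J X] biased_walk.emeasure_CI[OF n X])
  moreover have "prod_emb {0..<n} (\<lambda>_. count_space UNIV) J X \<in> sets (PiM {0..<n} (\<lambda>_. count_space UNIV))"
    using n X by (rule measurable_prod_emb)
  ultimately show "(\<lambda>\<omega>. emeasure (walk \<beta> \<omega>) A) \<in> borel_measurable (GW P)"
    by (simp add: measurable_emeasure_kernel[OF measurable_walk_C])
next
  have "emeasure (walk \<beta> \<omega>) UNIV = 1" for \<omega>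
    using prob_space.emeasure_space_1[OF prob_space_walk] by (simp add: space_walk)
  then show "(\<lambda>\<omega>. emeasure (walk \<beta> \<omega>) (\<Pi>\<^sub>E i\<in>UNIV. space (count_space UNIV))) \<in> borel_measurable (GW P)"
    by simp
qed



definition averaged_walk :: "real \<Rightarrow> nat pmf \<Rightarrow> (nat \<Rightarrow> vertex) measure" where
  "averaged_walk \<beta> P = GW P \<bind> walk \<beta>"

lemma prob_space_averaged_walk: "prob_space (averaged_walk \<beta> P)"
  unfolding averaged_walk_def
proof (rule prob_space.prob_space_bind[OF _ _ measurable_walk])
  show "prob_space (GW P)"
    unfolding GW_def by (intro prob_space_PiM measure_pmf.prob_space_axioms)
qed (simp add: prob_space_walk)

lemma AE_averaged_walk:
  assumes "Measurable.pred (PiM UNIV (\<lambda>_. count_space UNIV)) Q"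
  shows "(AE X in averaged_walk \<beta> P. Q X) \<longleftrightarrow> (AE \<omega> in GW P. AE X in walk \<beta> \<omega>. Q X)"
  unfolding averaged_walk_def by (rule AE_bind[OF measurable_walk assms])

definition speed :: "real \<Rightarrow> nat pmf \<Rightarrow> real" where
  "speed \<beta> P =
    (THE v. AE X in averaged_walk \<beta> P. (\<lambda>n. real (length (X n)) / real n) \<longlonglongrightarrow> v)"

definition stoch_dominates :: "nat pmf \<Rightarrow> nat pmf \<Rightarrow> bool" where
  "stoch_dominates P1 P2 \<longleftrightarrow>
    (\<forall>k. measure_pmf.prob P1 {k..} \<ge> measure_pmf.prob P2 {k..})"

definition monotone_coupling :: "(nat \<times> nat) pmf \<Rightarrow> nat pmf \<Rightarrow> nat pmf \<Rightarrow> bool" where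
  "monotone_coupling Q P1 P2 \<longleftrightarrow>
    map_pmf fst Q = P1 \<and> map_pmf snd Q = P2 \<and> (AE (z1, z2) in Q. z1 \<ge> z2)"

definition beta1 :: "real \<Rightarrow> nat pmf \<Rightarrow> nat pmf \<Rightarrow> (nat \<times> nat) pmf \<Rightarrow> real" where
  "beta1 c P1 P2 Q =
    (let d = measure_pmf.expectation Q (\<lambda>(z1, z2). 1 / real z2 - 1 / real z1)
     in c * min
       (measure_pmf.expectation (pair_pmf P1 P2)
          (\<lambda>(z1, z2). (1 / real z1 - 1 / real z2) * of_bool (z1 < z2)) / d)
       (measure_pmf.expectation Q (\<lambda>(z1, z2). real z2 * (1 / real z2 - 1 / real z1)) / d + 1))"

end

theory Submission
  imports Defs
begin

text \<open>
  The speed is compared through the frequency of backward steps. At a vertex with \<open>k\<close> children the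
  walk steps back with probability \<open>1 / (1 + \<beta> k)\<close>, which decreases in \<open>k\<close>, and the speed is
  \<open>1 - 2 b\<close> for the long-run frequency \<open>b\<close> of backward steps. A vertex that is seen for the first time
  shows a fresh offspring number, and there the dominating law wins by at least a constant multiple of
  \<open>d / (1 + \<beta>)\<close>, where \<open>d\<close> is the expectation of \<open>1 / Z2' - 1 / Z1'\<close>. A vertex that is seen again
  carries a biased offspring number, and there the order may be reversed. This is rare for large
  \<open>\<beta>\<close>, and it costs at most a constant multiple of \<open>1 / (1 + \<beta>)\<^sup>2\<close> times either of the two numerators
  in \<^const>\<open>beta1\<close>. So a large constant \<open>c\<close> makes the gain prevail.

  All steps use one source of randomness that serves every offspring number at once: independent marks
  at \<open>1, 2, 3, \<dots>\<close>, with a mark at \<open>j\<close> having probability \<open>\<beta> / (1 + \<beta> j)\<close>. A walk at a vertex with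
  \<open>k\<close> children goes to the child whose number is the largest marked \<open>j \<le> k\<close>, and back if there is none;
  the products telescope to the correct probabilities (\<open>prob_choice\<close>, \<open>distr_move\<close>). A mark at \<open>1\<close> forces
  a forward step for every \<open>k\<close>. So the marks at \<open>1\<close> drive a biased walk on the integers, the
  height, whose steps never exceed those of the walk on the tree (\<open>length_pos_diff\<close>). Two offspring
  numbers \<open>a \<le> b\<close> lead to different moves only if there is a mark in \<open>{a<..b}\<close>, which has probability
  at most \<open>1 - a / b\<close>.

  The offspring numbers are revealed along the walk: the vertex first visited at time \<open>i\<close> receives the
  \<open>i\<close>-th term of an i.i.d. sequence. This gives the averaged law (\<open>emeasure_averaged_walk\<close>), because an
  i.i.d. field that is read at new places, each chosen from what was read before, yields an i.i.d.
  sequence (\<open>distr_exploration\<close>).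

  A cut time is a time at which the height reaches a strict record and below which it does not fall
  later on. The walk on the tree is then at a new vertex whose subtree it does not leave, so that its
  future is a function of the later randomness alone (\<open>pos_shift\<close>). Counting gives at least as many cut
  times as steps minus three times the number of falls of the height (\<open>card_cuts_ge\<close>); as falls have
  probability \<open>p = 1 / (1 + \<beta>) \<le> 4 / 27\<close>, the time since the last cut time has exponential tails,
  and the tail bound carries an additional factor \<open>p\<close> (\<open>prob_no_cut\<close>).

  Hence the increments of the distance from the root are functions of the recent randomness up to
  exponentially small errors, their covariances decay exponentially, the variance of the distance at
  time \<open>n\<close> is of order \<open>n\<close>, and Chebyshev's inequality along the squares gives the strong law
  (\<open>speed_limit\<close>) and the formula for the speed (\<open>speed_eq_back_limit\<close>).

  For the comparison two walks use the same marks. If the height has a record at time \<open>n\<close>, both walks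
  are at new vertices and the gain is exact. Otherwise the walk with law \<open>P1\<close> may step back where the
  other does not. If the offspring sequences are independent, the two offspring numbers involved are
  among those revealed since the last cut time, and each pair of such times contributes the first
  numerator (\<open>prob_overtaken_uncoupled\<close>). If the offspring sequences are coupled monotonically, the
  walks have moved in parallel since the last cut time unless some mark has separated them, and each
  pair of times contributes the second numerator (\<open>prob_overtaken_coupled\<close>). The tail bound for cut
  times makes the sums over pairs a constant multiple of \<open>p\<close>.
\<close>

section \<open>Walks driven by marks, and cut times\<close>

text \<open>
  The largest marked number at most \<open>k\<close>, or \<open>0\<close> if there is none; \<open>e\<close> tells whether \<open>1\<close> is marked and
  \<open>v j\<close> whether \<open>j + 1\<close> is. The number \<open>1\<close> is treated apart because its mark drives the height below. The
  value at \<open>k = 0\<close> equals that at \<open>k = 1\<close>, so that a mark at \<open>1\<close> leads upwards for every \<open>k\<close>.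
\<close>

primrec pick :: "bool \<Rightarrow> (nat \<Rightarrow> bool) \<Rightarrow> nat \<Rightarrow> nat" where
  "pick e v 0 = (if e then 1 else 0)"
| "pick e v (Suc k) = (if k > 0 \<and> v k then Suc k else pick e v k)"

type_synonym noise = "bool \<times> (bool \<times> nat \<Rightarrow> bool)"

abbreviation choice :: "noise \<Rightarrow> nat \<Rightarrow> nat" where
  "choice w k \<equiv> pick (fst w) (\<lambda>j. snd w (False, j)) k"

text \<open>
  The root has no parent. A step back from it is replaced by a second choice with marks of probability
  \<open>1 / j\<close>, which is uniform on the children. In this way the root and the other vertices respond alike to
  the first family of marks, so that a walk may be restarted at any vertex as if it were the root.
\<close>

definition move :: "noise \<Rightarrow> nat \<Rightarrow> vertex \<Rightarrow> vertex" where
  "move w k x =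
    (if choice w k > 0 then x @ [choice w k - 1]
     else if x = [] then [pick True (\<lambda>j. snd w (True, j)) k - 1]
     else butlast x)"

lemma pick_pos: "e \<Longrightarrow> pick e v k > 0"
  by (induction k) auto

text \<open>
  More children never turn a forward step into a backward one: this is the monotonicity in the coupling of two walks by common marks.
\<close>

lemma pick_eq_0_antimono:
  assumes "pick e v k = 0" "l \<le> k"
  shows "pick e v l = 0"
  using assms(2,1) by (induction rule: dec_induct) (auto split: if_splits)

text \<open>
  The event that a given number is picked is a cylinder in the marks, so its probability is a product.
\<close>

lemma pick_eq_iff:
  "pick e v k = i \<longleftrightarrow>
    i \<le> max k 1 \<and> (if i \<le> 1 then e = (i = 1) else v (i - 1)) \<and> (\<forall>j\<in>{max i 1..<k}. \<not> v j)"
proof (induction k)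
  case 0
  then show ?case by auto
next
  case (Suc k)
  show ?case
  proof (cases "k > 0 \<and> v k")
    case True
    then show ?thesis by (cases "i = Suc k") (auto simp: max_def)
  next
    case False
    have "{max i 1..<Suc k} = {max i 1..<k} \<union> (if max i 1 \<le> k then {k} else {})"
      by auto
    then show ?thesis using False Suc.IH
      by (auto simp: le_Suc_eq max_def split: if_splits)
  qed
qed

lemma length_move:
  "length (move w k x) = Suc (length x) \<or> Suc (length (move w k x)) = length x"
  by (cases "x = []") (auto simp: move_def)

lemma length_move_up: "fst w \<Longrightarrow> length (move w k x) = Suc (length x)"
  by (auto simp: move_def pick_pos)

lemma length_move_eq:
  assumes "x \<noteq> []"
  shows "int (length (move w k x)) - int (length x) = 1 - 2 * of_bool (choice w k = 0)"
  using assms by (cases x rule: rev_cases) (auto simp: move_def)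

text \<open>
  The vertex first visited at time \<open>i\<close> gets \<open>z i\<close> children; \<open>z i\<close> is not looked at if the vertex
  visited at time \<open>i\<close> is old. The list of visited vertices is what the recursion has to remember.
\<close>

primrec hist :: "(nat \<Rightarrow> nat) \<Rightarrow> (nat \<Rightarrow> noise) \<Rightarrow> nat \<Rightarrow> vertex list" where
  "hist z V 0 = [[]]"
| "hist z V (Suc n) = hist z V n @
     [move (V n) (z (LEAST i. hist z V n ! i = last (hist z V n))) (last (hist z V n))]"

definition pos :: "(nat \<Rightarrow> nat) \<Rightarrow> (nat \<Rightarrow> noise) \<Rightarrow> nat \<Rightarrow> vertex" where
  "pos z V n = last (hist z V n)"

definition first_visit :: "(nat \<Rightarrow> nat) \<Rightarrow> (nat \<Rightarrow> noise) \<Rightarrow> nat \<Rightarrow> nat" where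
  "first_visit z V n = (LEAST i. pos z V i = pos z V n)"

lemma length_hist [simp]: "length (hist z V n) = Suc n"
  by (induction n) auto

lemma hist_nth: "i \<le> n \<Longrightarrow> hist z V n ! i = pos z V i"
proof (induction n)
  case (Suc n)
  then show ?case
    by (cases "i = Suc n") (auto simp: nth_append pos_def)
qed (simp add: pos_def)

lemma pos_0 [simp]: "pos z V 0 = []"
  by (simp add: pos_def)

lemma first_visit_le: "first_visit z V n \<le> n"
  unfolding first_visit_def by (rule Least_le) simp

lemma pos_first_visit: "pos z V (first_visit z V n) = pos z V n"
  unfolding first_visit_def by (rule LeastI[of _ n]) simp

lemma first_visit_less: "i < first_visit z V n \<Longrightarrow> pos z V i \<noteq> pos z V n"
  unfolding first_visit_def by (rule not_less_Least)

lemma first_visit_eqI: "pos z V i = pos z V n \<Longrightarrow> (\<And>j. j < i \<Longrightarrow> pos z V j \<noteq> pos z V n) \<Longrightarrow> first_visit z V n = i"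
  unfolding first_visit_def by (rule Least_equality) (auto simp: not_less[symmetric])

lemma first_visit_hist: "(LEAST i. hist z V n ! i = last (hist z V n)) = first_visit z V n"
proof (rule Least_equality)
  show "hist z V n ! first_visit z V n = last (hist z V n)"
    using first_visit_le pos_first_visit by (simp add: hist_nth flip: pos_def)
  show "first_visit z V n \<le> i" if "hist z V n ! i = last (hist z V n)" for i
  proof (rule ccontr)
    assume "\<not> first_visit z V n \<le> i"
    then have "i < first_visit z V n" by simp
    with that first_visit_less[OF this] first_visit_le[of z V n] show False
      by (simp add: hist_nth flip: pos_def)
  qed
qed

lemma pos_Suc: "pos z V (Suc n) = move (V n) (z (first_visit z V n)) (pos z V n)"
  by (simp add: pos_def first_visit_hist)

lemma pos_cong:
  assumes "\<And>i. i < n \<Longrightarrow> z i = z' i" "\<And>i. i < n \<Longrightarrow> V i = V' i"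
  shows "pos z V n = pos z' V' n"
proof -
  have "hist z V n = hist z' V' n"
    using assms
  proof (induction n)
    case (Suc n)
    have IH: "hist z V n = hist z' V' n" using Suc by simp
    have "first_visit z V n = first_visit z' V' n"
      using first_visit_hist[of z V n] first_visit_hist[of z' V' n] IH by simp
    moreover have "z (first_visit z V n) = z' (first_visit z V n)"
      using Suc.prems first_visit_le[of z V n] by simp
    ultimately show ?case
      using IH Suc.prems by (simp add: first_visit_hist)
  qed simp
  then show ?thesis by (simp add: pos_def)
qed

text \<open>
  The walk on the integers that goes up exactly when \<open>1\<close> is marked.
\<close>

definition height :: "(nat \<Rightarrow> bool) \<Rightarrow> nat \<Rightarrow> int" where
  "height e n = (\<Sum>s<n. if e s then 1 else - 1)"

lemma height_0 [simp]: "height e 0 = 0" by (simp add: height_def)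
lemma height_Suc: "height e (Suc n) = height e n + (if e n then 1 else - 1)" by (simp add: height_def)

text \<open>
  The condition refers to the heights up to a horizon \<open>N\<close> only, so that the events are determined by finitely
  many steps.
\<close>

definition cut_time :: "(nat \<Rightarrow> bool) \<Rightarrow> nat \<Rightarrow> nat \<Rightarrow> bool" where
  "cut_time e t N \<longleftrightarrow> t \<le> N \<and> (\<forall>s<t. height e s < height e t) \<and> (\<forall>s. t \<le> s \<and> s \<le> N \<longrightarrow> height e t \<le> height e s)"

lemma height_shift: "height e (a + n) = height e a + height (\<lambda>s. e (a + s)) n"
  by (induction n) (auto simp: height_Suc)

lemma cut_time_shift:
  assumes "cut_time e t N" "a \<le> t"
  shows "cut_time (\<lambda>s. e (a + s)) (t - a) (N - a)"
  unfolding cut_time_def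
proof (intro conjI allI impI)
  have h: "height (\<lambda>s. e (a + s)) n = height e (a + n) - height e a" for n
    using height_shift[of e a n] by simp
  have *: "t \<le> N" "\<And>s. s < t \<Longrightarrow> height e s < height e t" "\<And>s. t \<le> s \<Longrightarrow> s \<le> N \<Longrightarrow> height e t \<le> height e s"
    using assms unfolding cut_time_def by auto
  show "t - a \<le> N - a" using * by simp
  show "height (\<lambda>s. e (a + s)) s < height (\<lambda>s. e (a + s)) (t - a)" if "s < t - a" for s
    using that assms(2) *(2)[of "a + s"] by (simp add: h)
  show "height (\<lambda>s. e (a + s)) (t - a) \<le> height (\<lambda>s. e (a + s)) s" if "t - a \<le> s \<and> s \<le> N - a" for s
    using that assms(2) *(1) *(3)[of "a + s"] by (auto simp: h)
qed

abbreviation up :: "(nat \<Rightarrow> noise) \<Rightarrow> nat \<Rightarrow> bool" where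
  "up V \<equiv> \<lambda>s. fst (V s)"

text \<open>
  The height rises only where the walk on the tree moves away from the root, whatever the offspring numbers are.
\<close>

lemma length_pos_diff:
  assumes "a \<le> b"
  shows "height (up V) b - height (up V) a \<le> int (length (pos z V b)) - int (length (pos z V a))"
  using assms
proof (induction rule: dec_induct)
  case (step n)
  then show ?case
    using length_move[of "V n" "z (first_visit z V n)" "pos z V n"]
      length_move_up[of "V n" "z (first_visit z V n)" "pos z V n"]
    by (auto simp: pos_Suc height_Suc)
qed simp

text \<open>
  After a cut time the walk on the tree is deeper than at any time before it, so it does not meet an old vertex.
\<close>

lemma first_visit_ge_cut:
  assumes "cut_time (up V) t N" "t \<le> n" "n \<le> N"
  shows "t \<le> first_visit z V n"
proof (rule ccontr)
  assume "\<not> t \<le> first_visit z V n"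
  then have lt: "first_visit z V n < t" by simp
  have "height (up V) (first_visit z V n) < height (up V) t" "height (up V) t \<le> height (up V) n"
    using assms lt unfolding cut_time_def by auto
  with length_pos_diff[of "first_visit z V n" n V z] first_visit_le[of z V n] show False
    by (simp add: pos_first_visit)
qed

lemma first_visit_record: "cut_time (up V) n n \<Longrightarrow> first_visit z V n = n"
  using first_visit_ge_cut[of V n n n z] first_visit_le[of z V n] by simp

text \<open>
  After a cut time \<open>t\<close> the walk stays in the subtree of \<open>pos z V t\<close>, in which it has not been before. So it
  follows the walk that starts from the root with the randomness used from time \<open>t\<close> on.
\<close>

lemma pos_shift:
  assumes cut_time: "cut_time (up V) t N" and "t + s \<le> N"
  shows "pos z V (t + s) = pos z V t @ pos (\<lambda>i. z (t + i)) (\<lambda>i. V (t + i)) s"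
  using assms(2)
proof (induction s rule: less_induct)
  case (less s)
  let ?z = "\<lambda>i. z (t + i)" and ?V = "\<lambda>i. V (t + i)"
  show ?case
  proof (cases s)
    case (Suc r)
    have IH: "pos z V (t + i) = pos z V t @ pos ?z ?V i" if "i \<le> r" for i
      using less that Suc by simp
    have first_visit: "first_visit z V (t + r) = t + first_visit ?z ?V r"
    proof (rule first_visit_eqI)
      show "pos z V (t + first_visit ?z ?V r) = pos z V (t + r)"
        using IH[of "first_visit ?z ?V r"] IH[of r] first_visit_le[of ?z ?V r] pos_first_visit[of ?z ?V r] by simp
      show "pos z V j \<noteq> pos z V (t + r)" if "j < t + first_visit ?z ?V r" for j
      proof (cases "j < t")
        case True
        then show ?thesis
          using first_visit_ge_cut[OF cut_time, of "t + r" z] less.prems Suc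
          by (metis Suc_leD add_Suc_right first_visit_less le_add1 order_less_le_trans)
      next
        case False
        then have j: "j = t + (j - t)" "j - t < first_visit ?z ?V r" using that by auto
        with IH[of "j - t"] IH[of r] first_visit_le[of ?z ?V r] first_visit_less[OF j(2)] show ?thesis
          by simp
      qed
    qed
    have "pos z V (t + s) = move (V (t + r)) (z (t + first_visit ?z ?V r)) (pos z V t @ pos ?z ?V r)"
      using Suc IH[of r] by (simp add: pos_Suc first_visit)
    also have "\<dots> = pos z V t @ move (V (t + r)) (z (t + first_visit ?z ?V r)) (pos ?z ?V r)"
    proof (cases "choice (V (t + r)) (z (t + first_visit ?z ?V r)) > 0 \<or> pos ?z ?V r \<noteq> [] \<or> pos z V t = []")
      case True
      then show ?thesis by (auto simp: move_def butlast_append)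
    next
      case False
      have "height (up V) t \<le> height (up V) (t + s)"
        using cut_time less.prems unfolding cut_time_def by auto
      (* A step back from the vertex reached at the cut time would take the walk above it, where the height does not allow it to be. *)
      then have "length (pos z V t) \<le> length (pos z V (t + s))"
        using length_pos_diff[of t "t + s" V z] by simp
      moreover have "length (pos z V (t + s)) < length (pos z V t)"
        using False Suc IH[of r] by (auto simp: pos_Suc first_visit move_def)
      ultimately show ?thesis by simp
    qed
    also have "\<dots> = pos z V t @ pos ?z ?V s"
      by (simp add: Suc pos_Suc)
    finally show ?thesis .
  qed simp
qed

lemma first_visit_shift:
  assumes cut_time: "cut_time (up V) t N" and le: "t + r \<le> N"
  shows "first_visit z V (t + r) = t + first_visit (\<lambda>i. z (t + i)) (\<lambda>i. V (t + i)) r"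
proof (rule first_visit_eqI)
  let ?z = "\<lambda>i. z (t + i)" and ?V = "\<lambda>i. V (t + i)"
  note P = pos_shift[OF cut_time, of _ z]
  show "pos z V (t + first_visit ?z ?V r) = pos z V (t + r)"
    using P[of "first_visit ?z ?V r"] P[of r] first_visit_le[of ?z ?V r] pos_first_visit[of ?z ?V r] le by simp
  show "pos z V j \<noteq> pos z V (t + r)" if "j < t + first_visit ?z ?V r" for j
  proof (cases "j < t")
    case True
    then show ?thesis
      using first_visit_ge_cut[OF cut_time, of "t + r" z] le first_visit_less[of j z V "t + r"] by simp
  next
    case False
    then have j: "j = t + (j - t)" "j - t < first_visit ?z ?V r" using that by auto
    with P[of "j - t"] P[of r] first_visit_le[of ?z ?V r] first_visit_less[OF j(2)] le show ?thesis
      by simp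
  qed
qed

text \<open>
  The distance of the height below its running maximum.
\<close>

primrec gap :: "(nat \<Rightarrow> bool) \<Rightarrow> nat \<Rightarrow> nat" where
  "gap e 0 = 0"
| "gap e (Suc n) = (if e n then gap e n - 1 else Suc (gap e n))"

definition falls :: "(nat \<Rightarrow> bool) \<Rightarrow> nat \<Rightarrow> nat \<Rightarrow> nat" where
  "falls e a N = card {s. a \<le> s \<and> s < N \<and> \<not> e s}"

lemma falls_Suc: "a \<le> N \<Longrightarrow> falls e a (Suc N) = falls e a N + (if e N then 0 else 1)"
proof (cases "e N")
  case True
  then have "{s. a \<le> s \<and> s < Suc N \<and> \<not> e s} = {s. a \<le> s \<and> s < N \<and> \<not> e s}"
    by (auto simp: less_Suc_eq)
  with True show ?thesis unfolding falls_def by presburger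
next
  assume "a \<le> N"
  case False
  with \<open>a \<le> N\<close> have "{s. a \<le> s \<and> s < Suc N \<and> \<not> e s} = insert N {s. a \<le> s \<and> s < N \<and> \<not> e s}"
    by (auto simp: less_Suc_eq)
  moreover have "card (insert N {s. a \<le> s \<and> s < N \<and> \<not> e s}) = Suc (card {s. a \<le> s \<and> s < N \<and> \<not> e s})"
    by (rule card_insert_disjoint) auto
  ultimately show ?thesis using False unfolding falls_def by presburger
qed

lemma height_le_gap: "s \<le> n \<Longrightarrow> height e s \<le> height e n + int (gap e n)"
proof (induction n)
  case (Suc n)
  show ?case
  proof (cases "s = Suc n")
    case False
    with Suc have "height e s \<le> height e n + int (gap e n)" by simp
    then show ?thesis by (auto simp: height_Suc)
  qed simp
qed simp

lemma gap_attained: "\<exists>s\<le>n. height e s = height e n + int (gap e n)"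
proof (induction n)
  case (Suc n)
  then obtain s where s: "s \<le> n" "height e s = height e n + int (gap e n)" by auto
  show ?case
  proof (cases "e n \<and> gap e n = 0")
    case True
    then show ?thesis by (intro exI[of _ "Suc n"]) simp
  next
    case False
    then show ?thesis using s by (intro exI[of _ s]) (auto simp: height_Suc)
  qed
qed simp

lemma record_Suc_iff: "cut_time e (Suc n) (Suc n) \<longleftrightarrow> gap e n = 0 \<and> e n"
proof
  assume "cut_time e (Suc n) (Suc n)"
  then have *: "\<And>s. s \<le> n \<Longrightarrow> height e s < height e (Suc n)"
    unfolding cut_time_def by auto
  from *[of n] have "e n" by (auto simp: height_Suc split: if_splits)
  moreover from gap_attained[of n e] obtain s where s: "s \<le> n" "height e s = height e n + int (gap e n)" by auto
  with *[OF s(1)] \<open>e n\<close> have "gap e n = 0" by (simp add: height_Suc)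
  ultimately show "gap e n = 0 \<and> e n" by simp
next
  assume *: "gap e n = 0 \<and> e n"
  then have "height e s < height e (Suc n)" if "s \<le> n" for s
    using height_le_gap[OF that, of e] by (simp add: height_Suc)
  then show "cut_time e (Suc n) (Suc n)" unfolding cut_time_def by (auto simp: less_Suc_eq_le)
qed

text \<open>
  By induction on \<open>N\<close>: an upward step creates a cut time if the gap is \<open>0\<close> and else reduces the gap; a
  downward step increases the gap by one and destroys at most one cut time, as a height is reached as a
  record only once. The factor \<open>3\<close> pays for the step itself, the gap and the lost cut time.
\<close>

lemma card_cuts_ge:
  assumes "a \<le> N"
  shows "int (N - a) + int (gap e N) \<le>
    int (card {t. a < t \<and> cut_time e t N}) + 3 * int (falls e a N) + int (gap e a)"
  using assms
proof (induction rule: dec_induct)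
  case base
  then show ?case by simp
next
  case (step N)
  let ?R = "\<lambda>N. {t. a < t \<and> cut_time e t N}"
  have fin: "finite (?R N)" for N
    by (rule finite_subset[of _ "{..N}"]) (auto simp: cut_time_def)
  have N: "Suc N - a = Suc (N - a)" using step by simp
  show ?case
  proof (cases "e N")
    case True
    have sub: "?R N \<subseteq> ?R (Suc N)"
    proof safe
      fix t assume t: "a < t" "cut_time e t N"
      then have "height e t \<le> height e N" unfolding cut_time_def by auto
      then show "cut_time e t (Suc N)" using t True unfolding cut_time_def by (auto simp: height_Suc le_Suc_eq)
    qed
    show ?thesis
    proof (cases "gap e N = 0")
      case gap0: True
      have "insert (Suc N) (?R N) \<subseteq> ?R (Suc N)"
        using sub record_Suc_iff[of e N] gap0 True step by auto
      then have "card (insert (Suc N) (?R N)) \<le> card (?R (Suc N))"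
        by (intro card_mono fin)
      moreover have "card (insert (Suc N) (?R N)) = Suc (card (?R N))"
        using fin by (subst card_insert_disjoint) (auto simp: cut_time_def)
      ultimately show ?thesis using step True gap0 N by (simp add: falls_Suc)
    next
      case False
      with card_mono[OF fin sub] show ?thesis using step True N by (simp add: falls_Suc)
    qed
  next
    case False
    have sub: "?R N - {t. cut_time e t N \<and> height e t = height e N} \<subseteq> ?R (Suc N)"
    proof safe
      fix t assume t: "a < t" "cut_time e t N" "height e t \<noteq> height e N"
      then have "height e t \<le> height e N" unfolding cut_time_def by auto
      then show "cut_time e t (Suc N)" using t False unfolding cut_time_def by (auto simp: height_Suc le_Suc_eq)
    qed
    have "card {t. cut_time e t N \<and> height e t = height e N} \<le> 1"
    proof (rule card_le_Suc0_iff_eq[THEN iffD2, folded One_nat_def])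
      show "finite {t. cut_time e t N \<and> height e t = height e N}"
        by (rule finite_subset[of _ "{..N}"]) (auto simp: cut_time_def)
      show "\<forall>x\<in>{t. cut_time e t N \<and> height e t = height e N}. \<forall>y\<in>{t. cut_time e t N \<and> height e t = height e N}. x = y"
        by (auto simp: cut_time_def) (metis linorder_neqE_nat less_irrefl)
    qed
    moreover have "card (?R N) \<le> card (?R N - {t. cut_time e t N \<and> height e t = height e N}) + card {t. cut_time e t N \<and> height e t = height e N}"
      using diff_card_le_card_Diff[of "{t. cut_time e t N \<and> height e t = height e N}" "?R N"]
        finite_subset[of "{t. cut_time e t N \<and> height e t = height e N}" "{..N}"]
      by (auto simp: cut_time_def)
    ultimately have "card (?R N) \<le> Suc (card (?R (Suc N)))"
      using card_mono[OF fin sub] by simp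
    then show ?thesis using step False N by (simp add: falls_Suc)
  qed
qed

definition no_cut :: "(nat \<Rightarrow> bool) \<Rightarrow> nat \<Rightarrow> nat \<Rightarrow> bool" where
  "no_cut e a N \<longleftrightarrow> (\<forall>t. a < t \<longrightarrow> \<not> cut_time e t N)"

lemma no_cut_imp:
  assumes "no_cut e a N" "a \<le> N"
  shows "N - a \<le> 3 * falls e a N + gap e a"
proof -
  have "{t. a < t \<and> cut_time e t N} = {}" using assms unfolding no_cut_def by auto
  then have "card {t. a < t \<and> cut_time e t N} = 0" by (simp only: card.empty)
  with card_cuts_ge[OF assms(2), of e] show ?thesis by linarith
qed

text \<open>
  One of the cut times may be the horizon \<open>Suc n\<close> itself; this costs the one step by which the
  bound is weaker than in \<open>no_cut_imp\<close>.
\<close>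

lemma cut_before_last:
  assumes "a \<le> n" "\<And>t. a < t \<Longrightarrow> t \<le> n \<Longrightarrow> \<not> cut_time e t (Suc n)"
  shows "n - a \<le> 3 * falls e a (Suc n) + gap e a"
proof -
  have "{t. a < t \<and> cut_time e t (Suc n)} \<subseteq> {Suc n}"
  proof safe
    fix t assume t: "a < t" "cut_time e t (Suc n)"
    then have "t \<le> Suc n" by (simp add: cut_time_def)
    with assms(2)[OF t(1)] t(2) show "t = Suc n" by (meson le_Suc_eq)
  qed
  then have "card {t. a < t \<and> cut_time e t (Suc n)} \<le> 1"
    using card_mono[of "{Suc n}"] by simp
  with card_cuts_ge[of a "Suc n" e] assms(1) show ?thesis by linarith
qed

lemma gap_cong: "(\<And>s. s < n \<Longrightarrow> e s = e' s) \<Longrightarrow> gap e n = gap e' n"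
  by (induction n) auto

lemma height_cong: "(\<And>s. s < n \<Longrightarrow> e s = e' s) \<Longrightarrow> height e n = height e' n"
  by (induction n) (auto simp: height_Suc)

lemma cut_time_cong: "(\<And>s. s < N \<Longrightarrow> e s = e' s) \<Longrightarrow> cut_time e t N = cut_time e' t N"
proof -
  assume a: "\<And>s. s < N \<Longrightarrow> e s = e' s"
  have "height e s = height e' s" if "s \<le> N" for s using a that by (intro height_cong) auto
  then show ?thesis unfolding cut_time_def by auto
qed

lemma no_cut_cong: "(\<And>s. s < N \<Longrightarrow> e s = e' s) \<Longrightarrow> no_cut e a N = no_cut e' a N"
  unfolding no_cut_def using cut_time_cong[of N e e'] by auto

lemma no_cut_antimono: "no_cut e a N \<Longrightarrow> a \<le> b \<Longrightarrow> no_cut e b N"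
  unfolding no_cut_def by auto

lemma falls_cong: "(\<And>s. s < N \<Longrightarrow> e s = e' s) \<Longrightarrow> falls e a N = falls e' a N"
  unfolding falls_def by (rule arg_cong[of _ _ card]) auto

section \<open>Sequences of independent random variables\<close>

text \<open>
  A sequence of independent pairs is a pair of independent sequences. This allows to integrate over one
  component of all steps while the other one is kept fixed.
\<close>

lemma PiM_zip:
  fixes M :: "'a measure" and N :: "'b measure"
  assumes M: "prob_space M" and N: "prob_space N"
  shows "distr (PiM (UNIV :: 'i set) (\<lambda>_. M) \<Otimes>\<^sub>M PiM UNIV (\<lambda>_. N)) (PiM UNIV (\<lambda>_. M \<Otimes>\<^sub>M N))
           (\<lambda>(f, g) i. (f i, g i)) = PiM UNIV (\<lambda>_. M \<Otimes>\<^sub>M N)"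
proof -
  interpret M: prob_space M by fact
  interpret N: prob_space N by fact
  interpret MN: pair_prob_space M N ..
  interpret PM: product_prob_space "\<lambda>_::'i. M" UNIV
    by (intro product_prob_spaceI) fact
  interpret PN: product_prob_space "\<lambda>_::'i. N" UNIV
    by (intro product_prob_spaceI) fact
  interpret PMN: product_prob_space "\<lambda>_::'i. M \<Otimes>\<^sub>M N" UNIV
    by (intro product_prob_spaceI) (rule MN.prob_space_axioms)
  let ?S = "PiM (UNIV :: 'i set) (\<lambda>_. M)" and ?T = "PiM (UNIV :: 'i set) (\<lambda>_. N)"
  let ?zip = "\<lambda>(f :: 'i \<Rightarrow> 'a, g :: 'i \<Rightarrow> 'b) i. (f i, g i)"
  have zip: "?zip \<in> ?S \<Otimes>\<^sub>M ?T \<rightarrow>\<^sub>M PiM UNIV (\<lambda>_. M \<Otimes>\<^sub>M N)"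
    unfolding case_prod_beta
    by (rule measurable_PiM_single') (auto simp: space_PiM space_pair_measure)
  show ?thesis
  proof (rule PMN.PiM_eq)
    fix J :: "'i set" and F :: "'i \<Rightarrow> ('a \<times> 'b) set"
    assume J: "finite J" and F: "\<And>j. j \<in> J \<Longrightarrow> F j \<in> sets (M \<Otimes>\<^sub>M N)"
    let ?X = "prod_emb UNIV (\<lambda>_. M \<Otimes>\<^sub>M N) J (PiE J F)"
    have X: "?X \<in> sets (PiM UNIV (\<lambda>_. M \<Otimes>\<^sub>M N))"
      using J F by (intro sets_PiM_I) auto
    let ?A = "?zip -` ?X \<inter> space (?S \<Otimes>\<^sub>M ?T)"
    have A: "?A \<in> sets (?S \<Otimes>\<^sub>M ?T)"
      using zip X by (rule measurable_sets)
    have restr: "(\<lambda>f. restrict f J) \<in> ?S \<rightarrow>\<^sub>M PiM J (\<lambda>_. M)"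
      by (rule measurable_restrict_subset) simp
    have prod_m: "(\<lambda>f. \<Prod>j\<in>J. emeasure N (Pair (f j) -` F j)) \<in> borel_measurable (PiM J (\<lambda>_. M))"
      using F by (intro borel_measurable_prod_ennreal measurable_compose[OF measurable_component_singleton N.measurable_emeasure_Pair]) auto
    have "emeasure (distr (?S \<Otimes>\<^sub>M ?T) (PiM UNIV (\<lambda>_. M \<Otimes>\<^sub>M N)) ?zip) ?X = emeasure (?S \<Otimes>\<^sub>M ?T) ?A"
      using zip X by (rule emeasure_distr)
    also have "\<dots> = (\<integral>\<^sup>+f. emeasure ?T (Pair f -` ?A) \<partial>?S)"
      using A by (rule PN.emeasure_pair_measure_alt)
    also have "\<dots> = (\<integral>\<^sup>+f. (\<Prod>j\<in>J. emeasure N (Pair (f j) -` F j)) \<partial>?S)"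
    proof (rule nn_integral_cong)
      fix f assume f: "f \<in> space ?S"
      have "Pair f -` ?A = {g \<in> space ?T. \<forall>j\<in>J. g j \<in> Pair (f j) -` F j}"
        using f by (auto simp: prod_emb_def space_PiM space_pair_measure PiE_iff)
      also have "emeasure ?T \<dots> = (\<Prod>j\<in>J. emeasure N (Pair (f j) -` F j))"
        using F J by (intro PN.emeasure_PiM_Collect) (auto intro!: sets_Pair1)
      finally show "emeasure ?T (Pair f -` ?A) = (\<Prod>j\<in>J. emeasure N (Pair (f j) -` F j))" .
    qed
    also have "\<dots> = (\<integral>\<^sup>+f. (\<Prod>j\<in>J. emeasure N (Pair (restrict f J j) -` F j)) \<partial>?S)"
      by (intro nn_integral_cong prod.cong) auto
    also have "\<dots> = (\<integral>\<^sup>+f. (\<Prod>j\<in>J. emeasure N (Pair (f j) -` F j)) \<partial>distr ?S (PiM J (\<lambda>_. M)) (\<lambda>f. restrict f J))"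
      using prod_m by (intro nn_integral_distr[OF restr, symmetric]) simp
    also have "distr ?S (PiM J (\<lambda>_. M)) (\<lambda>f. restrict f J) = PiM J (\<lambda>_. M)"
      by (rule PM.distr_PiM_restrict_finite[OF J subset_UNIV])
    also have "(\<integral>\<^sup>+f. (\<Prod>j\<in>J. emeasure N (Pair (f j) -` F j)) \<partial>PiM J (\<lambda>_. M)) =
        (\<Prod>j\<in>J. \<integral>\<^sup>+x. emeasure N (Pair x -` F j) \<partial>M)"
      using J F by (intro PM.product_nn_integral_prod N.measurable_emeasure_Pair)
    also have "\<dots> = (\<Prod>j\<in>J. emeasure (M \<Otimes>\<^sub>M N) (F j))"
      using F by (intro prod.cong refl N.emeasure_pair_measure_alt[symmetric])
    finally show "emeasure (distr (?S \<Otimes>\<^sub>M ?T) (PiM UNIV (\<lambda>_. M \<Otimes>\<^sub>M N)) ?zip) ?X =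
        (\<Prod>j\<in>J. emeasure (M \<Otimes>\<^sub>M N) (F j))" .
  qed simp
qed

lemma PiM_map:
  assumes M: "prob_space M" and f: "f \<in> M \<rightarrow>\<^sub>M N"
  shows "distr (PiM (UNIV :: 'i set) (\<lambda>_. M)) (PiM UNIV (\<lambda>_. N)) (\<lambda>\<omega> i. f (\<omega> i)) =
    PiM UNIV (\<lambda>_. distr M N f)"
proof -
  interpret M: prob_space M by fact
  interpret PM: product_prob_space "\<lambda>_::'i. M" UNIV
    by (intro product_prob_spaceI) fact
  interpret PN: product_prob_space "\<lambda>_::'i. distr M N f" UNIV
    by (intro product_prob_spaceI M.prob_space_distr f)
  have m: "(\<lambda>\<omega> i. f (\<omega> i)) \<in> PiM (UNIV :: 'i set) (\<lambda>_. M) \<rightarrow>\<^sub>M PiM UNIV (\<lambda>_. N)"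
    using f by (intro measurable_PiM_single') (auto simp: space_PiM dest: measurable_space)
  show ?thesis
  proof (rule PN.PiM_eq)
    show "sets (distr (PiM UNIV (\<lambda>_. M)) (PiM UNIV (\<lambda>_. N)) (\<lambda>\<omega> i. f (\<omega> i))) =
        sets (PiM (UNIV :: 'i set) (\<lambda>_. distr M N f))"
      by (simp cong: sets_PiM_cong)
    fix J :: "'i set" and F
    assume J: "finite J" and F: "\<And>j. j \<in> J \<Longrightarrow> F j \<in> sets (distr M N f)"
    let ?X = "prod_emb UNIV (\<lambda>_. distr M N f) J (PiE J F)"
    have X: "?X \<in> sets (PiM (UNIV :: 'i set) (\<lambda>_. N))"
    proof -
      have "?X = prod_emb UNIV (\<lambda>_. N) J (PiE J F)" by (simp add: prod_emb_def)
      then show ?thesis using J F by (auto intro!: sets_PiM_I)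
    qed
    have "emeasure (distr (PiM UNIV (\<lambda>_. M)) (PiM UNIV (\<lambda>_. N)) (\<lambda>\<omega> i. f (\<omega> i))) ?X =
      emeasure (PiM UNIV (\<lambda>_. M)) {\<omega> \<in> space (PiM UNIV (\<lambda>_. M)). \<forall>j\<in>J. \<omega> j \<in> f -` F j \<inter> space M}"
      using measurable_space[OF f]
      by (subst emeasure_distr[OF m X], intro arg_cong[of _ _ "emeasure _"])
         (auto simp: prod_emb_def space_PiM PiE_iff)
    also have "\<dots> = (\<Prod>j\<in>J. emeasure M (f -` F j \<inter> space M))"
      using F J f by (intro PM.emeasure_PiM_Collect) (auto intro: measurable_sets)
    also have "\<dots> = (\<Prod>j\<in>J. emeasure (distr M N f) (F j))"
      using F f by (intro prod.cong refl) (simp add: emeasure_distr)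
    finally show "emeasure (distr (PiM UNIV (\<lambda>_. M)) (PiM UNIV (\<lambda>_. N)) (\<lambda>\<omega> i. f (\<omega> i))) ?X =
      (\<Prod>j\<in>J. emeasure (distr M N f) (F j))" .
  qed
qed

context sequence_space
begin

lemma shift_measurable: "(\<lambda>\<omega> i. \<omega> (n + i)) \<in> S \<rightarrow>\<^sub>M S"
  by (rule measurable_PiM_single') (auto simp: space_PiM)

text \<open>
  A function of the first coordinates is independent of every function of the later ones: the sequence is cut in two by \<open>comb_seq\<close>.
\<close>

lemma integral_past_future:
  fixes F G :: "(nat \<Rightarrow> 'a) \<Rightarrow> real"
  assumes [measurable]: "F \<in> borel_measurable S" "G \<in> borel_measurable S"
    and F: "\<And>\<omega>. \<bar>F \<omega>\<bar> \<le> B" and G: "\<And>\<omega>. \<bar>G \<omega>\<bar> \<le> C"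
    and dep: "\<And>\<omega> \<omega>'. (\<And>i. i < n \<Longrightarrow> \<omega> i = \<omega>' i) \<Longrightarrow> F \<omega> = F \<omega>'"
  shows "(\<integral>\<omega>. F \<omega> * G (\<lambda>i. \<omega> (n + i)) \<partial>S) = (\<integral>\<omega>. F \<omega> \<partial>S) * (\<integral>\<omega>. G \<omega> \<partial>S)"
proof -
  note [measurable] = shift_measurable[of n]
  interpret SS: pair_prob_space S S ..
  have B: "0 \<le> B" using F[of undefined] by linarith
  have "(\<integral>\<omega>. F \<omega> * G (\<lambda>i. \<omega> (n + i)) \<partial>S) =
      (\<integral>\<omega>. F \<omega> * G (\<lambda>i. \<omega> (n + i)) \<partial>distr (S \<Otimes>\<^sub>M S) S (\<lambda>(\<omega>, \<omega>'). comb_seq n \<omega> \<omega>'))"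
    by (simp only: PiM_comb_seq)
  also have "\<dots> = (\<integral>p. F (fst p) * G (snd p) \<partial>(S \<Otimes>\<^sub>M S))"
  proof (subst integral_distr)
    have "F (comb_seq n \<omega> \<omega>') = F \<omega>" for \<omega> \<omega>'
      by (rule dep) (simp add: comb_seq_less)
    moreover have "(\<lambda>i. comb_seq n \<omega> \<omega>' (n + i)) = \<omega>'" for \<omega> \<omega>' :: "nat \<Rightarrow> 'a"
      by (simp add: comb_seq_def)
    ultimately show "(\<integral>x. F (case x of (\<omega>, \<omega>') \<Rightarrow> comb_seq n \<omega> \<omega>') *
        G (\<lambda>i. (case x of (\<omega>, \<omega>') \<Rightarrow> comb_seq n \<omega> \<omega>') (n + i)) \<partial>(S \<Otimes>\<^sub>M S)) =
      (\<integral>p. F (fst p) * G (snd p) \<partial>(S \<Otimes>\<^sub>M S))"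
      by (intro Bochner_Integration.integral_cong) (auto simp: case_prod_beta)
  qed (measurable)
  also have "\<dots> = (\<integral>\<omega>. \<integral>\<omega>'. F \<omega> * G \<omega>' \<partial>S \<partial>S)"
  proof (subst SS.integral_fst'[symmetric])
    show "integrable (S \<Otimes>\<^sub>M S) (\<lambda>p. F (fst p) * G (snd p))"
      using F G B
      by (intro SS.P.integrable_const_bound[of _ "B * C"])
         (auto simp: abs_mult intro!: AE_I2 mult_mono)
  qed simp
  also have "\<dots> = (\<integral>\<omega>. F \<omega> \<partial>S) * (\<integral>\<omega>. G \<omega> \<partial>S)"
    by simp
  finally show ?thesis .
qed

lemma integral_shift:
  fixes G :: "(nat \<Rightarrow> 'a) \<Rightarrow> real"
  assumes "G \<in> borel_measurable S" "\<And>\<omega>. \<bar>G \<omega>\<bar> \<le> C"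
  shows "(\<integral>\<omega>. G (\<lambda>i. \<omega> (n + i)) \<partial>S) = (\<integral>\<omega>. G \<omega> \<partial>S)"
  using integral_past_future[of "\<lambda>_. 1" G 1 C n] assms by (simp add: P.prob_space)

lemma integral_past_next:
  fixes F :: "(nat \<Rightarrow> 'a) \<Rightarrow> real" and g :: "'a \<Rightarrow> real"
  assumes F [measurable]: "F \<in> borel_measurable S" and g [measurable]: "g \<in> borel_measurable M"
    and FB: "\<And>\<omega>. \<bar>F \<omega>\<bar> \<le> B" and gC: "\<And>x. \<bar>g x\<bar> \<le> C"
    and dep: "\<And>\<omega> \<omega>'. (\<And>i. i < n \<Longrightarrow> \<omega> i = \<omega>' i) \<Longrightarrow> F \<omega> = F \<omega>'"
  shows "(\<integral>\<omega>. F \<omega> * g (\<omega> n) \<partial>S) = (\<integral>\<omega>. F \<omega> \<partial>S) * (\<integral>x. g x \<partial>M)"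
proof -
  have "(\<integral>\<omega>. F \<omega> * g (\<omega> n) \<partial>S) = (\<integral>\<omega>. F \<omega> \<partial>S) * (\<integral>\<omega>. g (\<omega> 0) \<partial>S)"
    using integral_past_future[OF F _ FB _ dep, of "\<lambda>\<omega>. g (\<omega> 0)" C] gC by simp
  also have "(\<integral>\<omega>. g (\<omega> 0) \<partial>S) = (\<integral>x. g x \<partial>distr S M (\<lambda>\<omega>. \<omega> 0))"
    by (subst integral_distr) auto
  also have "distr S M (\<lambda>\<omega>. \<omega> 0) = M"
    using PiM_component[of 0] by simp
  finally show ?thesis .
qed

end

section \<open>The law of the marks\<close>

text \<open>
  The pair \<open>(b, j)\<close> stands for the number \<open>j + 1\<close>, in the family of marks used at the root if \<open>b\<close> and in
  the general family otherwise.
\<close>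

definition mark_prob :: "real \<Rightarrow> bool \<times> nat \<Rightarrow> real" where
  "mark_prob \<beta> = (\<lambda>(b, j). if b then 1 / real (j + 1) else \<beta> / (1 + \<beta> * real (j + 1)))"

definition marks :: "real \<Rightarrow> (bool \<times> nat \<Rightarrow> bool) measure" where
  "marks \<beta> = PiM UNIV (\<lambda>i. measure_pmf (bernoulli_pmf (mark_prob \<beta> i)))"

definition noise :: "real \<Rightarrow> noise measure" where
  "noise \<beta> = measure_pmf (bernoulli_pmf (\<beta> / (1 + \<beta>))) \<Otimes>\<^sub>M marks \<beta>"

lemma mark_prob_range: "\<beta> > 0 \<Longrightarrow> 0 \<le> mark_prob \<beta> i \<and> mark_prob \<beta> i \<le> 1"
  by (auto simp: mark_prob_def divide_le_eq_1 add_pos_nonneg add_nonneg_nonneg split: prod.splits)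
     (simp add: algebra_simps add_increasing)

lemma prob_space_marks: "prob_space (marks \<beta>)"
  unfolding marks_def by (intro prob_space_PiM measure_pmf.prob_space_axioms)

lemma space_marks [simp]: "space (marks \<beta>) = UNIV"
  by (simp add: marks_def space_PiM)

lemma space_noise [simp]: "space (noise \<beta>) = UNIV"
  by (simp add: noise_def space_pair_measure)

lemma prob_space_noise: "prob_space (noise \<beta>)"
proof -
  interpret A: prob_space "measure_pmf (bernoulli_pmf (\<beta> / (1 + \<beta>)))"
    by (rule measure_pmf.prob_space_axioms)
  interpret B: prob_space "marks \<beta>" by (rule prob_space_marks)
  interpret pair_prob_space "measure_pmf (bernoulli_pmf (\<beta> / (1 + \<beta>)))" "marks \<beta>" ..
  show ?thesis unfolding noise_def by (rule prob_space_axioms)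
qed

lemma measurable_mark [measurable]: "(\<lambda>r. r i) \<in> marks \<beta> \<rightarrow>\<^sub>M count_space UNIV"
proof -
  have "(\<lambda>r. r i) \<in> marks \<beta> \<rightarrow>\<^sub>M measure_pmf (bernoulli_pmf (mark_prob \<beta> i))"
    unfolding marks_def by (rule measurable_component_singleton) simp
  then show ?thesis by (simp cong: measurable_cong_sets)
qed

lemma measurable_fst_noise [measurable]: "fst \<in> noise \<beta> \<rightarrow>\<^sub>M count_space UNIV"
proof -
  have "fst \<in> noise \<beta> \<rightarrow>\<^sub>M measure_pmf (bernoulli_pmf (\<beta> / (1 + \<beta>)))"
    unfolding noise_def by simp
  then show ?thesis by (simp cong: measurable_cong_sets)
qed

lemma measurable_snd_noise [measurable]: "snd \<in> noise \<beta> \<rightarrow>\<^sub>M marks \<beta>"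
  unfolding noise_def by simp

lemma measurable_pick:
  assumes "e \<in> M \<rightarrow>\<^sub>M count_space UNIV" and "\<And>j. (\<lambda>w. v w j) \<in> M \<rightarrow>\<^sub>M count_space UNIV"
  shows "(\<lambda>w. pick (e w) (v w) k) \<in> M \<rightarrow>\<^sub>M count_space UNIV"
proof (induction k)
  case 0
  then show ?case using assms(1) by (auto intro!: measurable_If pred_eq_const1 simp: measurable_If_set)
next
  case (Suc k)
  then show ?case using assms(2)[of k] by (auto intro!: measurable_If)
qed

lemma measurable_choice [measurable]: "(\<lambda>w. choice w k) \<in> noise \<beta> \<rightarrow>\<^sub>M count_space UNIV"
  by (rule measurable_pick) measurable

lemma measurable_move [measurable]: "(\<lambda>w. move w k x) \<in> noise \<beta> \<rightarrow>\<^sub>M count_space UNIV"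
proof -
  have [measurable]: "(\<lambda>w. pick True (\<lambda>j. snd w (True, j)) k) \<in> noise \<beta> \<rightarrow>\<^sub>M count_space UNIV"
    by (rule measurable_pick) measurable
  show ?thesis unfolding move_def
    by (cases "x = []") measurable
qed

text \<open>
  The measurability of the walk is stated for arbitrary measurable offspring numbers and marks; it serves for fixed offspring numbers as well as for random ones.
\<close>

lemma measurable_hist:
  assumes Z [measurable]: "\<And>i. (\<lambda>\<omega>. Z \<omega> i) \<in> M \<rightarrow>\<^sub>M count_space UNIV"
    and V [measurable]: "\<And>i. (\<lambda>\<omega>. V \<omega> i) \<in> M \<rightarrow>\<^sub>M noise \<beta>"
  shows "(\<lambda>\<omega>. hist (Z \<omega>) (V \<omega>) n) \<in> M \<rightarrow>\<^sub>M count_space UNIV"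
proof (induction n)
  case (Suc n)
  have 1: "(\<lambda>\<omega>. h @ [move (V \<omega> n) (Z \<omega> i) x]) \<in> M \<rightarrow>\<^sub>M count_space UNIV" for h i x
  proof -
    have "(\<lambda>\<omega>. move (V \<omega> n) k x) \<in> M \<rightarrow>\<^sub>M count_space UNIV" for k
      by (rule measurable_compose[OF V measurable_move])
    then have "(\<lambda>\<omega>. move (V \<omega> n) (Z \<omega> i) x) \<in> M \<rightarrow>\<^sub>M count_space UNIV"
      by (rule measurable_compose_countable[where f = "\<lambda>k \<omega>. move (V \<omega> n) k x" and g = "\<lambda>\<omega>. Z \<omega> i", OF _ Z])
    then show ?thesis by (rule measurable_compose) simp
  qed
  let ?F = "\<lambda>h \<omega>. h @ [move (V \<omega> n) (Z \<omega> (LEAST i. h ! i = last h)) (last h)]"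
  have "(\<lambda>\<omega>. ?F (hist (Z \<omega>) (V \<omega>) n) \<omega>) \<in> M \<rightarrow>\<^sub>M count_space UNIV"
    using 1 by (rule measurable_compose_countable[where f = ?F and g = "\<lambda>\<omega>. hist (Z \<omega>) (V \<omega>) n", OF _ Suc])
  then show ?case by (simp only: hist.simps)
qed simp

lemma measurable_pos:
  assumes "\<And>i. (\<lambda>\<omega>. Z \<omega> i) \<in> M \<rightarrow>\<^sub>M count_space UNIV"
    and "\<And>i. (\<lambda>\<omega>. V \<omega> i) \<in> M \<rightarrow>\<^sub>M noise \<beta>"
  shows "(\<lambda>\<omega>. pos (Z \<omega>) (V \<omega>) n) \<in> M \<rightarrow>\<^sub>M count_space UNIV"
  unfolding pos_def by (rule measurable_compose[OF measurable_hist[OF assms]]) auto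

lemma measurable_first_visit:
  assumes "\<And>i. (\<lambda>\<omega>. Z \<omega> i) \<in> M \<rightarrow>\<^sub>M count_space UNIV"
    and "\<And>i. (\<lambda>\<omega>. V \<omega> i) \<in> M \<rightarrow>\<^sub>M noise \<beta>"
  shows "(\<lambda>\<omega>. first_visit (Z \<omega>) (V \<omega>) n) \<in> M \<rightarrow>\<^sub>M count_space UNIV"
  unfolding first_visit_hist[symmetric]
  by (rule measurable_compose[OF measurable_hist[OF assms, where n=n],
        of "\<lambda>h. LEAST i. h ! i = last h"]) auto

lemma measure_noise_cylinder:
  assumes \<beta>: "\<beta> > 0" and fin: "finite A" "finite B" and disj: "A \<inter> B = {}"
  shows "measure (noise \<beta>) {w. fst w \<in> E \<and> (\<forall>i\<in>A. snd w i) \<and> (\<forall>i\<in>B. \<not> snd w i)} =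
    measure (bernoulli_pmf (\<beta> / (1 + \<beta>))) E *
    ((\<Prod>i\<in>A. mark_prob \<beta> i) * (\<Prod>i\<in>B. 1 - mark_prob \<beta> i))"
proof -
  interpret P: product_prob_space "\<lambda>i. measure_pmf (bernoulli_pmf (mark_prob \<beta> i))" UNIV
    by (intro product_prob_spaceI measure_pmf.prob_space_axioms)
  interpret B: prob_space "marks \<beta>" by (rule prob_space_marks)
  let ?X = "\<lambda>i. if i \<in> A then {True} else {False}"
  let ?C = "{r. (\<forall>i\<in>A. r i) \<and> (\<forall>i\<in>B. \<not> r i)}"
  have C: "?C = {r \<in> space (marks \<beta>). \<forall>i\<in>A \<union> B. r i \<in> ?X i}"
    using disj by auto
  have "emeasure (marks \<beta>) ?C = (\<Prod>i\<in>A\<union>B. emeasure (measure_pmf (bernoulli_pmf (mark_prob \<beta> i))) (?X i))"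
    unfolding C marks_def using fin by (intro P.emeasure_PiM_Collect) auto
  also have "\<dots> = (\<Prod>i\<in>A\<union>B. ennreal (if i \<in> A then mark_prob \<beta> i else 1 - mark_prob \<beta> i))"
    using mark_prob_range[OF \<beta>] by (intro prod.cong refl) (auto simp: emeasure_pmf_single)
  also have "\<dots> = ennreal (\<Prod>i\<in>A\<union>B. if i \<in> A then mark_prob \<beta> i else 1 - mark_prob \<beta> i)"
    using mark_prob_range[OF \<beta>] by (intro prod_ennreal) auto
  also have "(\<Prod>i\<in>A\<union>B. if i \<in> A then mark_prob \<beta> i else 1 - mark_prob \<beta> i) =
      (\<Prod>i\<in>A. mark_prob \<beta> i) * (\<Prod>i\<in>B. 1 - mark_prob \<beta> i)"
  proof -
    have "(\<Prod>i\<in>A\<union>B. if i \<in> A then mark_prob \<beta> i else 1 - mark_prob \<beta> i) =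
      (\<Prod>i\<in>A. if i \<in> A then mark_prob \<beta> i else 1 - mark_prob \<beta> i) *
      (\<Prod>i\<in>B. if i \<in> A then mark_prob \<beta> i else 1 - mark_prob \<beta> i)"
      using fin disj by (rule prod.union_disjoint)
    also have "(\<Prod>i\<in>B. if i \<in> A then mark_prob \<beta> i else 1 - mark_prob \<beta> i) = (\<Prod>i\<in>B. 1 - mark_prob \<beta> i)"
      using disj by (intro prod.cong) auto
    finally show ?thesis by simp
  qed
  finally have 1: "measure (marks \<beta>) ?C = (\<Prod>i\<in>A. mark_prob \<beta> i) * (\<Prod>i\<in>B. 1 - mark_prob \<beta> i)"
    using mark_prob_range[OF \<beta>]
    by (simp add: measure_def prod_nonneg)
  have sC: "?C \<in> sets (marks \<beta>)"
    unfolding C using fin by measurable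
  have "{w. fst w \<in> E \<and> (\<forall>i\<in>A. snd w i) \<and> (\<forall>i\<in>B. \<not> snd w i)} = E \<times> ?C" by auto
  then have "measure (noise \<beta>) {w. fst w \<in> E \<and> (\<forall>i\<in>A. snd w i) \<and> (\<forall>i\<in>B. \<not> snd w i)} =
    measure (bernoulli_pmf (\<beta> / (1 + \<beta>))) E * measure (marks \<beta>) ?C"
    using sC unfolding noise_def measure_def
    by (simp add: B.emeasure_pair_measure_Times enn2real_mult)
  then show ?thesis by (simp add: 1)
qed

text \<open>
  The factors are \<open>(1 + \<beta> j) / (1 + \<beta> (j + 1))\<close> and telescope.
\<close>

lemma prod_unmarked_False:
  assumes "\<beta> > 0" "a \<le> b"
  shows "(\<Prod>i\<in>Pair False ` {a..<b}. 1 - mark_prob \<beta> i) = (1 + \<beta> * real a) / (1 + \<beta> * real b)"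
proof -
  have pos: "1 + \<beta> * real n > 0" for n using assms by (simp add: add_pos_nonneg)
  have "(\<Prod>i\<in>Pair False ` {a..<b}. 1 - mark_prob \<beta> i) = (\<Prod>j\<in>{a..<b}. 1 - mark_prob \<beta> (False, j))"
    by (subst prod.reindex) (auto simp: inj_on_def)
  also have "\<dots> = (1 + \<beta> * real a) / (1 + \<beta> * real b)"
    using assms(2)
  proof (induction rule: dec_induct)
    case (step n)
    have "1 - mark_prob \<beta> (False, n) = (1 + \<beta> * real n) / (1 + \<beta> * real (Suc n))"
      using pos[of "Suc n"] by (simp add: mark_prob_def field_simps)
    with step show ?case using pos[of n] by (simp add: prod.atLeastLessThan_Suc)
  qed (use pos[of a] in simp)
  finally show ?thesis .
qed

lemma prod_unmarked_True:
  assumes "1 \<le> a" "a \<le> b"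
  shows "(\<Prod>i\<in>Pair True ` {a..<b}. 1 - mark_prob \<beta> i) = real a / real b"
proof -
  have "(\<Prod>i\<in>Pair True ` {a..<b}. 1 - mark_prob \<beta> i) = (\<Prod>j\<in>{a..<b}. 1 - mark_prob \<beta> (True, j))"
    by (subst prod.reindex) (auto simp: inj_on_def)
  also have "\<dots> = real a / real b"
    using assms(2)
  proof (induction rule: dec_induct)
    case (step n)
    have "1 - mark_prob \<beta> (True, n) = real n / real (Suc n)"
      by (simp add: mark_prob_def field_simps)
    with step show ?case using assms(1) by (simp add: prod.atLeastLessThan_Suc)
  qed (use assms in simp)
  finally show ?thesis .
qed

text \<open>
  Being the largest mark means a mark at \<open>i\<close> and none in \<open>{i<..k}\<close>: the telescoping product turns
  \<open>\<beta> / (1 + \<beta> i)\<close> into \<open>\<beta> / (1 + \<beta> k)\<close>, the same value for every \<open>i\<close>.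
\<close>

lemma prob_choice:
  assumes \<beta>: "\<beta> > 0" and k: "1 \<le> k" "i \<le> k"
  shows "measure (noise \<beta>) {w. choice w k = i} = (if i = 0 then 1 else \<beta>) / (1 + \<beta> * real k)"
proof -
  define A where "A = (if i \<le> 1 then {} else {(False, i - 1)})"
  define E where "E = (if i \<le> 1 then {i = 1} else UNIV)"
  let ?B = "Pair False ` {max i 1..<k}"
  have pos: "1 + \<beta> * real n > 0" for n using \<beta> by (simp add: add_pos_nonneg)
  have "{w. choice w k = i} = {w. fst w \<in> E \<and> (\<forall>j\<in>A. snd w j) \<and> (\<forall>j\<in>?B. \<not> snd w j)}"
    using k by (auto simp: pick_eq_iff A_def E_def)
  also have "measure (noise \<beta>) \<dots> = measure (bernoulli_pmf (\<beta> / (1 + \<beta>))) E *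
    ((\<Prod>i\<in>A. mark_prob \<beta> i) * (\<Prod>i\<in>?B. 1 - mark_prob \<beta> i))"
    using \<beta> by (intro measure_noise_cylinder) (auto simp: A_def)
  also have "(\<Prod>i\<in>?B. 1 - mark_prob \<beta> i) = (1 + \<beta> * real (max i 1)) / (1 + \<beta> * real k)"
    using \<beta> k by (intro prod_unmarked_False) auto
  also have "measure (bernoulli_pmf (\<beta> / (1 + \<beta>))) E * ((\<Prod>i\<in>A. mark_prob \<beta> i) * \<dots>) =
      (if i = 0 then 1 else \<beta>) / (1 + \<beta> * real k)"
  proof -
    consider "i = 0" | "i = 1" | "i > 1" by linarith
    then show ?thesis
    proof cases
      case 1
      have "pmf (bernoulli_pmf (\<beta> / (1 + \<beta>))) False = 1 / (1 + \<beta>)"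
        using \<beta> by (simp add: field_simps)
      then show ?thesis using 1 \<beta> by (simp add: A_def E_def measure_pmf_single)
    next
      case 2
      have "pmf (bernoulli_pmf (\<beta> / (1 + \<beta>))) True = \<beta> / (1 + \<beta>)"
        using \<beta> by simp
      then show ?thesis using 2 \<beta> by (simp add: A_def E_def measure_pmf_single)
    next
      case 3
      then have "real (i - 1) + 1 = real i" by simp
      then show ?thesis using 3 pos[of i] by (simp add: A_def E_def mark_prob_def max_def)
    qed
  qed
  finally show ?thesis .
qed

text \<open>
  The two ways to reach a child add up to
  \<open>\<beta> / (1 + \<beta> k) + 1 / (1 + \<beta> k) * (1 / k) = 1 / k\<close>.
\<close>

lemma prob_move_root:
  assumes \<beta>: "\<beta> > 0" and k: "1 \<le> k" "i < k"
  shows "measure (noise \<beta>) {w. move w k [] = [i]} = 1 / real k"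
proof -
  interpret N: prob_space "noise \<beta>" by (rule prob_space_noise)
  define A where "A = (if i = 0 then {} else {(True, i)})"
  let ?B = "Pair False ` {1..<k} \<union> Pair True ` {max i 1 + (if i = 0 then 0 else 1)..<k}"
  have pos: "1 + \<beta> * real n > 0" for n using \<beta> by (simp add: add_pos_nonneg)
  have root: "pick True v k - 1 = i \<longleftrightarrow> pick True v k = i + 1" for v
    using pick_pos[of True v k] by auto
  have "move w k [] = [i] \<longleftrightarrow>
      choice w k = i + 1 \<or> choice w k = 0 \<and> pick True (\<lambda>j. snd w (True, j)) k = i + 1" for w
    using root[of "\<lambda>j. snd w (True, j)"]
    by (cases "choice w k = 0") (simp_all add: move_def, arith)
  then have split: "{w. move w k [] = [i]} = {w. choice w k = i + 1} \<union>
      {w. choice w k = 0 \<and> pick True (\<lambda>j. snd w (True, j)) k = i + 1}"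
    by (simp only: Collect_disj_eq)
  have *: "{w. choice w k = 0 \<and> pick True (\<lambda>j. snd w (True, j)) k = i + 1} =
      {w. fst w \<in> {False} \<and> (\<forall>j\<in>A. snd w j) \<and> (\<forall>j\<in>?B. \<not> snd w j)}"
    using k by (cases "i = 0") (auto simp: pick_eq_iff A_def)
  have m1: "{w. choice w k = i + 1} \<in> sets (noise \<beta>)"
    using measurable_sets[OF measurable_choice, of "{i+1}" k \<beta>] by (simp add: vimage_def)
  have m2: "{w. choice w k = 0 \<and> pick True (\<lambda>j. snd w (True, j)) k = i + 1} \<in> sets (noise \<beta>)"
  proof -
    have [measurable]: "(\<lambda>w. pick True (\<lambda>j. snd w (True, j)) k) \<in> noise \<beta> \<rightarrow>\<^sub>M count_space UNIV"
      by (rule measurable_pick) measurable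
    have "{w \<in> space (noise \<beta>). choice w k = 0 \<and> pick True (\<lambda>j. snd w (True, j)) k = i + 1} \<in> sets (noise \<beta>)"
      by measurable
    then show ?thesis by simp
  qed
  have "measure (noise \<beta>) {w. move w k [] = [i]} = measure (noise \<beta>) {w. choice w k = i + 1} +
      measure (noise \<beta>) {w. choice w k = 0 \<and> pick True (\<lambda>j. snd w (True, j)) k = i + 1}"
    unfolding split using m1 m2 by (intro N.finite_measure_Union) auto
  also have "measure (noise \<beta>) {w. choice w k = i + 1} = \<beta> / (1 + \<beta> * real k)"
    using prob_choice[OF \<beta> k(1), of "i + 1"] k by simp
  also have "measure (noise \<beta>) {w. choice w k = 0 \<and> pick True (\<lambda>j. snd w (True, j)) k = i + 1} =
      measure (bernoulli_pmf (\<beta> / (1 + \<beta>))) {False} *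
    ((\<Prod>i\<in>A. mark_prob \<beta> i) * (\<Prod>i\<in>?B. 1 - mark_prob \<beta> i))"
    unfolding * using \<beta> by (intro measure_noise_cylinder) (auto simp: A_def)
  also have "(\<Prod>i\<in>?B. 1 - mark_prob \<beta> i) = (\<Prod>i\<in>Pair False ` {1..<k}. 1 - mark_prob \<beta> i) *
      (\<Prod>i\<in>Pair True ` {max i 1 + (if i = 0 then 0 else 1)..<k}. 1 - mark_prob \<beta> i)"
    by (rule prod.union_disjoint) auto
  also have "(\<Prod>i\<in>Pair False ` {1..<k}. 1 - mark_prob \<beta> i) = (1 + \<beta>) / (1 + \<beta> * real k)"
    using prod_unmarked_False[OF \<beta>, of 1 k] k by simp
  also have "(\<Prod>i\<in>Pair True ` {max i 1 + (if i = 0 then 0 else 1)..<k}. 1 - mark_prob \<beta> i) =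
      real (i + 1) / real k"
    using prod_unmarked_True[of "max i 1 + (if i = 0 then 0 else 1)" k \<beta>] k
    by (auto simp: max_def split: if_splits)
  also have "measure (bernoulli_pmf (\<beta> / (1 + \<beta>))) {False} = 1 / (1 + \<beta>)"
    using \<beta> by (simp add: measure_pmf_single field_simps)
  also have "(\<Prod>i\<in>A. mark_prob \<beta> i) = 1 / real (i + 1)"
    by (simp add: A_def mark_prob_def)
  finally have "measure (noise \<beta>) {w. move w k [] = [i]} =
     \<beta> / (1 + \<beta> * real k) + 1 / (1 + \<beta>) * (1 / real (i + 1) * ((1 + \<beta>) / (1 + \<beta> * real k) * (real (i + 1) / real k)))" .
  also have "\<dots> = \<beta> / (1 + \<beta> * real k) + 1 / (1 + \<beta> * real k) * (1 / real k)"
    using \<beta> by simp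
  also have "\<dots> = 1 / real k"
  proof -
    define D where "D = 1 + \<beta> * real k"
    have "D > 0" using pos[of k] by (simp add: D_def)
    then have "\<beta> / D + 1 / D * (1 / real k) = (\<beta> * real k + 1) / (D * real k)"
      using k by (simp add: field_simps)
    also have "\<dots> = 1 / real k" using \<open>D > 0\<close> by (simp add: D_def add.commute)
    finally show ?thesis by (simp only: D_def)
  qed
  finally show ?thesis .
qed

lemma distr_move:
  assumes \<beta>: "\<beta> > 0" and \<omega>: "\<omega> x > 0"
  shows "distr (noise \<beta>) (count_space UNIV) (\<lambda>w. move w (\<omega> x) x) = measure_pmf (step \<beta> \<omega> x)"
proof -
  interpret N: prob_space "noise \<beta>" by (rule prob_space_noise)
  let ?D = "distr (noise \<beta>) (count_space UNIV) (\<lambda>w. move w (\<omega> x) x)"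
  interpret D: prob_space ?D by (rule N.prob_space_distr) measurable
  have k: "1 \<le> \<omega> x" using \<omega> by simp
  have D: "measure ?D A = measure (noise \<beta>) {w. move w (\<omega> x) x \<in> A}" for A
    by (subst measure_distr) (auto simp: vimage_def)
  have eq: "measure ?D {y} = pmf (step \<beta> \<omega> x) y" if "y \<in> set_pmf (step \<beta> \<omega> x)" for y
  proof (cases "x = []")
    case True
    with that \<omega> have "y \<in> children \<omega> []"
      by (auto simp: set_pmf_iff pmf_step_root split: if_splits)
    then obtain i where "y = [i]" "i < \<omega> []" by (auto simp: children_def)
    then show ?thesis
      using True \<omega> \<open>y \<in> children \<omega> []\<close> prob_move_root[OF \<beta> k, of i] D[of "{[i]}"] by (simp add: pmf_step_root)
  next
    case False
    then have ne: "length x \<noteq> 0" by simp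
    from that False consider "y = butlast x" | i where "y = x @ [i]" "i < \<omega> x"
      using \<beta> by (auto simp: set_pmf_iff pmf_step children_def split: if_splits)
    then show ?thesis
    proof cases
      case 1
      have "(move w (\<omega> x) x = butlast x) = (choice w (\<omega> x) = 0)" for w
      proof -
        have "x @ [j] \<noteq> butlast x" for j
          by (metis append_eq_conv_conj butlast_conv_take length_butlast length_append_singleton
              diff_le_self le_imp_less_Suc less_not_refl3)
        then show ?thesis using False by (auto simp: move_def)
      qed
      then show ?thesis
        using 1 False \<beta> prob_choice[OF \<beta> k, of 0] by (simp add: D pmf_step)
    next
      case 2
      have "butlast x \<noteq> x @ [i]"
        by (metis length_butlast length_append_singleton diff_le_self le_imp_less_Suc less_not_refl3)
      moreover from this have "(move w (\<omega> x) x = x @ [i]) = (choice w (\<omega> x) = i + 1)" for w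
        using False by (auto simp: move_def)
      ultimately show ?thesis
        using 2 False \<beta> prob_choice[OF \<beta> k, of "i + 1"] by (auto simp add: D pmf_step children_def)
    qed
  qed
  let ?S = "set_pmf (step \<beta> \<omega> x)"
  have emS: "emeasure ?D (A \<inter> ?S) = emeasure (measure_pmf (step \<beta> \<omega> x)) (A \<inter> ?S)" for A
  proof -
    have "emeasure ?D (A \<inter> ?S) = (\<integral>\<^sup>+y. emeasure ?D {y} \<partial>count_space (A \<inter> ?S))"
      by (rule emeasure_countable_singleton) (auto intro: countable_subset[OF _ countable_set_pmf])
    also have "\<dots> = (\<integral>\<^sup>+y. emeasure (measure_pmf (step \<beta> \<omega> x)) {y} \<partial>count_space (A \<inter> ?S))"
      by (intro nn_integral_cong) (auto simp: D.emeasure_eq_measure eq emeasure_pmf_single)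
    also have "\<dots> = emeasure (measure_pmf (step \<beta> \<omega> x)) (A \<inter> ?S)"
      by (rule emeasure_countable_singleton[symmetric]) (auto intro: countable_subset[OF _ countable_set_pmf])
    finally show ?thesis .
  qed
  have "emeasure ?D ?S = 1"
    using emS[of UNIV] by (simp add: emeasure_pmf)
  then have AE: "AE y in ?D. y \<in> ?S"
    by (intro D.AE_prob_1) (simp add: D.emeasure_eq_measure)
  show ?thesis
  proof (rule measure_eqI)
    fix A assume "A \<in> sets ?D"
    have "emeasure ?D A = emeasure ?D (A \<inter> ?S)"
      using AE by (intro emeasure_eq_AE) auto
    also have "\<dots> = emeasure (measure_pmf (step \<beta> \<omega> x)) (A \<inter> ?S)" by (rule emS)
    also have "\<dots> = emeasure (measure_pmf (step \<beta> \<omega> x)) A"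
      by (rule emeasure_Int_set_pmf)
    finally show "emeasure ?D A = emeasure (measure_pmf (step \<beta> \<omega> x)) A" .
  qed simp
qed

section \<open>Exponential tails for cut times\<close>

abbreviation noise_seq :: "real \<Rightarrow> (nat \<Rightarrow> noise) measure" where
  "noise_seq \<beta> \<equiv> PiM UNIV (\<lambda>_. noise \<beta>)"

lemma prob_space_noise_seq: "prob_space (noise_seq \<beta>)"
  by (intro prob_space_PiM prob_space_noise)

lemma sequence_space_noise: "sequence_space (noise \<beta>)"
  unfolding sequence_space_def by (intro product_prob_spaceI prob_space_noise)

text \<open>
  A function of finitely many bits is measurable for trivial reasons; this covers all events about heights
  and cut times.
\<close>

lemma measurable_ups:
  assumes dep: "\<And>e e' :: nat \<Rightarrow> bool. (\<And>i. i < n \<Longrightarrow> e i = e' i) \<Longrightarrow> f e = f e'"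
    and V: "\<And>i. (\<lambda>\<omega>. V \<omega> i) \<in> M \<rightarrow>\<^sub>M noise \<beta>"
  shows "(\<lambda>\<omega>. f (up (V \<omega>))) \<in> M \<rightarrow>\<^sub>M count_space UNIV"
proof -
  have "(\<lambda>\<omega>. map (up (V \<omega>)) [0..<n]) \<in> M \<rightarrow>\<^sub>M count_space UNIV"
  proof (induction n)
    case (Suc n)
    have [measurable]: "(\<lambda>\<omega>. fst (V \<omega> n)) \<in> M \<rightarrow>\<^sub>M count_space UNIV"
      by (rule measurable_compose[OF V measurable_fst_noise])
    have "(\<lambda>\<omega>. l @ [fst (V \<omega> n)]) \<in> M \<rightarrow>\<^sub>M count_space UNIV" for l
      by measurable
    then have "(\<lambda>\<omega>. map (up (V \<omega>)) [0..<n] @ [fst (V \<omega> n)]) \<in> M \<rightarrow>\<^sub>M count_space UNIV"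
      by (rule measurable_compose_countable[where f = "\<lambda>l \<omega>. l @ [fst (V \<omega> n)]" and
            g = "\<lambda>\<omega>. map (up (V \<omega>)) [0..<n]", OF _ Suc])
    then show ?case by simp
  qed simp
  then have "(\<lambda>\<omega>. f (\<lambda>i. map (up (V \<omega>)) [0..<n] ! i)) \<in> M \<rightarrow>\<^sub>M count_space UNIV"
    by (rule measurable_compose[where g = "\<lambda>l. f (\<lambda>i. l ! i)"]) simp
  moreover have "f (\<lambda>i. map (up (V \<omega>)) [0..<n] ! i) = f (up (V \<omega>))" for \<omega>
    by (rule dep) simp
  ultimately show ?thesis by simp
qed

lemma gap_le: "gap e n \<le> n"
  by (induction n) auto

lemma falls_le: "falls e a N \<le> N"
  unfolding falls_def
  by (rule order_trans[OF card_mono[of "{..<N}"]]) auto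

lemma power_diff_1_le: "(1 + h) ^ m - 1 \<le> real m * h * (1 + h) ^ m" if "0 \<le> h" for h :: real
proof (induction m)
  case (Suc m)
  have "(1 + h) ^ Suc m - 1 = ((1 + h) ^ m - 1) + h * (1 + h) ^ m" by (simp add: algebra_simps)
  also have "\<dots> \<le> real (Suc m) * h * (1 + h) ^ m" using Suc by (simp add: algebra_simps)
  also have "\<dots> \<le> real (Suc m) * h * (1 + h) ^ Suc m" using that
    by (intro mult_left_mono) (auto intro: power_increasing)
  finally show ?case .
qed simp

text \<open>
  All terms \<open>y ^ i\<close> of the geometric series with \<open>i \<le> k\<close> are at least \<open>y ^ k\<close>.
\<close>

lemma Suc_times_power_le: "real (Suc k) * y ^ k \<le> 1 / (1 - y)" if "0 \<le> y" "y < 1" for y :: real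
proof -
  have "real (Suc k) * y ^ k = (\<Sum>i\<le>k. y ^ k)" by simp
  also have "\<dots> \<le> (\<Sum>i\<le>k. y ^ i)"
    using that by (intro sum_mono power_decreasing) auto
  also have "\<dots> \<le> (\<Sum>i. y ^ i)"
    using that by (intro sum_le_suminf summable_geometric) auto
  also have "\<dots> = 1 / (1 - y)" using that by (simp add: suminf_geometric)
  finally show ?thesis .
qed

lemma measurable_ups_seq:
  assumes dep: "\<And>e e' :: nat \<Rightarrow> bool. (\<And>i. i < n \<Longrightarrow> e i = e' i) \<Longrightarrow> f e = f e'"
  shows "(\<lambda>V. f (up V)) \<in> noise_seq \<beta> \<rightarrow>\<^sub>M count_space UNIV"
  by (rule measurable_ups[where n = n and f = f and V = "\<lambda>V. V" and \<beta> = \<beta>, OF dep])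
    (auto intro: measurable_component_singleton)

lemma measurable_falls_gap:
  assumes "a \<le> N"
  shows "(\<lambda>V. 3 * falls (up V) a N + gap (up V) a) \<in> noise_seq \<beta> \<rightarrow>\<^sub>M count_space UNIV"
proof (rule measurable_ups_seq[where f = "\<lambda>e. 3 * falls e a N + gap e a" and n = N])
  show "3 * falls e a N + gap e a = 3 * falls e' a N + gap e' a"
    if "\<And>i. i < N \<Longrightarrow> e i = e' i" for e e'
    using falls_cong[of N e e' a] gap_cong[of a e e'] that assms by simp
qed

lemma no_cut_sets: "{V. no_cut (up V) a N} \<in> sets (noise_seq \<beta>)"
proof -
  have "(\<lambda>V. no_cut (up V) a N) \<in> noise_seq \<beta> \<rightarrow>\<^sub>M count_space UNIV"
    by (rule measurable_ups_seq[where f = "\<lambda>e. no_cut e a N" and n = N]) (rule no_cut_cong)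
  from measurable_sets[OF this, of "{True}"] show ?thesis by (simp add: vimage_def space_PiM)
qed

lemma cut_sets: "{V. cut_time (up V) t n} \<in> sets (noise_seq \<beta>)"
proof -
  have "(\<lambda>V. cut_time (up V) t n) \<in> noise_seq \<beta> \<rightarrow>\<^sub>M count_space UNIV"
    by (rule measurable_ups_seq[where f = "\<lambda>e. cut_time e t n" and n = n]) (rule cut_time_cong)
  from measurable_sets[OF this, of "{True}"] show ?thesis by (simp add: vimage_def space_PiM)
qed

context
  fixes \<beta> p :: real
  assumes \<beta>: "\<beta> > 23 / 4"
  defines "p \<equiv> 1 / (1 + \<beta>)"
begin

interpretation S: sequence_space "noise \<beta>"
  by (rule sequence_space_noise)

lemma p_bounds: "0 < p" "p \<le> 4 / 27"
  using \<beta> by (auto simp: p_def field_simps)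

lemma prob_up: "measure (noise \<beta>) {w. fst w} = 1 - p" "measure (noise \<beta>) {w. \<not> fst w} = p"
proof -
  have \<beta>0: "\<beta> > 0" using \<beta> by simp
  have "measure (noise \<beta>) {w. fst w = e} = pmf (bernoulli_pmf (\<beta> / (1 + \<beta>))) e" for e
    using measure_noise_cylinder[OF \<beta>0, of "{}" "{}" "{e}"]
    by (simp add: measure_pmf_single)
  from this[of True] this[of False]
  show "measure (noise \<beta>) {w. fst w} = 1 - p" "measure (noise \<beta>) {w. \<not> fst w} = p"
    using \<beta> by (simp_all add: p_def field_simps)
qed

lemma integral_up: "(\<integral>w. (if fst w then a else b) \<partial>noise \<beta>) = a * (1 - p) + b * p"
proof -
  have m: "{w. fst w} \<in> sets (noise \<beta>)" "{w. \<not> fst w} \<in> sets (noise \<beta>)"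
    using measurable_sets[OF measurable_fst_noise, of "{True}" \<beta>]
      measurable_sets[OF measurable_fst_noise, of "{False}" \<beta>] by (auto simp: vimage_def)
  have "(\<integral>w. (if fst w then a else b) \<partial>noise \<beta>) =
      (\<integral>w. a * indicator {w. fst w} w + b * indicator {w. \<not> fst w} w \<partial>noise \<beta>)"
    by (intro Bochner_Integration.integral_cong) (auto simp: indicator_def)
  also have "\<dots> = a * (1 - p) + b * p"
    using m by (subst Bochner_Integration.integral_add) (auto simp: prob_up S.M.emeasure_eq_measure)
  finally show ?thesis .
qed

text \<open>
  The gap is a walk reflected at \<open>0\<close> that goes up with probability \<open>p\<close>. The recursion for the exponential
  moment with base \<open>3 / 2\<close> preserves the bound \<open>1 + 3 p\<close>, which is close to \<open>1\<close> for small \<open>p\<close>.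
\<close>

lemma gap_moment: "(\<integral>V. (3/2) ^ gap (up V) n \<partial>noise_seq \<beta>) \<le> 1 + 3 * p"
proof (induction n)
  case 0
  then show ?case using p_bounds by (simp add: S.P.prob_space)
next
  case (Suc n)
  let ?g = "\<lambda>w. if fst w then 2/3 else (3/2 :: real)" and ?h = "\<lambda>w. if fst w then 1/3 else (0::real)"
  have gm: "(\<lambda>V. gap (up V) k) \<in> noise_seq \<beta> \<rightarrow>\<^sub>M count_space UNIV" for k
    by (rule measurable_ups_seq[where f = "\<lambda>e. gap e k" and n = k]) (rule gap_cong)
  have Fm: "(\<lambda>V. (3/2 :: real) ^ gap (up V) k) \<in> borel_measurable (noise_seq \<beta>)" for k
    by (rule measurable_compose[OF gm]) simp
  have Fb: "\<bar>(3/2 :: real) ^ gap (up V) k\<bar> \<le> (3/2) ^ k" for V k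
    using gap_le[of "up V" k] by (simp add: power_increasing)
  have gmeas: "?g \<in> borel_measurable (noise \<beta>)" "?h \<in> borel_measurable (noise \<beta>)" by measurable
  have fnm [measurable]: "(\<lambda>V. fst (V n)) \<in> noise_seq \<beta> \<rightarrow>\<^sub>M count_space UNIV"
    by (rule measurable_compose[of "\<lambda>V. V n", OF measurable_component_singleton measurable_fst_noise]) simp
  have dep: "(3/2 :: real) ^ gap (up V) n = (3/2) ^ gap (up V') n" if "\<And>i. i < n \<Longrightarrow> V i = V' i" for V V'
    using gap_cong[of n "up V" "up V'"] that by simp
  have int: "integrable (noise_seq \<beta>) (\<lambda>V. (3/2 :: real) ^ gap (up V) k)" for k
    by (rule S.P.integrable_const_bound[of _ "(3/2)^k"]) (use Fb[of _ k] Fm in auto)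
  have int1: "integrable (noise_seq \<beta>) (\<lambda>V. (3/2) ^ gap (up V) n * ?g (V n))"
  proof (rule S.P.integrable_const_bound[of _ "(3/2)^n * (3/2)"])
    show "AE V in noise_seq \<beta>. norm ((3/2) ^ gap (up V) n * ?g (V n)) \<le> (3/2)^n * (3/2)"
      using Fb[of _ n] by (intro AE_I2) (auto simp: abs_mult intro!: mult_mono)
    show "(\<lambda>V. (3/2) ^ gap (up V) n * ?g (V n)) \<in> borel_measurable (noise_seq \<beta>)"
      by (intro borel_measurable_times Fm) measurable
  qed
  have int2: "integrable (noise_seq \<beta>) (\<lambda>V. ?h (V n))"
    by (rule S.P.integrable_const_bound[of _ "1/3"]) auto
  have "(\<integral>V. (3/2) ^ gap (up V) (Suc n) \<partial>noise_seq \<beta>) \<le>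
      (\<integral>V. (3/2) ^ gap (up V) n * ?g (V n) + ?h (V n) \<partial>noise_seq \<beta>)"
  proof (rule integral_mono[OF int Bochner_Integration.integrable_add[OF int1 int2]])
    fix V :: "nat \<Rightarrow> noise"
    show "(3/2) ^ gap (up V) (Suc n) \<le> (3/2) ^ gap (up V) n * ?g (V n) + ?h (V n)"
      by (cases "gap (up V) n") auto
  qed
  also have "\<dots> = (\<integral>V. (3/2) ^ gap (up V) n * ?g (V n) \<partial>noise_seq \<beta>) + (\<integral>V. ?h (V n) \<partial>noise_seq \<beta>)"
    by (rule Bochner_Integration.integral_add[OF int1 int2])
  also have "(\<integral>V. (3/2) ^ gap (up V) n * ?g (V n) \<partial>noise_seq \<beta>) =
      (\<integral>V. (3/2) ^ gap (up V) n \<partial>noise_seq \<beta>) * (2/3 * (1 - p) + 3/2 * p)"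
    using S.integral_past_next[OF Fm gmeas(1) Fb, of "3/2", OF _ dep] by (simp add: integral_up)
  also have "(\<integral>V. ?h (V n) \<partial>noise_seq \<beta>) = 1/3 * (1 - p)"
    using S.integral_past_next[of "\<lambda>_. 1", OF _ gmeas(2), of 1 1 n] S.P.prob_space by (simp add: integral_up)
  also have "(\<integral>V. (3/2) ^ gap (up V) n \<partial>noise_seq \<beta>) * (2/3 * (1 - p) + 3/2 * p) + 1/3 * (1 - p) \<le>
      (1 + 3 * p) * (2/3 * (1 - p) + 3/2 * p) + 1/3 * (1 - p)"
    using Suc p_bounds by (intro add_right_mono mult_right_mono) auto
  also have "\<dots> \<le> 1 + 3 * p"
  proof -
    have "p * p \<le> p * (1/5)" using p_bounds by (intro mult_left_mono) auto
    moreover have "(1 + 3 * p) * (2/3 * (1 - p) + 3/2 * p) + 1/3 * (1 - p) = 1 + 5/2 * p + 5/2 * (p * p)"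
      by (simp add: field_simps)
    ultimately show ?thesis by linarith
  qed
  finally show ?case .
qed

text \<open>
  Every step contributes the factor \<open>1 - p + (3/2)\<^sup>3 p \<le> 1 + 3 p\<close>.
\<close>

lemma gap_falls_moment:
  assumes "a \<le> N"
  shows "(\<integral>V. (3/2) ^ (3 * falls (up V) a N + gap (up V) a) \<partial>noise_seq \<beta>) \<le> (1 + 3 * p) ^ (N - a + 1)"
  using assms
proof (induction rule: dec_induct)
  case base
  have "falls e a a = 0" for e by (simp add: falls_def)
  then show ?case using gap_moment[of a] by simp
next
  case (step N)
  let ?W = "\<lambda>V N. 3 * falls (up V) a N + gap (up V) a"
  let ?g = "\<lambda>w. if fst w then 1 else ((3/2)^3 :: real)"
  have Wcong: "3 * falls e a N + gap e a = 3 * falls e' a N + gap e' a"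
    if "\<And>i. i < N \<Longrightarrow> e i = e' i" for e e'
    using falls_cong[of N e e' a] gap_cong[of a e e'] that step by simp
  have Wm: "(\<lambda>V. ?W V N) \<in> noise_seq \<beta> \<rightarrow>\<^sub>M count_space UNIV"
    by (rule measurable_falls_gap[OF step(1)])
  have Fm: "(\<lambda>V. (3/2 :: real) ^ ?W V N) \<in> borel_measurable (noise_seq \<beta>)"
    by (rule measurable_compose[OF Wm]) simp
  have Fb: "\<bar>(3/2 :: real) ^ ?W V N\<bar> \<le> (3/2) ^ (3 * N + a)" for V
    using gap_le[of "up V" a] falls_le[of "up V" a N]
    by simp
  have gmeas: "?g \<in> borel_measurable (noise \<beta>)" by measurable
  have dep: "(3/2 :: real) ^ ?W V N = (3/2) ^ ?W V' N" if "\<And>i. i < N \<Longrightarrow> V i = V' i" for V V'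
    using Wcong[of "up V" "up V'"] that by simp
  have "(\<integral>V. (3/2) ^ ?W V (Suc N) \<partial>noise_seq \<beta>) = (\<integral>V. (3/2) ^ ?W V N * ?g (V N) \<partial>noise_seq \<beta>)"
    using step(1) by (intro Bochner_Integration.integral_cong refl) (auto simp: falls_Suc power_add)
  also have "\<dots> = (\<integral>V. (3/2) ^ ?W V N \<partial>noise_seq \<beta>) * (1 * (1 - p) + (3/2)^3 * p)"
    using S.integral_past_next[OF Fm gmeas Fb, of "(3/2)^3", OF _ dep] by (simp add: integral_up)
  also have "\<dots> \<le> (1 + 3 * p) ^ (N - a + 1) * (1 + 3 * p)"
    using step.IH p_bounds by (intro mult_mono) (auto simp: power3_eq_cube)
  finally show ?case using step by (simp add: Suc_diff_le mult.commute)
qed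

text \<open>
  Markov's inequality in two forms. The second one, with \<open>1\<close> subtracted on both sides, keeps a factor
  \<open>p\<close> on the right.
\<close>

lemma gap_falls_tail:
  assumes "a \<le> N"
  shows "measure (noise_seq \<beta>) {V. k \<le> 3 * falls (up V) a N + gap (up V) a} * (3/2) ^ k \<le> (1 + 3 * p) ^ (N - a + 1)"
    and "measure (noise_seq \<beta>) {V. k \<le> 3 * falls (up V) a N + gap (up V) a} * ((3/2) ^ k - 1) \<le> (1 + 3 * p) ^ (N - a + 1) - 1"
proof -
  let ?W = "\<lambda>V. 3 * falls (up V) a N + gap (up V) a"
  let ?E = "{V. k \<le> ?W V}"
  have Wm: "?W \<in> noise_seq \<beta> \<rightarrow>\<^sub>M count_space UNIV"
    by (rule measurable_falls_gap[OF assms])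
  have Fm: "(\<lambda>V. (3/2 :: real) ^ ?W V) \<in> borel_measurable (noise_seq \<beta>)"
    by (rule measurable_compose[OF Wm]) simp
  have Fb: "\<bar>(3/2 :: real) ^ ?W V\<bar> \<le> (3/2) ^ (3 * N + a)" for V
    using gap_le[of "up V" a] falls_le[of "up V" a N]
    by simp
  have E: "?E \<in> sets (noise_seq \<beta>)"
    using measurable_sets[OF Wm, of "{k..}"] by (simp add: vimage_def space_PiM)
  have int: "integrable (noise_seq \<beta>) (\<lambda>V. (3/2 :: real) ^ ?W V)"
    by (rule S.P.integrable_const_bound[of _ "(3/2) ^ (3 * N + a)"]) (use Fb Fm in auto)
  have intE: "integrable (noise_seq \<beta>) (\<lambda>V. indicator ?E V * (c :: real))" for c
    using E by (intro integrable_mult_left) (simp add: S.P.emeasure_eq_measure)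
  have "measure (noise_seq \<beta>) ?E * (3/2)^k = (\<integral>V. indicator ?E V * (3/2)^k \<partial>noise_seq \<beta>)"
    using E by simp
  also have "\<dots> \<le> (\<integral>V. (3/2) ^ ?W V \<partial>noise_seq \<beta>)"
    by (intro integral_mono intE int) (auto simp: indicator_def intro: power_increasing)
  also have "\<dots> \<le> (1 + 3 * p) ^ (N - a + 1)"
    by (rule gap_falls_moment[OF assms])
  finally show "measure (noise_seq \<beta>) ?E * (3/2)^k \<le> (1 + 3 * p) ^ (N - a + 1)" .
  have "measure (noise_seq \<beta>) ?E * ((3/2)^k - 1) = (\<integral>V. indicator ?E V * ((3/2)^k - 1) \<partial>noise_seq \<beta>)"
    using E by simp
  also have "\<dots> \<le> (\<integral>V. (3/2) ^ ?W V - 1 \<partial>noise_seq \<beta>)"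
    by (intro integral_mono intE Bochner_Integration.integrable_diff int) (auto simp: indicator_def intro: power_increasing)
  also have "\<dots> = (\<integral>V. (3/2) ^ ?W V \<partial>noise_seq \<beta>) - 1"
    using int by (simp add: S.P.prob_space)
  also have "\<dots> \<le> (1 + 3 * p) ^ (N - a + 1) - 1"
    using gap_falls_moment[OF assms] by simp
  finally show "measure (noise_seq \<beta>) ?E * ((3/2) ^ k - 1) \<le> (1 + 3 * p) ^ (N - a + 1) - 1" .
qed

text \<open>
  Without a cut time in \<open>{a<..n}\<close> the falls and the gap must account for all \<open>n - a\<close> steps. The factor
  \<open>p\<close> reflects that already one fall is needed. It is essential for the comparison of the speeds, where the
  loss must be small in relation to a gain of order \<open>p\<close>.
\<close>

lemma prob_no_cut:
  assumes "a < n"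
  shows "measure (noise_seq \<beta>) {V. no_cut (up V) a n} \<le> 1000 * p * (99/100) ^ (2 * (n - a))"
proof -
  define k where "k = n - a"
  have k: "1 \<le> k" using assms by (simp add: k_def)
  let ?m = "measure (noise_seq \<beta>) {V. no_cut (up V) a n}"
  from assms have "a \<le> n" by simp
  from measurable_sets[OF measurable_falls_gap[OF this], of "{k..}"]
  have Es: "{V. k \<le> 3 * falls (up V) a n + gap (up V) a} \<in> sets (noise_seq \<beta>)"
    by (simp add: vimage_def space_PiM)
  have m1: "?m \<le> measure (noise_seq \<beta>) {V. k \<le> 3 * falls (up V) a n + gap (up V) a}"
    using assms Es by (intro S.P.finite_measure_mono) (auto simp: k_def dest: no_cut_imp)
  have x1: "1 \<le> (3/2 :: real) ^ k" by simp
  have "(3/2 :: real) ^ 1 \<le> (3/2) ^ k" using k by (intro power_increasing) auto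
  then have x3: "(3/2 :: real) ^ k / 3 \<le> (3/2) ^ k - 1" by simp
  have "?m * ((3/2) ^ k / 3) \<le> ?m * ((3/2) ^ k - 1)"
    using x3 by (intro mult_left_mono) auto
  also have "\<dots> \<le> measure (noise_seq \<beta>) {V. k \<le> 3 * falls (up V) a n + gap (up V) a} * ((3/2) ^ k - 1)"
    using m1 x1 by (intro mult_right_mono) auto
  also have "\<dots> \<le> (1 + 3 * p) ^ (k + 1) - 1"
    using gap_falls_tail(2)[of a n k] assms by (simp add: k_def)
  also have "\<dots> \<le> real (k + 1) * (3 * p) * (1 + 3 * p) ^ (k + 1)"
    using p_bounds by (intro power_diff_1_le) auto
  also have "\<dots> \<le> real (k + 1) * (3 * p) * (13/9) ^ (k + 1)"
    using p_bounds by (intro mult_left_mono power_mono) auto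
  finally have le: "?m * ((3/2) ^ k / 3) * (3 * (2/3) ^ k) \<le> real (k + 1) * (3 * p) * (13/9) ^ (k + 1) * (3 * (2/3) ^ k)"
    by (intro mult_right_mono) auto
  have lhs: "?m * ((3/2) ^ k / 3) * (3 * (2/3) ^ k) = ?m"
    by (simp flip: power_mult_distrib)
  have "(13/9) ^ k * (2/3) ^ k = (26/27 :: real) ^ k"
    by (simp flip: power_mult_distrib)
  then have rhs: "real (k + 1) * (3 * p) * (13/9) ^ (k + 1) * (3 * (2/3) ^ k) = 13 * p * (real (k + 1) * (26/27) ^ k)"
    by (simp add: algebra_simps)
  have "?m \<le> 13 * p * (real (k + 1) * (26/27) ^ k)"
    using le unfolding lhs rhs .
  (* A bit of the exponential decay absorbs the factor k + 1: 26/27 = (2600000/2646270) * (99/100)^2. *)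
  also have "real (k + 1) * (26/27) ^ k = (real (Suc k) * (2600000/2646270) ^ k) * ((99/100)^2) ^ k"
    by (simp add: power2_eq_square flip: power_mult_distrib)
  also have "\<dots> \<le> 1 / (1 - 2600000/2646270) * ((99/100)^2) ^ k"
    by (intro mult_right_mono Suc_times_power_le) auto
  also have "13 * p * \<dots> \<le> 1000 * p * (99/100) ^ (2 * k)"
    using p_bounds by (simp add: power_mult)
  finally show ?thesis using p_bounds by (simp add: k_def mult_left_mono)
qed

text \<open>
  The horizon \<open>Suc n\<close> covers the step taken at time \<open>n\<close>, so that a cut time \<open>t \<le> n\<close> decouples this
  step from the past.
\<close>

lemma prob_no_early_cut:
  assumes "a \<le> n"
  shows "measure (noise_seq \<beta>) {V. \<forall>t. a < t \<longrightarrow> t \<le> n \<longrightarrow> \<not> cut_time (up V) t (Suc n)} \<le> 3 * (26/27) ^ (n - a)"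
proof -
  define k where "k = n - a"
  let ?m = "measure (noise_seq \<beta>) {V. \<forall>t. a < t \<longrightarrow> t \<le> n \<longrightarrow> \<not> cut_time (up V) t (Suc n)}"
  from assms have "a \<le> Suc n" by simp
  from measurable_sets[OF measurable_falls_gap[OF this], of "{k..}"]
  have Es: "{V. k \<le> 3 * falls (up V) a (Suc n) + gap (up V) a} \<in> sets (noise_seq \<beta>)"
    by (simp add: vimage_def space_PiM)
  have m1: "?m \<le> measure (noise_seq \<beta>) {V. k \<le> 3 * falls (up V) a (Suc n) + gap (up V) a}"
    unfolding k_def
    by (intro S.P.finite_measure_mono Es[unfolded k_def] subsetI CollectI cut_before_last[OF assms]) auto
  have "?m * (3/2) ^ k \<le> measure (noise_seq \<beta>) {V. k \<le> 3 * falls (up V) a (Suc n) + gap (up V) a} * (3/2) ^ k"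
    using m1 by (intro mult_right_mono) auto
  also have "\<dots> \<le> (1 + 3 * p) ^ (k + 2)"
    using gap_falls_tail(1)[of a "Suc n" k] assms by (simp add: k_def Suc_diff_le)
  also have "\<dots> \<le> (13/9) ^ (k + 2)"
    using p_bounds by (intro power_mono) auto
  finally have "?m * (3/2) ^ k \<le> (13/9) ^ (k + 2)" .
  then have le: "?m * (3/2) ^ k * (2/3) ^ k \<le> (13/9) ^ (k + 2) * (2/3) ^ k"
    by (intro mult_right_mono) auto
  have lhs: "?m * (3/2) ^ k * (2/3) ^ k = ?m"
    by (simp add: mult.assoc flip: power_mult_distrib)
  have "(13/9) ^ (k + 2) * (2/3) ^ k = (13/9)^2 * ((13/9) ^ k * (2/3 :: real) ^ k)"
    by (simp only: power_add mult_ac)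
  also have "(13/9) ^ k * (2/3) ^ k = (26/27 :: real) ^ k"
    by (simp flip: power_mult_distrib)
  finally have rhs: "(13/9) ^ (k + 2) * (2/3) ^ k = (13/9)^2 * (26/27 :: real) ^ k" .
  have "?m \<le> (13/9)^2 * (26/27) ^ k"
    using le unfolding lhs rhs .
  also have "\<dots> \<le> 3 * (26/27) ^ k" by (simp add: power2_eq_square)
  finally show ?thesis by (simp add: k_def)
qed

text \<open>
  A record at \<open>Suc m\<close> means that the gap at time \<open>m\<close> is \<open>0\<close> and the next step goes up, which has probability
  at least \<open>(1 - 6 p) (1 - p)\<close>.
\<close>

lemma prob_record:
  assumes "n \<ge> 1"
  shows "measure (noise_seq \<beta>) {V. cut_time (up V) n n} \<ge> 9/100"
proof -
  from assms obtain m where n: "n = Suc m" by (cases n) auto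
  have gm: "(\<lambda>V. gap (up V) m) \<in> noise_seq \<beta> \<rightarrow>\<^sub>M count_space UNIV"
    by (rule measurable_ups_seq[where f = "\<lambda>e. gap e m" and n = m]) (rule gap_cong)
  have G: "{V. gap (up V) m = 0} \<in> sets (noise_seq \<beta>)"
    using measurable_sets[OF gm, of "{0}"] by (simp add: vimage_def space_PiM)
  have Fm: "(\<lambda>V. indicator {V. gap (up V) m = 0} V :: real) \<in> borel_measurable (noise_seq \<beta>)"
    using G by simp
  let ?g = "\<lambda>w. if fst w then 1 else (0 :: real)"
  have gmeas: "?g \<in> borel_measurable (noise \<beta>)" by measurable
  have dep: "(indicator {V. gap (up V) m = 0} V :: real) = indicator {V. gap (up V) m = 0} V'"
    if "\<And>i. i < m \<Longrightarrow> V i = V' i" for V V'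
    using gap_cong[of m "up V" "up V'"] that by (simp add: indicator_def)
  have "measure (noise_seq \<beta>) {V. cut_time (up V) n n} = (\<integral>V. indicator {V. cut_time (up V) n n} V \<partial>noise_seq \<beta>)"
    using cut_sets[of n n] by simp
  also have "\<dots> = (\<integral>V. indicator {V. gap (up V) m = 0} V * ?g (V m) \<partial>noise_seq \<beta>)"
    by (intro Bochner_Integration.integral_cong) (auto simp: n record_Suc_iff indicator_def)
  also have "\<dots> = (\<integral>V. indicator {V. gap (up V) m = 0} V \<partial>noise_seq \<beta>) * (1 - p)"
    using S.integral_past_next[OF Fm gmeas _ _ dep, of 1 1] by (simp add: integral_up)
  also have "(\<integral>V. indicator {V. gap (up V) m = 0} V \<partial>noise_seq \<beta>) = measure (noise_seq \<beta>) {V. gap (up V) m = 0}"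
    using G by simp
  finally have eq: "measure (noise_seq \<beta>) {V. cut_time (up V) n n} = measure (noise_seq \<beta>) {V. gap (up V) m = 0} * (1 - p)" .
  have "measure (noise_seq \<beta>) {V. 1 \<le> 3 * falls (up V) m m + gap (up V) m} * ((3/2) ^ 1 - 1) \<le> (1 + 3 * p) ^ (m - m + 1) - 1"
    by (rule gap_falls_tail(2)) simp
  moreover have "falls e m m = 0" for e by (simp add: falls_def)
  moreover have "{V. 1 \<le> gap (up V) m} = space (noise_seq \<beta>) - {V. gap (up V) m = 0}"
    by (auto simp: space_PiM)
  ultimately have "measure (noise_seq \<beta>) {V. gap (up V) m = 0} \<ge> 1 - 6 * p"
    using S.P.prob_compl[OF G] by simp
  then have "(1 - 6 * p) * (1 - p) \<le> measure (noise_seq \<beta>) {V. cut_time (up V) n n}"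
    unfolding eq using p_bounds by (intro mult_right_mono) auto
  moreover have "(1/9) * (23/27) \<le> (1 - 6 * p) * (1 - p)"
    using p_bounds by (intro mult_mono) auto
  ultimately show ?thesis by linarith
qed

end

section \<open>Comparison of two sequences of offspring numbers\<close>

text \<open>
  At the root this says only that the general family of marks asks for a step back. The walk then moves
  to a child all the same.
\<close>

definition steps_back :: "(nat \<Rightarrow> nat) \<Rightarrow> (nat \<Rightarrow> noise) \<Rightarrow> nat \<Rightarrow> bool" where
  "steps_back z V n \<longleftrightarrow> choice (V n) (z (first_visit z V n)) = 0"

definition back_prob :: "real \<Rightarrow> nat \<Rightarrow> real" where
  "back_prob \<beta> k = 1 / (1 + \<beta> * real k)"

lemma measurable_back:
  assumes Z: "\<And>i. (\<lambda>\<omega>. Z \<omega> i) \<in> M \<rightarrow>\<^sub>M count_space UNIV"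
    and V: "\<And>i. (\<lambda>\<omega>. V \<omega> i) \<in> M \<rightarrow>\<^sub>M noise \<beta>"
  shows "(\<lambda>\<omega>. steps_back (Z \<omega>) (V \<omega>) n) \<in> M \<rightarrow>\<^sub>M count_space UNIV"
proof -
  have "(\<lambda>\<omega>. choice (V \<omega> n) k = 0) \<in> M \<rightarrow>\<^sub>M count_space UNIV" for k
    by (rule measurable_compose[OF V, of "\<lambda>w. choice w k = 0"]) measurable
  then have 1: "(\<lambda>\<omega>. choice (V \<omega> n) (Z \<omega> i) = 0) \<in> M \<rightarrow>\<^sub>M count_space UNIV" for i
    by (rule measurable_compose_countable[where f = "\<lambda>k \<omega>. choice (V \<omega> n) k = 0" and g = "\<lambda>\<omega>. Z \<omega> i", OF _ Z])
  show ?thesis unfolding steps_back_def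
    by (rule measurable_compose_countable[where f = "\<lambda>i \<omega>. choice (V \<omega> n) (Z \<omega> i) = 0" and
          g = "\<lambda>\<omega>. first_visit (Z \<omega>) (V \<omega>) n", OF 1 measurable_first_visit[OF Z V]])
qed

lemma back_sets: "{V. steps_back z V n} \<in> sets (noise_seq \<beta>)"
proof -
  have "(\<lambda>V. steps_back z V n) \<in> noise_seq \<beta> \<rightarrow>\<^sub>M count_space UNIV"
    by (rule measurable_back[where Z = "\<lambda>_. z" and V = "\<lambda>V. V" and \<beta> = \<beta>])
       (auto intro: measurable_component_singleton)
  from measurable_sets[OF this, of "{True}"] show ?thesis by (simp add: vimage_def space_PiM)
qed

lemma pick_agree:
  assumes "1 \<le> a" "a \<le> b" "\<And>j. a \<le> j \<Longrightarrow> j < b \<Longrightarrow> \<not> v j"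
  shows "pick e v b = pick e v a"
  using assms(2,3) by (induction rule: dec_induct) auto

lemma move_agree:
  assumes "1 \<le> a" "a \<le> b" "\<And>c j. a \<le> j \<Longrightarrow> j < b \<Longrightarrow> \<not> snd w (c, j)"
  shows "move w b x = move w a x"
  using pick_agree[of a b "\<lambda>j. snd w (False, j)" "fst w"] pick_agree[of a b "\<lambda>j. snd w (True, j)" True] assms
  by (simp add: move_def)

text \<open>
  Let \<open>t\<close> be the last cut time up to \<open>n\<close>, or \<open>0\<close>. If no mark used at a time \<open>s \<ge> t\<close> lies between
  offspring numbers revealed at a time \<open>r \<ge> t\<close>, the two walks have moved in parallel since time \<open>t\<close>.
  Then they read offspring numbers with the same index at time \<open>n\<close>, and the larger one cannot step back alone.
\<close>

lemma back_coupled: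
  assumes z: "\<And>i. 1 \<le> z2 i" "\<And>i. z2 i \<le> z1 i"
    and b: "steps_back z1 V n" "\<not> steps_back z2 V n"
  obtains s r c j where "\<not> fst (V n)" "s < n" "r < n" "no_cut (up V) (min s r) n"
    "z2 r \<le> j" "j < z1 r" "snd (V s) (c, j)"
proof -
  have nup: "\<not> fst (V n)"
  proof
    assume "fst (V n)"
    from pick_pos[OF this, of "\<lambda>j. snd (V n) (False, j)" "z1 (first_visit z1 V n)"] b(1) show False
      by (simp add: steps_back_def)
  qed
  (* The time 0 serves as well as a cut time, as nothing happened before it. *)
  obtain t where t: "t \<le> n" "t = 0 \<or> cut_time (up V) t n" "no_cut (up V) t n"
  proof (cases "\<exists>t. cut_time (up V) t n")
    case True
    define t where "t = Max {t. cut_time (up V) t n}"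
    have fin: "finite {t. cut_time (up V) t n}"
      by (rule finite_subset[of _ "{..n}"]) (auto simp: cut_time_def)
    have "cut_time (up V) t n"
      using Max_in[OF fin] True by (auto simp: t_def)
    moreover have "no_cut (up V) t n"
      unfolding no_cut_def using Max_ge[OF fin] by (auto simp: t_def not_le[symmetric])
    ultimately show ?thesis using that[of t] by (auto simp: cut_time_def)
  next
    case False
    then show ?thesis using that[of 0] by (auto simp: no_cut_def)
  qed
  define V' where "V' = (\<lambda>i. V (t + i))"
  have first_visit: "first_visit z V n = t + first_visit (\<lambda>i. z (t + i)) V' (n - t)" for z
  proof (cases "t = 0")
    case False
    then show ?thesis using first_visit_shift[of V t n "n - t" z] t by (simp add: V'_def)
  qed (simp add: V'_def)
  let ?z1 = "\<lambda>i. z1 (t + i)" and ?z2 = "\<lambda>i. z2 (t + i)"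
  have "\<exists>s r c j. s < n \<and> r < n \<and> t \<le> s \<and> t \<le> r \<and> z2 r \<le> j \<and> j < z1 r \<and> snd (V s) (c, j)"
  proof (rule ccontr)
    assume none: "\<not> ?thesis"
    have eq: "pos ?z1 V' m = pos ?z2 V' m" if "m \<le> n - t" for m
      using that
    proof (induction m rule: less_induct)
      case (less m)
      show ?case
      proof (cases m)
        case (Suc k)
        have same: "pos ?z1 V' i = pos ?z2 V' i" if "i \<le> k" for i
          using less that Suc by simp
        have d: "first_visit ?z1 V' k = first_visit ?z2 V' k"
          using first_visit_le[of ?z2 V' k] first_visit_less[of _ ?z2 V' k] pos_first_visit[of ?z2 V' k]
          by (intro first_visit_eqI) (auto simp: same)
        have "move (V' k) (?z1 (first_visit ?z2 V' k)) x = move (V' k) (?z2 (first_visit ?z2 V' k)) x" for x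
        proof (rule move_agree)
          fix c j assume j: "?z2 (first_visit ?z2 V' k) \<le> j" "j < ?z1 (first_visit ?z2 V' k)"
          have "t + k < n" "t + first_visit ?z2 V' k < n"
            using less.prems Suc first_visit_le[of ?z2 V' k] by auto
          with none j show "\<not> snd (V' k) (c, j)"
            unfolding V'_def by (metis le_add1)
        qed (use z in auto)
        then show ?thesis
          using same[of k] d by (simp add: Suc pos_Suc)
      qed simp
    qed
    have "first_visit ?z1 V' (n - t) = first_visit ?z2 V' (n - t)"
      using first_visit_le[of ?z2 V' "n - t"] first_visit_less[of _ ?z2 V' "n - t"] pos_first_visit[of ?z2 V' "n - t"]
      by (intro first_visit_eqI) (auto simp: eq)
    then have "first_visit z1 V n = first_visit z2 V n"
      by (simp add: first_visit)
    then have "steps_back z2 V n"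
      using b(1) z(2) pick_eq_0_antimono unfolding steps_back_def by metis
    with b(2) show False by simp
  qed
  then obtain s r c j where "s < n" "r < n" "t \<le> s" "t \<le> r" "z2 r \<le> j" "j < z1 r" "snd (V s) (c, j)"
    by blast
  moreover from this t have "no_cut (up V) (min s r) n"
    using no_cut_antimono[of "up V" t n "min s r"] by simp
  ultimately show ?thesis using that nup by blast
qed

text \<open>
  The offspring numbers that are read at time \<open>n\<close> have not been revealed before the last cut time. The term \<open>n - 1\<close>
  in the minimum accounts for two new vertices at a time without record of the height.
\<close>

lemma back_uncoupled:
  assumes n: "n \<ge> 1" and b: "steps_back z1 V n" "\<not> steps_back z2 V n" and R: "\<not> cut_time (up V) n n"
  obtains i l where "i \<le> n" "l \<le> n" "no_cut (up V) (min i (min l (n - 1))) n"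
    "choice (V n) (z1 i) = 0" "choice (V n) (z2 l) \<noteq> 0"
proof -
  define i where "i = first_visit z1 V n"
  define l where "l = first_visit z2 V n"
  have "no_cut (up V) (min i (min l (n - 1))) n"
    unfolding no_cut_def
  proof (intro allI impI notI)
    fix t assume t: "min i (min l (n - 1)) < t" "cut_time (up V) t n"
    then have "t \<le> n" by (simp add: cut_time_def)
    with t have "t \<le> i" "t \<le> l"
      using first_visit_ge_cut[OF t(2), of n] by (auto simp: i_def l_def)
    with t have "n - 1 < t" by simp
    with \<open>t \<le> n\<close> n have "t = n" by simp
    with t R show False by simp
  qed
  then show ?thesis
    using b by (intro that[of i l]) (auto simp: i_def l_def first_visit_le steps_back_def)
qed

lemma choice_sets: "{w. choice w k = 0} \<in> sets (noise \<beta>)"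
  using measurable_sets[OF measurable_choice, of "{0}" k \<beta>] by (simp add: vimage_def)

context
  fixes \<beta> p :: real
  assumes \<beta>: "\<beta> > 23 / 4"
  defines "p \<equiv> 1 / (1 + \<beta>)"
begin

interpretation S: sequence_space "noise \<beta>"
  by (rule sequence_space_noise)

lemma p0: "0 < p" using \<beta> by (simp add: p_def)
lemma \<beta>0: "\<beta> > 0" using \<beta> by simp

lemma prob_back: "1 \<le> k \<Longrightarrow> measure (noise \<beta>) {w. choice w k = 0} = back_prob \<beta> k"
  using prob_choice[OF \<beta>0, of k 0] by (simp add: back_prob_def)

lemma prob_back_diff:
  assumes "1 \<le> k" "1 \<le> l"
  shows "measure (noise \<beta>) {w. choice w k = 0 \<and> choice w l \<noteq> 0} = max 0 (back_prob \<beta> k - back_prob \<beta> l)"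
proof (cases "l \<le> k")
  case True
  have "\<not> (choice w k = 0 \<and> choice w l \<noteq> 0)" for w
  proof
    assume *: "choice w k = 0 \<and> choice w l \<noteq> 0"
    from pick_eq_0_antimono[OF conjunct1[OF *] True] conjunct2[OF *] show False
      by (rule notE[rotated])
  qed
  then have empty: "{w. choice w k = 0 \<and> choice w l \<noteq> 0} = {}"
    by (simp only: Collect_empty_eq simp_thms)
  have "back_prob \<beta> k \<le> back_prob \<beta> l"
    unfolding back_prob_def using \<beta>0 True by (intro divide_left_mono mult_pos_pos add_pos_nonneg) auto
  then show ?thesis unfolding empty by simp
next
  case False
  then have eq: "{w. choice w k = 0 \<and> choice w l \<noteq> 0} = {w. choice w k = 0} - {w. choice w l = 0}"
    by auto
  have sub: "{w. choice w l = 0} \<subseteq> {w. choice w k = 0}"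
    using False pick_eq_0_antimono[of _ _ l k] by auto
  have diff: "measure (noise \<beta>) {w. choice w k = 0 \<and> choice w l \<noteq> 0} = back_prob \<beta> k - back_prob \<beta> l"
    unfolding eq using sub assms
    by (subst S.M.finite_measure_Diff) (auto simp: choice_sets prob_back)
  have "0 \<le> back_prob \<beta> k - back_prob \<beta> l"
    unfolding diff[symmetric] by (rule measure_nonneg)
  with diff show ?thesis by linarith
qed

lemma integral_ups_next:
  assumes A: "{V. A (up V)} \<in> sets (noise_seq \<beta>)"
    and dep: "\<And>e e' :: nat \<Rightarrow> bool. (\<And>i. i < n \<Longrightarrow> e i = e' i) \<Longrightarrow> A e = A e'"
    and C: "C \<in> sets (noise \<beta>)"
  shows "measure (noise_seq \<beta>) {V. A (up V) \<and> V n \<in> C} =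
    measure (noise_seq \<beta>) {V. A (up V)} * measure (noise \<beta>) C"
proof -
  have Vn: "(\<lambda>V. V n) \<in> noise_seq \<beta> \<rightarrow>\<^sub>M noise \<beta>"
    by (rule measurable_component_singleton) simp
  have "{V. V n \<in> C} \<in> sets (noise_seq \<beta>)"
    using measurable_sets[OF Vn C] by (simp add: vimage_def space_PiM)
  then have s: "{V. A (up V)} \<inter> {V. V n \<in> C} \<in> sets (noise_seq \<beta>)"
    using A by (rule sets.Int[rotated])
  have eq: "{V. A (up V) \<and> V n \<in> C} = {V. A (up V)} \<inter> {V. V n \<in> C}" by auto
  have "measure (noise_seq \<beta>) {V. A (up V) \<and> V n \<in> C} =
    (\<integral>V. indicator ({V. A (up V)} \<inter> {V. V n \<in> C}) V \<partial>noise_seq \<beta>)"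
    using s by (simp add: eq)
  also have "\<dots> = (\<integral>V. indicator {V. A (up V)} V * indicator C (V n) \<partial>noise_seq \<beta>)"
    by (intro Bochner_Integration.integral_cong) (auto simp: indicator_def)
  also have "\<dots> = (\<integral>V. indicator {V. A (up V)} V \<partial>noise_seq \<beta>) * (\<integral>w. indicator C w \<partial>noise \<beta>)"
  proof (rule S.integral_past_next)
    show "(indicator {V. A (up V)} V :: real) = indicator {V. A (up V)} V'"
      if "\<And>i. i < n \<Longrightarrow> V i = V' i" for V V'
      using dep[of "up V" "up V'"] that by (simp add: indicator_def)
    show "\<bar>indicator {V. A (up V)} V\<bar> \<le> (1 :: real)" "\<bar>indicator C w\<bar> \<le> (1 :: real)" for V w
      by (auto simp: indicator_def)
  qed (use A C in auto)
  also have "\<dots> = measure (noise_seq \<beta>) {V. A (up V)} * measure (noise \<beta>) C"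
    using A C by simp
  finally show ?thesis .
qed

text \<open>
  At a record of the height both walks are at new vertices, which gives the first term on the right; the
  second term bounds what happens otherwise.
\<close>

lemma prob_back_diff_le:
  assumes "1 \<le> z1 n" "1 \<le> z2 n"
  shows "measure (noise_seq \<beta>) {V. steps_back z1 V n} - measure (noise_seq \<beta>) {V. steps_back z2 V n} \<le>
    measure (noise_seq \<beta>) {V. cut_time (up V) n n} * (back_prob \<beta> (z1 n) - back_prob \<beta> (z2 n)) +
    measure (noise_seq \<beta>) {V. steps_back z1 V n \<and> \<not> steps_back z2 V n \<and> \<not> cut_time (up V) n n}"
proof -
  let ?R = "{V. cut_time (up V) n n}"
  let ?L = "{V. steps_back z1 V n \<and> \<not> steps_back z2 V n \<and> \<not> cut_time (up V) n n}"
  let ?C = "\<lambda>k. {V. cut_time (up V) n n \<and> V n \<in> {w. choice w k = 0}}"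
  note s = back_sets[of z1 n \<beta>] back_sets[of z2 n \<beta>] cut_sets[of n n]
  have L: "?L \<in> sets (noise_seq \<beta>)"
  proof -
    have "?L = {V. steps_back z1 V n} - {V. steps_back z2 V n} - ?R" by auto
    then show ?thesis using s by auto
  qed
  have C: "?C k \<in> sets (noise_seq \<beta>)" for k
  proof -
    have Vn: "(\<lambda>V. V n) \<in> noise_seq \<beta> \<rightarrow>\<^sub>M noise \<beta>"
      by (rule measurable_component_singleton) simp
    have "{V. V n \<in> {w. choice w k = 0}} \<in> sets (noise_seq \<beta>)"
      using measurable_sets[OF Vn choice_sets[of k]] by (simp add: vimage_def space_PiM)
    then have "?R \<inter> {V. V n \<in> {w. choice w k = 0}} \<in> sets (noise_seq \<beta>)"
      using s(3) by blast
    then show ?thesis by (simp add: Int_def)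
  qed
  have m: "measure (noise_seq \<beta>) (?C k) = measure (noise_seq \<beta>) ?R * back_prob \<beta> k" if "1 \<le> k" for k
    using integral_ups_next[where A = "\<lambda>e. cut_time e n n" and n = n, OF cut_sets cut_time_cong choice_sets, of k]
      prob_back[OF that] by simp
  have int: "integrable (noise_seq \<beta>) (indicator A :: _ \<Rightarrow> real)" if "A \<in> sets (noise_seq \<beta>)" for A
    using that by (simp add: S.P.emeasure_eq_measure)
  have "measure (noise_seq \<beta>) {V. steps_back z1 V n} - measure (noise_seq \<beta>) {V. steps_back z2 V n} =
    (\<integral>V. indicator {V. steps_back z1 V n} V - indicator {V. steps_back z2 V n} V \<partial>noise_seq \<beta>)"
    using s by (subst Bochner_Integration.integral_diff) (auto intro!: int)
  also have "\<dots> \<le> (\<integral>V. (indicator (?C (z1 n)) V - indicator (?C (z2 n)) V) + indicator ?L V \<partial>noise_seq \<beta>)"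
  proof (rule integral_mono)
    fix V :: "nat \<Rightarrow> noise"
    show "(indicator {V. steps_back z1 V n} V - indicator {V. steps_back z2 V n} V :: real) \<le>
      (indicator (?C (z1 n)) V - indicator (?C (z2 n)) V) + indicator ?L V"
      using first_visit_record[of V n z1] first_visit_record[of V n z2]
      by (auto simp: indicator_def steps_back_def)
  qed (use s L C in \<open>auto intro!: int Bochner_Integration.integrable_diff Bochner_Integration.integrable_add\<close>)
  also have "\<dots> = measure (noise_seq \<beta>) (?C (z1 n)) - measure (noise_seq \<beta>) (?C (z2 n)) + measure (noise_seq \<beta>) ?L"
    using L C by (subst Bochner_Integration.integral_add Bochner_Integration.integral_diff;
      (intro int Bochner_Integration.integrable_diff)?; simp)+
  finally show ?thesis
    using m assms by (simp add: right_diff_distrib)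
qed

text \<open>
  The marks of step \<open>n\<close> are independent of the cut times with horizon \<open>n\<close>, which depend on the earlier
  steps only, so each pair of indices contributes a product. The exponent \<open>2 (n - min i l)\<close> in the tail bound is at least \<open>(n - i) + (n - l)\<close>, which
  separates the two sums.
\<close>

lemma prob_overtaken_uncoupled:
  assumes n: "n \<ge> 1" and z: "\<And>i. 1 \<le> z1 i" "\<And>i. 1 \<le> z2 i"
  shows "measure (noise_seq \<beta>) {V. steps_back z1 V n \<and> \<not> steps_back z2 V n \<and> \<not> cut_time (up V) n n} \<le>
    (\<Sum>i\<le>n. \<Sum>l\<le>n. 1000 * p * (99/100) ^ (n - i) * (99/100) ^ (n - l) *
       max 0 (back_prob \<beta> (z1 i) - back_prob \<beta> (z2 l)))"
proof -
  let ?a = "\<lambda>i l. min i (min l (n - 1))"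
  let ?C = "\<lambda>i l. {w. choice w (z1 i) = 0 \<and> choice w (z2 l) \<noteq> 0}"
  let ?E = "\<lambda>i l. {V. no_cut (up V) (?a i l) n \<and> V n \<in> ?C i l}"
  have C: "?C i l \<in> sets (noise \<beta>)" for i l
  proof -
    have "?C i l = {w. choice w (z1 i) = 0} - {w. choice w (z2 l) = 0}" by auto
    then show ?thesis using choice_sets by auto
  qed
  have E: "?E i l \<in> sets (noise_seq \<beta>)" for i l
  proof -
    have Vn: "(\<lambda>V. V n) \<in> noise_seq \<beta> \<rightarrow>\<^sub>M noise \<beta>"
      by (rule measurable_component_singleton) simp
    have "{V. V n \<in> ?C i l} \<in> sets (noise_seq \<beta>)"
      using measurable_sets[OF Vn C[of i l]] by (simp add: vimage_def space_PiM)
    then have "{V. no_cut (up V) (?a i l) n} \<inter> {V. V n \<in> ?C i l} \<in> sets (noise_seq \<beta>)"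
      using no_cut_sets by blast
    then show ?thesis by (simp add: Int_def)
  qed
  have bound: "measure (noise_seq \<beta>) (?E i l) \<le> 1000 * p * (99/100) ^ (n - i) * (99/100) ^ (n - l) *
       max 0 (back_prob \<beta> (z1 i) - back_prob \<beta> (z2 l))" for i l
  proof -
    have "measure (noise_seq \<beta>) (?E i l) = measure (noise_seq \<beta>) {V. no_cut (up V) (?a i l) n} *
        max 0 (back_prob \<beta> (z1 i) - back_prob \<beta> (z2 l))"
      using integral_ups_next[where A = "\<lambda>e. no_cut e (?a i l) n" and n = n, OF no_cut_sets no_cut_cong C, of i l]
        prob_back_diff[of "z1 i" "z2 l"] z by simp
    also have "\<dots> \<le> (1000 * p * (99/100) ^ (n - i) * (99/100) ^ (n - l)) *
        max 0 (back_prob \<beta> (z1 i) - back_prob \<beta> (z2 l))"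
    proof (rule mult_right_mono)
      have "measure (noise_seq \<beta>) {V. no_cut (up V) (?a i l) n} \<le> 1000 * p * (99/100) ^ (2 * (n - ?a i l))"
        using prob_no_cut[OF \<beta>, of "?a i l" n] n by (simp add: p_def)
      also have "\<dots> \<le> 1000 * p * (99/100) ^ ((n - i) + (n - l))"
        using p0 by (intro mult_left_mono power_decreasing) auto
      finally show "measure (noise_seq \<beta>) {V. no_cut (up V) (?a i l) n} \<le>
          1000 * p * (99/100) ^ (n - i) * (99/100) ^ (n - l)"
        by (simp add: power_add mult.assoc)
    qed simp
    finally show ?thesis .
  qed
  have "measure (noise_seq \<beta>) {V. steps_back z1 V n \<and> \<not> steps_back z2 V n \<and> \<not> cut_time (up V) n n} \<le>
      measure (noise_seq \<beta>) (\<Union>i\<in>{..n}. \<Union>l\<in>{..n}. ?E i l)"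
  proof (rule S.P.finite_measure_mono)
    show "{V. steps_back z1 V n \<and> \<not> steps_back z2 V n \<and> \<not> cut_time (up V) n n} \<subseteq> (\<Union>i\<in>{..n}. \<Union>l\<in>{..n}. ?E i l)"
    proof clarify
      fix V assume V: "steps_back z1 V n" "\<not> steps_back z2 V n" "\<not> cut_time (up V) n n"
      obtain i l where "i \<le> n" "l \<le> n" "no_cut (up V) (min i (min l (n - 1))) n"
        "choice (V n) (z1 i) = 0" "choice (V n) (z2 l) \<noteq> 0"
        by (rule back_uncoupled[OF n V])
      then show "V \<in> (\<Union>i\<in>{..n}. \<Union>l\<in>{..n}. ?E i l)"
        by (intro UN_I[of i] UN_I[of l]) auto
    qed
  qed (use E in auto)
  also have "\<dots> \<le> (\<Sum>i\<le>n. measure (noise_seq \<beta>) (\<Union>l\<in>{..n}. ?E i l))"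
    using E by (intro S.P.finite_measure_subadditive_finite) auto
  also have "\<dots> \<le> (\<Sum>i\<le>n. \<Sum>l\<le>n. measure (noise_seq \<beta>) (?E i l))"
    using E by (intro sum_mono S.P.finite_measure_subadditive_finite) auto
  also have "\<dots> \<le> (\<Sum>i\<le>n. \<Sum>l\<le>n. 1000 * p * (99/100) ^ (n - i) * (99/100) ^ (n - l) *
       max 0 (back_prob \<beta> (z1 i) - back_prob \<beta> (z2 l)))"
    by (intro sum_mono bound)
  finally show ?thesis .
qed

text \<open>
  Cut times depend on the marks at \<open>1\<close> only, and these are independent of all other marks, even within one step.
\<close>

lemma ups_marks_indep:
  assumes A: "{V. A (up V)} \<in> sets (noise_seq \<beta>)"
    and dep: "\<And>e e' :: nat \<Rightarrow> bool. (\<And>i. i < n \<Longrightarrow> e i = e' i) \<Longrightarrow> A e = A e'"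
    and B: "B \<in> sets (marks \<beta>)"
  shows "measure (noise_seq \<beta>) {V. A (up V) \<and> snd (V s) \<in> B} =
    measure (noise_seq \<beta>) {V. A (up V)} * measure (noise \<beta>) {w. snd w \<in> B}"
proof -
  let ?c = "measure_pmf (bernoulli_pmf (\<beta> / (1 + \<beta>)))"
  let ?zip = "\<lambda>(f, g) i. (f i, g i)"
  interpret Q: prob_space "PiM (UNIV :: nat set) (\<lambda>_. marks \<beta>)"
    by (intro prob_space_PiM prob_space_marks)
  interpret QC: prob_space "PiM (UNIV :: nat set) (\<lambda>_. ?c)"
    by (intro prob_space_PiM measure_pmf.prob_space_axioms)
  have eq: "noise_seq \<beta> = distr (PiM UNIV (\<lambda>_. ?c) \<Otimes>\<^sub>M PiM UNIV (\<lambda>_. marks \<beta>)) (noise_seq \<beta>) ?zip"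
    unfolding noise_def by (rule PiM_zip[symmetric]) (simp_all add: measure_pmf.prob_space_axioms prob_space_marks)
  have zip: "?zip \<in> PiM UNIV (\<lambda>_. ?c) \<Otimes>\<^sub>M PiM UNIV (\<lambda>_. marks \<beta>) \<rightarrow>\<^sub>M noise_seq \<beta>"
    unfolding noise_def case_prod_beta
    by (rule measurable_PiM_single') (auto simp: space_PiM space_pair_measure)
  have Am: "{f. A f} \<in> sets (PiM (UNIV :: nat set) (\<lambda>_. ?c))"
  proof -
    let ?emb = "\<lambda>f i. (f i, \<lambda>_. False)"
    have "?emb \<in> PiM (UNIV :: nat set) (\<lambda>_. ?c) \<rightarrow>\<^sub>M noise_seq \<beta>"
    proof (rule measurable_PiM_single')
      show "(\<lambda>f. (f i, \<lambda>_. False)) \<in> PiM UNIV (\<lambda>_. ?c) \<rightarrow>\<^sub>M noise \<beta>" for i :: nat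
        unfolding noise_def by (intro measurable_Pair measurable_component_singleton) auto
    qed (auto simp: space_PiM)
    from measurable_sets[OF this A] show ?thesis by (simp add: vimage_def space_PiM)
  qed
  have Bm: "{g. g s \<in> B} \<in> sets (PiM UNIV (\<lambda>_. marks \<beta>))" if "B \<in> sets (marks \<beta>)" for B
    using measurable_sets[OF measurable_component_singleton[of s UNIV "\<lambda>_. marks \<beta>"] that]
    by (simp add: vimage_def space_PiM)
  have Vs: "(\<lambda>V. snd (V s)) \<in> noise_seq \<beta> \<rightarrow>\<^sub>M marks \<beta>"
    by (rule measurable_compose[of "\<lambda>V. V s", OF measurable_component_singleton measurable_snd_noise]) simp
  have main: "measure (noise_seq \<beta>) {V. A' (up V) \<and> snd (V s) \<in> B} =
      measure (PiM UNIV (\<lambda>_. ?c)) {f. A' f} * measure (PiM UNIV (\<lambda>_. marks \<beta>)) {g. g s \<in> B}"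
    if A': "{V. A' (up V)} \<in> sets (noise_seq \<beta>)" "{f. A' f} \<in> sets (PiM UNIV (\<lambda>_. ?c))"
      and B: "B \<in> sets (marks \<beta>)" for A' B
  proof -
    have "{V. snd (V s) \<in> B} \<in> sets (noise_seq \<beta>)"
      using measurable_sets[OF Vs B] by (simp add: vimage_def space_PiM)
    then have "{V. A' (up V)} \<inter> {V. snd (V s) \<in> B} \<in> sets (noise_seq \<beta>)"
      using A' by blast
    then have s: "{V. A' (up V) \<and> snd (V s) \<in> B} \<in> sets (noise_seq \<beta>)"
      by (simp add: Int_def)
    have "emeasure (noise_seq \<beta>) {V. A' (up V) \<and> snd (V s) \<in> B} =
      emeasure (distr (PiM UNIV (\<lambda>_. ?c) \<Otimes>\<^sub>M PiM UNIV (\<lambda>_. marks \<beta>)) (noise_seq \<beta>) ?zip) {V. A' (up V) \<and> snd (V s) \<in> B}"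
      using eq by (rule arg_cong)
    also have "\<dots> = emeasure (PiM UNIV (\<lambda>_. ?c) \<Otimes>\<^sub>M PiM UNIV (\<lambda>_. marks \<beta>)) ({f. A' f} \<times> {g. g s \<in> B})"
      by (subst emeasure_distr[OF zip s], rule arg_cong[where f = "emeasure _"])
         (auto simp: space_PiM space_pair_measure)
    also have "\<dots> = emeasure (PiM UNIV (\<lambda>_. ?c)) {f. A' f} * emeasure (PiM UNIV (\<lambda>_. marks \<beta>)) {g. g s \<in> B}"
      by (rule Q.emeasure_pair_measure_Times[OF A'(2) Bm[OF B]])
    finally show ?thesis by (simp add: measure_def enn2real_mult)
  qed
  have "measure (PiM UNIV (\<lambda>_. ?c)) {f. A f} = measure (noise_seq \<beta>) {V. A (up V)}"
    using main[of A UNIV] A Am Q.prob_space sets.top[of "marks \<beta>"] by (simp add: space_PiM)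
  moreover have "measure (PiM UNIV (\<lambda>_. marks \<beta>)) {g. g s \<in> B} = measure (noise_seq \<beta>) {V. snd (V s) \<in> B}"
    using main[of "\<lambda>_. True" B] B QC.prob_space S.P.prob_space sets.top[of "noise_seq \<beta>"]
      sets.top[of "PiM UNIV (\<lambda>_ :: nat. ?c)"] by (simp add: space_PiM)
  moreover have "measure (noise_seq \<beta>) {V. snd (V s) \<in> B} = measure (noise \<beta>) {w. snd w \<in> B}"
  proof -
    have s: "{w. snd w \<in> B} \<in> sets (noise \<beta>)"
      using measurable_sets[OF measurable_snd_noise B] by (simp add: vimage_def)
    have "measure (noise \<beta>) {w. snd w \<in> B} = measure (distr (noise_seq \<beta>) (noise \<beta>) (\<lambda>V. V s)) {w. snd w \<in> B}"
      using S.PiM_component[of s] by simp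
    also have "\<dots> = measure (noise_seq \<beta>) {V. snd (V s) \<in> B}"
      using s by (subst measure_distr) (auto simp: vimage_def space_PiM)
    finally show ?thesis ..
  qed
  ultimately show ?thesis using main[OF A Am B] by simp
qed

lemma prob_marked_between:
  assumes "1 \<le> a" "a \<le> b"
  shows "measure (noise \<beta>) {w. \<exists>c j. a \<le> j \<and> j < b \<and> snd w (c, j)} \<le> 2 * (1 - real a / real b)"
proof -
  let ?N = "\<lambda>c. {w. \<forall>i\<in>Pair c ` {a..<b}. \<not> snd w i}"
  have N: "?N c \<in> sets (noise \<beta>)" for c
  proof -
    have "{w \<in> space (noise \<beta>). \<forall>i\<in>Pair c ` {a..<b}. \<not> snd w i} \<in> sets (noise \<beta>)" by measurable
    then show ?thesis by simp
  qed
  have PN: "measure (noise \<beta>) (?N c) = (\<Prod>i\<in>Pair c ` {a..<b}. 1 - mark_prob \<beta> i)" for c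
    using measure_noise_cylinder[OF \<beta>0, of "{}" "Pair c ` {a..<b}" UNIV] by simp
  have eq: "{w. \<exists>c j. a \<le> j \<and> j < b \<and> snd w (c, j)} = (space (noise \<beta>) - ?N False) \<union> (space (noise \<beta>) - ?N True)"
    by (auto simp: ex_bool_eq)
  have "measure (noise \<beta>) {w. \<exists>c j. a \<le> j \<and> j < b \<and> snd w (c, j)} \<le>
      measure (noise \<beta>) (space (noise \<beta>) - ?N False) + measure (noise \<beta>) (space (noise \<beta>) - ?N True)"
    unfolding eq by (intro measure_Un_le sets.compl_sets N)
  also have "\<dots> = (1 - (1 + \<beta> * real a) / (1 + \<beta> * real b)) + (1 - real a / real b)"
    by (simp only: S.M.prob_compl[OF N] PN prod_unmarked_False[OF \<beta>0 assms(2)] prod_unmarked_True[OF assms])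
  also have "1 - (1 + \<beta> * real a) / (1 + \<beta> * real b) \<le> 1 - real a / real b"
  proof -
    have "real a / real b \<le> (1 + \<beta> * real a) / (1 + \<beta> * real b)"
      using assms \<beta>0 by (simp add: frac_le_eq field_simps add_pos_nonneg)
    then show ?thesis by simp
  qed
  finally show ?thesis by simp
qed

text \<open>
  Three independent events are needed: no cut time since the separation, a mark that has separated the walks, and
  no mark at \<open>1\<close> in step \<open>n\<close>. The last one gives a second factor \<open>p\<close>.
\<close>

lemma prob_overtaken_coupled:
  assumes z: "\<And>i. 1 \<le> z2 i" "\<And>i. z2 i \<le> z1 i"
  shows "measure (noise_seq \<beta>) {V. steps_back z1 V n \<and> \<not> steps_back z2 V n \<and> \<not> cut_time (up V) n n} \<le>
    (\<Sum>s<n. \<Sum>r<n. 1000 * p * (99/100) ^ (n - s) * (99/100) ^ (n - r) *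
       (p * (2 * (1 - real (z2 r) / real (z1 r)))))"
proof -
  let ?B = "\<lambda>r. {v. \<exists>c j. z2 r \<le> j \<and> j < z1 r \<and> v (c, j)}"
  let ?A = "\<lambda>s r V. no_cut (up V) (min s r) n \<and> snd (V s) \<in> ?B r"
  let ?E = "\<lambda>s r. {V. ?A s r V \<and> \<not> fst (V n)}"
  have B: "?B r \<in> sets (marks \<beta>)" for r
  proof -
    have "{v \<in> space (marks \<beta>). \<exists>c j. z2 r \<le> j \<and> j < z1 r \<and> v (c, j)} \<in> sets (marks \<beta>)" by measurable
    then show ?thesis by simp
  qed
  have A: "{V. ?A s r V} \<in> sets (noise_seq \<beta>)" for s r
  proof -
    have Vs: "(\<lambda>V. snd (V s)) \<in> noise_seq \<beta> \<rightarrow>\<^sub>M marks \<beta>"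
      by (rule measurable_compose[of "\<lambda>V. V s", OF measurable_component_singleton measurable_snd_noise]) simp
    have "{V. snd (V s) \<in> ?B r} \<in> sets (noise_seq \<beta>)"
      using measurable_sets[OF Vs B[of r]] by (simp add: vimage_def space_PiM)
    then have "{V. no_cut (up V) (min s r) n} \<inter> {V. snd (V s) \<in> ?B r} \<in> sets (noise_seq \<beta>)"
      using no_cut_sets by blast
    then show ?thesis by (simp add: Int_def)
  qed
  have Vn: "{V. \<not> fst (V n)} \<in> sets (noise_seq \<beta>)"
  proof -
    have "(\<lambda>V. fst (V n)) \<in> noise_seq \<beta> \<rightarrow>\<^sub>M count_space UNIV"
      by (rule measurable_compose[of "\<lambda>V. V n", OF measurable_component_singleton measurable_fst_noise]) simp
    from measurable_sets[OF this, of "{False}"] show ?thesis by (simp add: vimage_def space_PiM)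
  qed
  have nf: "{w. \<not> fst w} \<in> sets (noise \<beta>)"
    using measurable_sets[OF measurable_fst_noise, of "{False}" \<beta>] by (simp add: vimage_def)
  have E: "?E s r \<in> sets (noise_seq \<beta>)" for s r
  proof -
    have "{V. ?A s r V} \<inter> {V. \<not> fst (V n)} \<in> sets (noise_seq \<beta>)" using A Vn by blast
    then show ?thesis by (simp add: Int_def conj_assoc)
  qed
  have bound: "measure (noise_seq \<beta>) (?E s r) \<le> 1000 * p * (99/100) ^ (n - s) * (99/100) ^ (n - r) *
       (p * (2 * (1 - real (z2 r) / real (z1 r))))" if s: "s < n" and r: "r < n" for s r
  proof -
    have "measure (noise_seq \<beta>) (?E s r) = (\<integral>V. indicator (?E s r) V \<partial>noise_seq \<beta>)"
      using E by simp
    also have "\<dots> = (\<integral>V. indicator {V. ?A s r V} V * indicator {w. \<not> fst w} (V n) \<partial>noise_seq \<beta>)"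
      by (intro Bochner_Integration.integral_cong) (auto simp: indicator_def)
    also have "\<dots> = (\<integral>V. indicator {V. ?A s r V} V \<partial>noise_seq \<beta>) * (\<integral>w. indicator {w. \<not> fst w} w \<partial>noise \<beta>)"
    proof (rule S.integral_past_next)
      show "(indicator {V. ?A s r V} V :: real) = indicator {V. ?A s r V} V'"
        if "\<And>i. i < n \<Longrightarrow> V i = V' i" for V V'
        using no_cut_cong[of n "up V" "up V'" "min s r"] that s by (simp add: indicator_def)
      show "\<bar>indicator {V. ?A s r V} V\<bar> \<le> (1 :: real)" "\<bar>indicator {w. \<not> fst w} w\<bar> \<le> (1 :: real)" for V w
        by (auto simp: indicator_def)
    qed (use A nf in auto)
    also have "\<dots> = measure (noise_seq \<beta>) {V. ?A s r V} * p"
      using A nf prob_up(2)[OF \<beta>] by (simp add: p_def)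
    also have "measure (noise_seq \<beta>) {V. ?A s r V} =
        measure (noise_seq \<beta>) {V. no_cut (up V) (min s r) n} * measure (noise \<beta>) {w. snd w \<in> ?B r}"
      by (rule ups_marks_indep[where A = "\<lambda>e. no_cut e (min s r) n" and n = n, OF no_cut_sets no_cut_cong B])
    also have "\<dots> \<le> (1000 * p * (99/100) ^ (n - s) * (99/100) ^ (n - r)) * (2 * (1 - real (z2 r) / real (z1 r)))"
    proof (rule mult_mono)
      have "measure (noise_seq \<beta>) {V. no_cut (up V) (min s r) n} \<le> 1000 * p * (99/100) ^ (2 * (n - min s r))"
        using prob_no_cut[OF \<beta>, of "min s r" n] s by (simp add: p_def)
      also have "\<dots> \<le> 1000 * p * (99/100) ^ ((n - s) + (n - r))"
        using p0 by (intro mult_left_mono power_decreasing) auto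
      finally show "measure (noise_seq \<beta>) {V. no_cut (up V) (min s r) n} \<le>
          1000 * p * (99/100) ^ (n - s) * (99/100) ^ (n - r)"
        by (simp add: power_add mult.assoc)
      show "measure (noise \<beta>) {w. snd w \<in> ?B r} \<le> 2 * (1 - real (z2 r) / real (z1 r))"
        using prob_marked_between[of "z2 r" "z1 r"] z by simp
    qed (use p0 in auto)
    finally show ?thesis using p0 by (simp add: mult_ac mult_right_mono)
  qed
  have "measure (noise_seq \<beta>) {V. steps_back z1 V n \<and> \<not> steps_back z2 V n \<and> \<not> cut_time (up V) n n} \<le>
      measure (noise_seq \<beta>) (\<Union>s\<in>{..<n}. \<Union>r\<in>{..<n}. ?E s r)"
  proof (rule S.P.finite_measure_mono)
    show "{V. steps_back z1 V n \<and> \<not> steps_back z2 V n \<and> \<not> cut_time (up V) n n} \<subseteq> (\<Union>s\<in>{..<n}. \<Union>r\<in>{..<n}. ?E s r)"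
    proof clarify
      fix V assume V: "steps_back z1 V n" "\<not> steps_back z2 V n"
      obtain s r c j where "\<not> fst (V n)" "s < n" "r < n" "no_cut (up V) (min s r) n"
        "z2 r \<le> j" "j < z1 r" "snd (V s) (c, j)"
        by (rule back_coupled[OF z V])
      then show "V \<in> (\<Union>s\<in>{..<n}. \<Union>r\<in>{..<n}. ?E s r)"
        by (intro UN_I[of s] UN_I[of r]) auto
    qed
  qed (use E in auto)
  also have "\<dots> \<le> (\<Sum>s<n. measure (noise_seq \<beta>) (\<Union>r\<in>{..<n}. ?E s r))"
    using E by (intro S.P.finite_measure_subadditive_finite) auto
  also have "\<dots> \<le> (\<Sum>s<n. \<Sum>r<n. measure (noise_seq \<beta>) (?E s r))"
    using E by (intro sum_mono S.P.finite_measure_subadditive_finite) auto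
  also have "\<dots> \<le> (\<Sum>s<n. \<Sum>r<n. 1000 * p * (99/100) ^ (n - s) * (99/100) ^ (n - r) *
       (p * (2 * (1 - real (z2 r) / real (z1 r)))))"
    by (intro sum_mono bound) auto
  finally show ?thesis .
qed

end

section \<open>The driven walk has the averaged law\<close>

lemma (in sequence_space) emeasure_past_next:
  fixes F :: "(nat \<Rightarrow> 'a) \<Rightarrow> 'b :: countable"
  assumes F: "F \<in> S \<rightarrow>\<^sub>M count_space UNIV"
    and dep: "\<And>\<omega> \<omega>'. (\<And>i. i < n \<Longrightarrow> \<omega> i = \<omega>' i) \<Longrightarrow> F \<omega> = F \<omega>'"
    and Q: "\<And>b. {x \<in> space M. Q b x} \<in> sets M"
  shows "emeasure S {\<omega> \<in> space S. Q (F \<omega>) (\<omega> n)} = (\<integral>\<^sup>+\<omega>. emeasure M {x \<in> space M. Q (F \<omega>) x} \<partial>S)"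
proof -
  have Qm: "(\<lambda>\<omega>. Q b (\<omega> i)) \<in> S \<rightarrow>\<^sub>M count_space UNIV" for b i
  proof (rule measurable_compose[where f = "\<lambda>\<omega>. \<omega> i" and g = "Q b"])
    show "(\<lambda>\<omega>. \<omega> i) \<in> S \<rightarrow>\<^sub>M M" by (rule measurable_component_singleton) simp
    show "Q b \<in> M \<rightarrow>\<^sub>M count_space UNIV" using Q[of b] by (simp add: pred_def)
  qed
  have E: "{\<omega> \<in> space S. Q (F \<omega>) (\<omega> n)} \<in> sets S"
    using measurable_compose_countable[where f = "\<lambda>b \<omega>. Q b (\<omega> n)" and g = F, OF Qm F]
    by (simp add: pred_def)
  let ?D = "{p \<in> space (S \<Otimes>\<^sub>M S). Q (F (fst p)) (snd p 0)}"
  have D: "?D \<in> sets (S \<Otimes>\<^sub>M S)"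
  proof -
    have "(\<lambda>p. Q b (snd p 0)) \<in> S \<Otimes>\<^sub>M S \<rightarrow>\<^sub>M count_space UNIV" for b
      by (rule measurable_compose[OF measurable_snd Qm])
    moreover have "(\<lambda>p. F (fst p)) \<in> S \<Otimes>\<^sub>M S \<rightarrow>\<^sub>M count_space UNIV"
      by (rule measurable_compose[OF measurable_fst F])
    ultimately have "(\<lambda>p. Q (F (fst p)) (snd p 0)) \<in> S \<Otimes>\<^sub>M S \<rightarrow>\<^sub>M count_space UNIV"
      by (rule measurable_compose_countable[where f = "\<lambda>b p. Q b (snd p 0)" and g = "\<lambda>p. F (fst p)"])
    then show ?thesis by (simp add: pred_def)
  qed
  have comb: "(\<lambda>(\<omega>, \<omega>'). comb_seq n \<omega> \<omega>') \<in> S \<Otimes>\<^sub>M S \<rightarrow>\<^sub>M S"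
    by (rule measurable_comb_seq)
  have "emeasure S {\<omega> \<in> space S. Q (F \<omega>) (\<omega> n)} =
      emeasure (distr (S \<Otimes>\<^sub>M S) S (\<lambda>(\<omega>, \<omega>'). comb_seq n \<omega> \<omega>')) {\<omega> \<in> space S. Q (F \<omega>) (\<omega> n)}"
    by (simp only: PiM_comb_seq)
  also have "\<dots> = emeasure (S \<Otimes>\<^sub>M S) ?D"
  proof (subst emeasure_distr[OF comb E], rule arg_cong[where f = "emeasure _"])
    have 1: "F (comb_seq n \<omega> \<omega>') = F \<omega>" for \<omega> \<omega>'
      by (rule dep) (simp add: comb_seq_less)
    have 2: "comb_seq n \<omega> \<omega>' n = \<omega>' 0" for \<omega> \<omega>' :: "nat \<Rightarrow> 'a"
      by (simp add: comb_seq_def)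
    show "(\<lambda>(\<omega>, \<omega>'). comb_seq n \<omega> \<omega>') -` {\<omega> \<in> space S. Q (F \<omega>) (\<omega> n)} \<inter> space (S \<Otimes>\<^sub>M S) = ?D"
      using measurable_space[OF comb] by (auto simp: 1 2)
  qed
  also have "\<dots> = (\<integral>\<^sup>+\<omega>. emeasure S (Pair \<omega> -` ?D) \<partial>S)"
    using D by (rule P.emeasure_pair_measure_alt)
  also have "\<dots> = (\<integral>\<^sup>+\<omega>. emeasure M {x \<in> space M. Q (F \<omega>) x} \<partial>S)"
  proof (rule nn_integral_cong)
    fix \<omega> assume "\<omega> \<in> space S"
    then have "Pair \<omega> -` ?D = {\<omega>' \<in> space S. \<omega>' 0 \<in> {x \<in> space M. Q (F \<omega>) x}}"
      by (auto simp: space_pair_measure space_PiM)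
    then show "emeasure S (Pair \<omega> -` ?D) = emeasure M {x \<in> space M. Q (F \<omega>) x}"
      using emeasure_PiM_Collect_single[OF UNIV_I Q, of 0 "F \<omega>"] by simp
  qed
  finally show ?thesis .
qed

lemma measurable_pmf_component:
  "(\<lambda>z. z i) \<in> PiM UNIV (\<lambda>_. measure_pmf P) \<rightarrow>\<^sub>M count_space UNIV"
proof -
  have "(\<lambda>z. z i) \<in> PiM UNIV (\<lambda>_. measure_pmf P) \<rightarrow>\<^sub>M measure_pmf P"
    by (rule measurable_component_singleton) simp
  then show ?thesis by (simp cong: measurable_cong_sets)
qed

primrec quenched_pos :: "(vertex \<Rightarrow> nat) \<Rightarrow> (nat \<Rightarrow> noise) \<Rightarrow> nat \<Rightarrow> vertex" where
  "quenched_pos \<omega> V 0 = []"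
| "quenched_pos \<omega> V (Suc n) = move (V n) (\<omega> (quenched_pos \<omega> V n)) (quenched_pos \<omega> V n)"

lemma quenched_pos_cong: "(\<And>i. i < n \<Longrightarrow> V i = V' i) \<Longrightarrow> quenched_pos \<omega> V n = quenched_pos \<omega> V' n"
  by (induction n) auto

lemma measurable_quenched_pos:
  assumes \<Omega>: "\<And>x. (\<lambda>\<omega>. \<Omega> \<omega> x) \<in> M \<rightarrow>\<^sub>M count_space UNIV"
    and V: "\<And>i. (\<lambda>\<omega>. V \<omega> i) \<in> M \<rightarrow>\<^sub>M noise \<beta>"
  shows "(\<lambda>\<omega>. quenched_pos (\<Omega> \<omega>) (V \<omega>) n) \<in> M \<rightarrow>\<^sub>M count_space UNIV"
proof (induction n)
  case (Suc n)
  have "(\<lambda>\<omega>. move (V \<omega> n) k x) \<in> M \<rightarrow>\<^sub>M count_space UNIV" for k x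
    by (rule measurable_compose[OF V measurable_move])
  then have "(\<lambda>\<omega>. move (V \<omega> n) (\<Omega> \<omega> x) x) \<in> M \<rightarrow>\<^sub>M count_space UNIV" for x
    by (rule measurable_compose_countable[where f = "\<lambda>k \<omega>. move (V \<omega> n) k x" and g = "\<lambda>\<omega>. \<Omega> \<omega> x", OF _ \<Omega>])
  then have "(\<lambda>\<omega>. move (V \<omega> n) (\<Omega> \<omega> (quenched_pos (\<Omega> \<omega>) (V \<omega>) n)) (quenched_pos (\<Omega> \<omega>) (V \<omega>) n)) \<in> M \<rightarrow>\<^sub>M count_space UNIV"
    by (rule measurable_compose_countable[where f = "\<lambda>x \<omega>. move (V \<omega> n) (\<Omega> \<omega> x) x" and
          g = "\<lambda>\<omega>. quenched_pos (\<Omega> \<omega>) (V \<omega>) n", OF _ Suc])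
  then show ?case by (simp only: quenched_pos.simps)
qed simp

text \<open>
  The one-time distributions of the walk on a fixed tree determine the first two moments of the distance
  from the root. Apart from the walk moving along edges, this is what the law of large numbers rests on.
\<close>

primrec walk_marginal :: "real \<Rightarrow> (vertex \<Rightarrow> nat) \<Rightarrow> nat \<Rightarrow> vertex pmf" where
  "walk_marginal \<beta> \<omega> 0 = return_pmf []"
| "walk_marginal \<beta> \<omega> (Suc n) = bind_pmf (walk_marginal \<beta> \<omega> n) (step \<beta> \<omega>)"

lemma distr_quenched_pos:
  assumes \<beta>: "\<beta> > 0" and \<omega>: "\<And>x. \<omega> x > 0"
  shows "distr (noise_seq \<beta>) (count_space UNIV) (\<lambda>V. quenched_pos \<omega> V n) = measure_pmf (walk_marginal \<beta> \<omega> n)"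
proof (induction n)
  interpret S: sequence_space "noise \<beta>" by (rule sequence_space_noise)
  case 0
  show ?case
    by (rule measure_eqI) (auto simp: emeasure_distr S.P.emeasure_space_1 indicator_def)
next
  interpret S: sequence_space "noise \<beta>" by (rule sequence_space_noise)
  case (Suc n)
  have qm: "(\<lambda>V. quenched_pos \<omega> V n) \<in> noise_seq \<beta> \<rightarrow>\<^sub>M count_space UNIV" for n
    by (rule measurable_quenched_pos[where \<Omega> = "\<lambda>_. \<omega>" and V = "\<lambda>V. V" and \<beta> = \<beta>])
       (auto intro: measurable_component_singleton)
  show ?case
  proof (rule measure_eqI)
    fix A :: "vertex set"
    have "emeasure (distr (noise_seq \<beta>) (count_space UNIV) (\<lambda>V. quenched_pos \<omega> V (Suc n))) A =
      emeasure (noise_seq \<beta>) {V \<in> space (noise_seq \<beta>). move (V n) (\<omega> (quenched_pos \<omega> V n)) (quenched_pos \<omega> V n) \<in> A}"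
      by (subst emeasure_distr[OF qm]) (auto intro!: arg_cong[where f = "emeasure _"])
    also have "\<dots> = (\<integral>\<^sup>+V. emeasure (noise \<beta>) {w \<in> space (noise \<beta>). move w (\<omega> (quenched_pos \<omega> V n)) (quenched_pos \<omega> V n) \<in> A} \<partial>noise_seq \<beta>)"
    proof (rule S.emeasure_past_next[where F = "\<lambda>V. quenched_pos \<omega> V n" and Q = "\<lambda>x w. move w (\<omega> x) x \<in> A", OF qm quenched_pos_cong])
      show "{w \<in> space (noise \<beta>). move w (\<omega> x) x \<in> A} \<in> sets (noise \<beta>)" for x
        using measurable_sets[OF measurable_move, of A "\<omega> x" x \<beta>] by (simp add: vimage_def)
    qed
    also have "\<dots> = (\<integral>\<^sup>+V. emeasure (measure_pmf (step \<beta> \<omega> (quenched_pos \<omega> V n))) A \<partial>noise_seq \<beta>)"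
    proof (rule nn_integral_cong)
      fix V
      have "emeasure (noise \<beta>) {w \<in> space (noise \<beta>). move w (\<omega> x) x \<in> A} = emeasure (measure_pmf (step \<beta> \<omega> x)) A" for x
        unfolding distr_move[where \<omega> = \<omega> and x = x, OF \<beta> \<omega>, symmetric]
        by (subst emeasure_distr[OF measurable_move]) (auto intro!: arg_cong[where f = "emeasure _"])
      then show "emeasure (noise \<beta>) {w \<in> space (noise \<beta>). move w (\<omega> (quenched_pos \<omega> V n)) (quenched_pos \<omega> V n) \<in> A} =
        emeasure (measure_pmf (step \<beta> \<omega> (quenched_pos \<omega> V n))) A" .
    qed
    also have "\<dots> = (\<integral>\<^sup>+x. emeasure (measure_pmf (step \<beta> \<omega> x)) A \<partial>distr (noise_seq \<beta>) (count_space UNIV) (\<lambda>V. quenched_pos \<omega> V n))"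
      by (rule nn_integral_distr[OF qm, symmetric]) simp
    also have "\<dots> = emeasure (measure_pmf (walk_marginal \<beta> \<omega> (Suc n))) A"
      by (simp add: Suc emeasure_bind_pmf)
    finally show "emeasure (distr (noise_seq \<beta>) (count_space UNIV) (\<lambda>V. quenched_pos \<omega> V (Suc n))) A =
      emeasure (measure_pmf (walk_marginal \<beta> \<omega> (Suc n))) A" .
  qed simp
qed

lemma nn_integral_walk_C:
  "(\<integral>\<^sup>+X. f (X n) \<partial>biased_walk.C \<beta> \<omega> 0 (Suc n) (\<lambda>_. undefined)) = (\<integral>\<^sup>+x. f x \<partial>measure_pmf (walk_marginal \<beta> \<omega> n))"
proof (induction n arbitrary: f)
  case (0 f)
  have u: "(\<lambda>_. undefined) \<in> space (PiM {0..<0::nat} (\<lambda>_. count_space (UNIV :: vertex set)))" by simp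
  have m: "(\<lambda>X. f (X 0)) \<in> borel_measurable (PiM {0..<Suc 0} (\<lambda>_. count_space (UNIV :: vertex set)))"
    by (rule measurable_compose[OF measurable_component_singleton]) auto
  have "(\<integral>\<^sup>+X. f (X 0) \<partial>biased_walk.C \<beta> \<omega> 0 (Suc 0) (\<lambda>_. undefined)) =
      (\<integral>\<^sup>+X. f (X 0) \<partial>biased_walk.eP \<beta> \<omega> 0 (\<lambda>_. undefined))"
    using u biased_walk.measurable_eP[of \<beta> \<omega> 0] by (simp add: bind_return)
  also have "\<dots> = f []"
    using u m by (subst biased_walk.nn_integral_eP) (auto simp: walk_kernel_def)
  finally show ?case by simp
next
  case (Suc n f)
  let ?C = "biased_walk.C \<beta> \<omega> 0 (Suc n) (\<lambda>_. undefined)"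
  have u: "(\<lambda>_. undefined) \<in> space (PiM {0..<0::nat} (\<lambda>_. count_space (UNIV :: vertex set)))" by simp
  have spC: "space ?C = space (PiM {0..<Suc n} (\<lambda>_. count_space UNIV))"
    using biased_walk.space_C[OF u, of \<beta> \<omega> "Suc n"] by simp
  have setsC: "sets ?C = sets (PiM {0..<Suc n} (\<lambda>_. count_space UNIV))"
    using biased_walk.sets_C[OF u, of \<beta> \<omega> "Suc n"] by simp
  have m: "(\<lambda>X. f (X (Suc n))) \<in> borel_measurable (PiM {0..<Suc (Suc n)} (\<lambda>_. count_space (UNIV :: vertex set)))"
    by (rule measurable_compose[OF measurable_component_singleton]) auto
  have eP: "biased_walk.eP \<beta> \<omega> (Suc n) \<in> ?C \<rightarrow>\<^sub>M subprob_algebra (PiM {0..<Suc (Suc n)} (\<lambda>_. count_space UNIV))"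
    using biased_walk.measurable_eP[of \<beta> \<omega> "Suc n"] setsC by (simp cong: measurable_cong_sets)
  have "(\<integral>\<^sup>+X. f (X (Suc n)) \<partial>biased_walk.C \<beta> \<omega> 0 (Suc (Suc n)) (\<lambda>_. undefined)) =
      (\<integral>\<^sup>+X. f (X (Suc n)) \<partial>(?C \<bind> biased_walk.eP \<beta> \<omega> (Suc n)))"
    by (subst biased_walk.C.simps(2)) simp
  also have "\<dots> = (\<integral>\<^sup>+X. \<integral>\<^sup>+X'. f (X' (Suc n)) \<partial>biased_walk.eP \<beta> \<omega> (Suc n) X \<partial>?C)"
    by (rule nn_integral_bind[OF m eP])
  also have "\<dots> = (\<integral>\<^sup>+X. (\<integral>\<^sup>+y. f y \<partial>measure_pmf (step \<beta> \<omega> (X n))) \<partial>?C)"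
  proof (rule nn_integral_cong)
    fix X assume "X \<in> space ?C"
    then have X: "X \<in> space (PiM {0..<Suc n} (\<lambda>_. count_space UNIV))" by (simp only: spC)
    show "(\<integral>\<^sup>+X'. f (X' (Suc n)) \<partial>biased_walk.eP \<beta> \<omega> (Suc n) X) = (\<integral>\<^sup>+y. f y \<partial>measure_pmf (step \<beta> \<omega> (X n)))"
      by (subst biased_walk.nn_integral_eP[OF X m]) (simp add: walk_kernel_def)
  qed
  also have "\<dots> = (\<integral>\<^sup>+x. (\<integral>\<^sup>+y. f y \<partial>measure_pmf (step \<beta> \<omega> x)) \<partial>measure_pmf (walk_marginal \<beta> \<omega> n))"
    by (rule Suc.IH)
  also have "\<dots> = (\<integral>\<^sup>+y. f y \<partial>measure_pmf (walk_marginal \<beta> \<omega> (Suc n)))"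
    by simp
  finally show ?case .
qed

text \<open>
  Two consecutive positions are treated jointly because the interpolation between the squares in the law of large
  numbers needs that the walk moves along edges.
\<close>

lemma emeasure_walk_pair:
  "emeasure (walk \<beta> \<omega>) {X. R (X n) (X (Suc n))} =
    (\<integral>\<^sup>+x. emeasure (measure_pmf (step \<beta> \<omega> x)) {y. R x y} \<partial>measure_pmf (walk_marginal \<beta> \<omega> n))"
proof -
  let ?U = "\<lambda>_ :: nat. count_space (UNIV :: vertex set)"
  let ?J = "{0..<Suc (Suc n)}"
  have u: "(\<lambda>_. undefined) \<in> space (PiM {0..<0::nat} ?U)" by simp
  have Rm: "(\<lambda>X. R (X n) (X (Suc n))) \<in> PiM ?J ?U \<rightarrow>\<^sub>M count_space UNIV"
  proof (rule measurable_compose_countable[where f = "\<lambda>x X. R x (X (Suc n))" and g = "\<lambda>X. X n"])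
    show "(\<lambda>X. R x (X (Suc n))) \<in> PiM ?J ?U \<rightarrow>\<^sub>M count_space UNIV" for x
      by (rule measurable_compose[of "\<lambda>X. X (Suc n)", OF measurable_component_singleton]) auto
    show "(\<lambda>X. X n) \<in> PiM ?J ?U \<rightarrow>\<^sub>M count_space UNIV"
      by (rule measurable_component_singleton) auto
  qed
  let ?Y = "{X \<in> space (PiM ?J ?U). R (X n) (X (Suc n))}"
  have Y: "?Y \<in> sets (PiM ?J ?U)" using Rm by (simp add: pred_def)
  have emb: "prod_emb UNIV ?U ?J ?Y = {X. R (X n) (X (Suc n))}"
    by (auto simp: prod_emb_def space_PiM)
  have emb2: "prod_emb ?J ?U ?J ?Y = ?Y"
    by (auto simp: prod_emb_def space_PiM)
  let ?C = "\<lambda>m. biased_walk.C \<beta> \<omega> 0 m (\<lambda>_. undefined)"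
  have spC: "space (?C (Suc n)) = space (PiM {0..<Suc n} ?U)"
    using biased_walk.space_C[OF u, of \<beta> \<omega> "Suc n"] by simp
  have setsC: "sets (?C m) = sets (PiM {0..<m} ?U)" for m
    using biased_walk.sets_C[OF u, of \<beta> \<omega> m] by simp
  have eP: "biased_walk.eP \<beta> \<omega> (Suc n) \<in> ?C (Suc n) \<rightarrow>\<^sub>M subprob_algebra (PiM ?J ?U)"
    using biased_walk.measurable_eP[of \<beta> \<omega> "Suc n"] setsC[of "Suc n"] by (simp cong: measurable_cong_sets)
  have I: "indicator ?Y \<in> borel_measurable (PiM ?J ?U)" using Y by simp
  have "emeasure (walk \<beta> \<omega>) {X. R (X n) (X (Suc n))} = emeasure (?C (Suc (Suc n))) ?Y"
    unfolding walk_def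
    using biased_walk.lim[of ?J ?Y \<beta> \<omega>] biased_walk.emeasure_CI[of ?J "Suc (Suc n)" ?Y \<beta> \<omega>] Y
    by (simp only: emb emb2 finite_atLeastLessThan subset_refl)
  also have "\<dots> = (\<integral>\<^sup>+X. indicator ?Y X \<partial>?C (Suc (Suc n)))"
    using Y by (simp add: setsC del: biased_walk.C.simps)
  also have "\<dots> = (\<integral>\<^sup>+X. indicator ?Y X \<partial>(?C (Suc n) \<bind> biased_walk.eP \<beta> \<omega> (Suc n)))"
    by (subst biased_walk.C.simps(2)) simp
  also have "\<dots> = (\<integral>\<^sup>+X. \<integral>\<^sup>+X'. indicator ?Y X' \<partial>biased_walk.eP \<beta> \<omega> (Suc n) X \<partial>?C (Suc n))"
    by (rule nn_integral_bind[OF I eP])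
  also have "\<dots> = (\<integral>\<^sup>+X. emeasure (measure_pmf (step \<beta> \<omega> (X n))) {y. R (X n) y} \<partial>?C (Suc n))"
  proof (rule nn_integral_cong)
    fix X assume "X \<in> space (?C (Suc n))"
    then have X: "X \<in> space (PiM {0..<Suc n} ?U)" by (simp only: spC)
    have "X(Suc n := y) \<in> space (PiM ?J ?U)" for y
      using X by (auto simp: space_PiM PiE_iff extensional_def)
    then have ind: "indicator ?Y (X(Suc n := y)) = (indicator {y. R (X n) y} y :: ennreal)" for y
      by (simp add: indicator_def)
    show "(\<integral>\<^sup>+X'. indicator ?Y X' \<partial>biased_walk.eP \<beta> \<omega> (Suc n) X) = emeasure (measure_pmf (step \<beta> \<omega> (X n))) {y. R (X n) y}"
      by (subst biased_walk.nn_integral_eP[OF X I]) (simp add: walk_kernel_def ind)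
  qed
  also have "\<dots> = (\<integral>\<^sup>+x. emeasure (measure_pmf (step \<beta> \<omega> x)) {y. R x y} \<partial>measure_pmf (walk_marginal \<beta> \<omega> n))"
    by (rule nn_integral_walk_C)
  finally show ?thesis .
qed

lemma emeasure_walk_marginal:
  "emeasure (walk \<beta> \<omega>) {X. X n \<in> A} = emeasure (measure_pmf (walk_marginal \<beta> \<omega> n)) A"
proof -
  have "emeasure (measure_pmf (step \<beta> \<omega> x)) {y. x \<in> A} = indicator A x" for x
    by (auto simp: indicator_def measure_pmf.emeasure_space_1[simplified])
  then show ?thesis
    using emeasure_walk_pair[of \<beta> \<omega> "\<lambda>x y. x \<in> A" n] by simp
qed

lemma measurable_quenched_hist:
  "(\<lambda>\<omega>. map (quenched_pos \<omega> V) [0..<Suc n]) \<in> GW P \<rightarrow>\<^sub>M count_space UNIV"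
  proof -
    have q: "(\<lambda>\<omega>. quenched_pos \<omega> V i) \<in> GW P \<rightarrow>\<^sub>M count_space UNIV" for i
    proof (rule measurable_quenched_pos[where \<Omega> = "\<lambda>\<omega>. \<omega>" and V = "\<lambda>_. V" and \<beta> = 1])
      show "(\<lambda>\<omega>. \<omega> x) \<in> GW P \<rightarrow>\<^sub>M count_space UNIV" for x
        unfolding GW_def by (rule measurable_pmf_component)
    qed simp
    show ?thesis
    proof (induction n)
      case (Suc n)
      have "(\<lambda>\<omega>. map (quenched_pos \<omega> V) [0..<Suc n] @ [quenched_pos \<omega> V (Suc n)]) \<in> GW P \<rightarrow>\<^sub>M count_space UNIV"
      proof (rule measurable_compose_countable[where f = "\<lambda>l \<omega>. l @ [quenched_pos \<omega> V (Suc n)]" and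
            g = "\<lambda>\<omega>. map (quenched_pos \<omega> V) [0..<Suc n]", OF _ Suc])
        show "(\<lambda>\<omega>. l @ [quenched_pos \<omega> V (Suc n)]) \<in> GW P \<rightarrow>\<^sub>M count_space UNIV" for l
          by (rule measurable_compose[OF q]) simp
      qed
      then show ?case by simp
    qed simp
  qed

lemma measurable_explored_hist:
  "(\<lambda>z. map (pos z V) [0..<Suc n]) \<in> PiM UNIV (\<lambda>_. measure_pmf P) \<rightarrow>\<^sub>M count_space UNIV"
  proof -
    have "map (pos z V) [0..<Suc n] = hist z V n" for z
      by (rule nth_equalityI) (auto simp: hist_nth simp del: upt_Suc)
    moreover have "(\<lambda>z. hist z V n) \<in> PiM UNIV (\<lambda>_. measure_pmf P) \<rightarrow>\<^sub>M count_space UNIV"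
    proof (rule measurable_hist[where Z = "\<lambda>z. z" and V = "\<lambda>_. V" and \<beta> = 1])
      show "(\<lambda>z. z i) \<in> PiM UNIV (\<lambda>_. measure_pmf P) \<rightarrow>\<^sub>M count_space UNIV" for i :: nat
        by (rule measurable_pmf_component)
    qed simp
    ultimately show ?thesis by simp
  qed

text \<open>
  For fixed marks both sides give a path the probability that the offspring number of each of its vertices
  belongs to a set determined by the path. The vertices are distinct coordinates on the left; on the right
  the times of the first visits are. Both probabilities are therefore the same product.
\<close>

lemma distr_exploration:
  fixes P :: "nat pmf"
  shows "distr (GW P) (count_space UNIV) (\<lambda>\<omega>. map (quenched_pos \<omega> V) [0..<Suc n]) =
    distr (PiM UNIV (\<lambda>_. measure_pmf P)) (count_space UNIV) (\<lambda>z. map (pos z V) [0..<Suc n])"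
    (is "?D1 = ?D2")
proof (rule measure_eqI_countable[where A = UNIV])
  interpret G: product_prob_space "\<lambda>_ :: vertex. measure_pmf P" UNIV
    by (intro product_prob_spaceI measure_pmf.prob_space_axioms)
  interpret Z: product_prob_space "\<lambda>_ :: nat. measure_pmf P" UNIV
    by (intro product_prob_spaceI measure_pmf.prob_space_axioms)
  fix xs :: "vertex list"
  note qm = measurable_quenched_hist[of V n P] and pm = measurable_explored_hist[of V n P]
  show "emeasure ?D1 {xs} = emeasure ?D2 {xs}"
  proof (cases "length xs = Suc n \<and> xs ! 0 = []")
    case False
    have ne: "map f [0..<Suc n] \<noteq> xs" if "f 0 = []" for f :: "nat \<Rightarrow> vertex"
      using False that by (auto simp del: upt_Suc)
    have "(\<lambda>\<omega>. map (quenched_pos \<omega> V) [0..<Suc n]) -` {xs} \<inter> space (GW P) = {}"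
      "(\<lambda>z. map (pos z V) [0..<Suc n]) -` {xs} \<inter> space (PiM UNIV (\<lambda>_. measure_pmf P)) = {}"
      using ne[of "quenched_pos _ V"] ne[of "pos _ V"] by (auto simp del: upt_Suc map_eq_conv)
    then show ?thesis
      by (simp add: emeasure_distr[OF qm] emeasure_distr[OF pm] del: upt_Suc)
  next
    case True
    define B where "B x = {k. \<forall>i<n. xs ! i = x \<longrightarrow> move (V i) k x = xs ! Suc i}" for x
    define first where "first i = (LEAST j. xs ! j = xs ! i)" for i
    define J where "J = first ` {..<n}"
    define K where "K = (!) xs ` {..<n}"
    have first: "first i \<le> i" "xs ! first i = xs ! i" for i
      unfolding first_def by (rule Least_le, simp) (rule LeastI, simp)
    have first_less: "j < first i \<Longrightarrow> xs ! j \<noteq> xs ! i" for i j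
      unfolding first_def by (rule not_less_Least)
    have q: "map (quenched_pos \<omega> V) [0..<Suc n] = xs \<longleftrightarrow> (\<forall>x\<in>K. \<omega> x \<in> B x)" for \<omega>
    proof
      assume eq: "map (quenched_pos \<omega> V) [0..<Suc n] = xs"
      have "quenched_pos \<omega> V i = xs ! i" if "i \<le> n" for i
        unfolding eq[symmetric] using that by (simp del: upt_Suc)
      from this[of "Suc _"] this show "\<forall>x\<in>K. \<omega> x \<in> B x"
        by (auto simp: K_def B_def) (metis Suc_leI less_imp_le_nat)
    next
      assume *: "\<forall>x\<in>K. \<omega> x \<in> B x"
      have "quenched_pos \<omega> V i = xs ! i" if "i \<le> n" for i
        using that
      proof (induction i)
        case (Suc i)
        then have "\<omega> (xs ! i) \<in> B (xs ! i)" using * by (auto simp: K_def)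
        with Suc show ?case by (auto simp: B_def)
      qed (use True in simp)
      then show "map (quenched_pos \<omega> V) [0..<Suc n] = xs"
        using True by (intro nth_equalityI) (auto simp del: upt_Suc)
    qed
    have first_visit_first: "first_visit z V i = first i" if "\<And>j. j \<le> i \<Longrightarrow> pos z V j = xs ! j" for z i
    proof (rule first_visit_eqI)
      show "pos z V (first i) = pos z V i" using that[of "first i"] that[of i] first[of i] by simp
      show "pos z V j \<noteq> pos z V i" if "j < first i" for j
        using \<open>\<And>j. j \<le> i \<Longrightarrow> pos z V j = xs ! j\<close>[of j] \<open>\<And>j. j \<le> i \<Longrightarrow> pos z V j = xs ! j\<close>[of i]
          first_less[OF that] first(1)[of i] that by simp
    qed
    have p: "map (pos z V) [0..<Suc n] = xs \<longleftrightarrow> (\<forall>j\<in>J. z j \<in> B (xs ! j))" for z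
    proof
      assume eq: "map (pos z V) [0..<Suc n] = xs"
      have xi: "pos z V i = xs ! i" if "i \<le> n" for i
        unfolding eq[symmetric] using that by (simp del: upt_Suc)
      show "\<forall>j\<in>J. z j \<in> B (xs ! j)"
      proof (clarsimp simp: J_def B_def)
        fix i' i assume i: "i' < n" "i < n" "xs ! i = xs ! first i'"
        then have "xs ! i = xs ! i'" using first(2)[of i'] by simp
        then have "first i = first i'" by (simp add: first_def)
        moreover have "first_visit z V i = first i" using i xi by (intro first_visit_first) auto
        ultimately show "move (V i) (z (first i')) (xs ! first i') = xs ! Suc i"
          using xi[of i] xi[of "Suc i"] i by (simp add: pos_Suc)
      qed
    next
      assume *: "\<forall>j\<in>J. z j \<in> B (xs ! j)"
      have "pos z V i = xs ! i" if "i \<le> n" for i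
        using that
      proof (induction i rule: less_induct)
        case (less i)
        show ?case
        proof (cases i)
          case (Suc k)
          have "first_visit z V k = first k" using less Suc by (intro first_visit_first) auto
          moreover have "z (first k) \<in> B (xs ! first k)" using * less Suc by (auto simp: J_def)
          then have "move (V k) (z (first k)) (xs ! k) = xs ! Suc k"
            using less.prems Suc first(2)[of k] by (auto simp: B_def)
          ultimately show ?thesis using less.IH[of k] less.prems Suc by (simp add: pos_Suc)
        qed (use True in simp)
      qed
      then show "map (pos z V) [0..<Suc n] = xs"
        using True by (intro nth_equalityI) (auto simp del: upt_Suc)
    qed
    have "emeasure ?D1 {xs} = emeasure (PiM UNIV (\<lambda>_. measure_pmf P))
        {\<omega> \<in> space (PiM UNIV (\<lambda>_. measure_pmf P)). \<forall>x\<in>K. \<omega> x \<in> B x}"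
      unfolding q[symmetric]
      by (subst emeasure_distr[OF qm]) (auto simp: GW_def simp del: upt_Suc intro!: arg_cong[where f = "emeasure _"])
    also have "\<dots> = (\<Prod>x\<in>K. emeasure (measure_pmf P) (B x))"
      by (rule G.emeasure_PiM_Collect) (auto simp: K_def)
    also have "\<dots> = (\<Prod>j\<in>J. emeasure (measure_pmf P) (B (xs ! j)))"
    proof (rule prod.reindex_bij_betw[symmetric])
      have "inj_on ((!) xs) J"
      proof (rule inj_onI)
        fix a b assume "a \<in> J" "b \<in> J" "xs ! a = xs ! b"
        then obtain i j where ij: "a = first i" "b = first j" by (auto simp: J_def)
        with \<open>xs ! a = xs ! b\<close> first(2) have "xs ! i = xs ! j" by simp
        then show "a = b" by (simp add: ij first_def)
      qed
      moreover have "(!) xs ` J = K"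
        unfolding J_def K_def image_image by (rule image_cong) (auto simp: first)
      ultimately show "bij_betw ((!) xs) J K" by (simp add: bij_betw_def)
    qed
    also have "\<dots> = emeasure (PiM UNIV (\<lambda>_. measure_pmf P))
        {z \<in> space (PiM UNIV (\<lambda>_. measure_pmf P)). \<forall>j\<in>J. z j \<in> B (xs ! j)}"
      by (rule Z.emeasure_PiM_Collect[symmetric]) (auto simp: J_def)
    also have "\<dots> = emeasure ?D2 {xs}"
      unfolding p[symmetric]
      by (subst emeasure_distr[OF pm]) (auto simp del: upt_Suc intro!: arg_cong[where f = "emeasure _"])
    finally show ?thesis .
  qed
qed auto


lemma emeasure_GW_quenched_pos:
  "emeasure (GW P) {\<omega> \<in> space (GW P). quenched_pos \<omega> V n \<in> A} =
   emeasure (PiM UNIV (\<lambda>_. measure_pmf P)) {z \<in> space (PiM UNIV (\<lambda>_. measure_pmf P)). pos z V n \<in> A}"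
proof -
  let ?L = "{xs. last xs \<in> A}"
  have qm: "(\<lambda>\<omega>. map (quenched_pos \<omega> V) [0..<Suc n]) \<in> GW P \<rightarrow>\<^sub>M count_space UNIV"
    by (rule measurable_quenched_hist)
  have pm: "(\<lambda>z. map (pos z V) [0..<Suc n]) \<in> PiM UNIV (\<lambda>_. measure_pmf P) \<rightarrow>\<^sub>M count_space UNIV"
    by (rule measurable_explored_hist)
  have "emeasure (GW P) {\<omega> \<in> space (GW P). quenched_pos \<omega> V n \<in> A} =
      emeasure (distr (GW P) (count_space UNIV) (\<lambda>\<omega>. map (quenched_pos \<omega> V) [0..<Suc n])) ?L"
    by (subst emeasure_distr[OF qm]) (auto intro!: arg_cong[where f = "emeasure _"])
  also have "\<dots> = emeasure (distr (PiM UNIV (\<lambda>_. measure_pmf P)) (count_space UNIV) (\<lambda>z. map (pos z V) [0..<Suc n])) ?L"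
    by (simp only: distr_exploration)
  also have "\<dots> = emeasure (PiM UNIV (\<lambda>_. measure_pmf P)) {z \<in> space (PiM UNIV (\<lambda>_. measure_pmf P)). pos z V n \<in> A}"
    by (subst emeasure_distr[OF pm]) (auto intro!: arg_cong[where f = "emeasure _"])
  finally show ?thesis .
qed

definition model :: "real \<Rightarrow> nat pmf \<Rightarrow> (nat \<Rightarrow> nat \<times> noise) measure" where
  "model \<beta> P = PiM UNIV (\<lambda>_. measure_pmf P \<Otimes>\<^sub>M noise \<beta>)"

abbreviation model_pos :: "(nat \<Rightarrow> nat \<times> noise) \<Rightarrow> nat \<Rightarrow> vertex" where
  "model_pos \<xi> n \<equiv> pos (\<lambda>i. fst (\<xi> i)) (\<lambda>i. snd (\<xi> i)) n"

lemma prob_space_GW: "prob_space (GW P)"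
  unfolding GW_def by (intro prob_space_PiM measure_pmf.prob_space_axioms)

lemma measurable_GW_component: "(\<lambda>\<omega>. \<omega> x) \<in> GW P \<rightarrow>\<^sub>M count_space UNIV"
  unfolding GW_def by (rule measurable_pmf_component)

lemma measurable_model_fst: "(\<lambda>\<xi>. fst (\<xi> i)) \<in> model \<beta> P \<rightarrow>\<^sub>M count_space UNIV"
proof -
  have "(\<lambda>\<xi>. fst (\<xi> i)) \<in> model \<beta> P \<rightarrow>\<^sub>M measure_pmf P"
    unfolding model_def
    by (rule measurable_compose[of "\<lambda>\<xi>. \<xi> i", OF measurable_component_singleton measurable_fst]) simp
  then show ?thesis by (simp cong: measurable_cong_sets)
qed

lemma measurable_model_snd: "(\<lambda>\<xi>. snd (\<xi> i)) \<in> model \<beta> P \<rightarrow>\<^sub>M noise \<beta>"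
  unfolding model_def
  by (rule measurable_compose[of "\<lambda>\<xi>. \<xi> i", OF measurable_component_singleton measurable_snd]) simp

lemma space_model [simp]: "space (model \<beta> P) = UNIV"
  by (simp add: model_def space_PiM space_pair_measure)

lemma emeasure_model_pair:
  assumes "{\<xi>. R (\<lambda>i. fst (\<xi> i)) (\<lambda>i. snd (\<xi> i))} \<in> sets (model \<beta> P)"
  shows "emeasure (model \<beta> P) {\<xi>. R (\<lambda>i. fst (\<xi> i)) (\<lambda>i. snd (\<xi> i))} =
    emeasure (PiM UNIV (\<lambda>_. measure_pmf P) \<Otimes>\<^sub>M noise_seq \<beta>)
      {p \<in> space (PiM UNIV (\<lambda>_. measure_pmf P) \<Otimes>\<^sub>M noise_seq \<beta>). R (fst p) (snd p)}"
proof -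
  let ?Z = "PiM UNIV (\<lambda>_ :: nat. measure_pmf P)"
  let ?zip = "\<lambda>(f, g) i. (f i, g i)"
  have zip: "?zip \<in> ?Z \<Otimes>\<^sub>M noise_seq \<beta> \<rightarrow>\<^sub>M model \<beta> P"
    unfolding case_prod_beta model_def
    by (rule measurable_PiM_single') (auto simp: space_PiM space_pair_measure)
  have "model \<beta> P = distr (?Z \<Otimes>\<^sub>M noise_seq \<beta>) (model \<beta> P) ?zip"
    unfolding model_def
    by (rule PiM_zip[symmetric]) (simp_all add: measure_pmf.prob_space_axioms prob_space_noise)
  then have "emeasure (model \<beta> P) {\<xi>. R (\<lambda>i. fst (\<xi> i)) (\<lambda>i. snd (\<xi> i))} =
      emeasure (distr (?Z \<Otimes>\<^sub>M noise_seq \<beta>) (model \<beta> P) ?zip) {\<xi>. R (\<lambda>i. fst (\<xi> i)) (\<lambda>i. snd (\<xi> i))}"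
    by (rule arg_cong)
  then show ?thesis
    by (subst (asm) emeasure_distr[OF zip assms]) (auto intro!: arg_cong[where f = "emeasure _"])
qed

lemma AE_GW_pos:
  assumes "0 \<notin> set_pmf P"
  shows "AE \<omega> in GW P. \<forall>x. \<omega> x > 0"
proof -
  have "AE \<omega> in GW P. \<omega> x > 0" for x
  proof -
    have "AE k in measure_pmf P. k > 0"
      using assms by (auto simp: AE_measure_pmf_iff intro!: gr0I)
    then show ?thesis unfolding GW_def
      by (intro AE_PiM_component[where P = "\<lambda>k. k > 0"]) (auto simp: measure_pmf.prob_space_axioms)
  qed
  then show ?thesis by (simp add: AE_all_countable)
qed

text \<open>
  For almost every tree the marks produce the walk on it. Fubini's theorem exchanges the order of integration,
  and for fixed marks the tree may be replaced by the offspring numbers in the order of discovery.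
\<close>

lemma emeasure_averaged_walk:
  assumes \<beta>: "\<beta> > 0" and P: "0 \<notin> set_pmf P"
  shows "emeasure (averaged_walk \<beta> P) {X. X n \<in> A} = emeasure (model \<beta> P) {\<xi>. model_pos \<xi> n \<in> A}"
proof -
  let ?Z = "PiM UNIV (\<lambda>_ :: nat. measure_pmf P)"
  interpret G: prob_space "GW P" by (rule prob_space_GW)
  interpret V: prob_space "noise_seq \<beta>" by (rule prob_space_noise_seq)
  interpret GV: pair_sigma_finite "GW P" "noise_seq \<beta>" ..
  interpret Z: prob_space ?Z by (intro prob_space_PiM measure_pmf.prob_space_axioms)
  interpret ZV: pair_sigma_finite ?Z "noise_seq \<beta>" ..
  have Xn: "(\<lambda>X. X n) \<in> PiM UNIV (\<lambda>_. count_space (UNIV :: vertex set)) \<rightarrow>\<^sub>M count_space UNIV"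
    by (rule measurable_component_singleton) simp
  have A: "{X. X n \<in> A} \<in> sets (PiM UNIV (\<lambda>_. count_space (UNIV :: vertex set)))"
    using measurable_sets[OF Xn, of A] by (simp add: vimage_def space_PiM)
  let ?E = "{p \<in> space (GW P \<Otimes>\<^sub>M noise_seq \<beta>). quenched_pos (fst p) (snd p) n \<in> A}"
  let ?F = "{p \<in> space (?Z \<Otimes>\<^sub>M noise_seq \<beta>). pos (fst p) (snd p) n \<in> A}"
  have E: "?E \<in> sets (GW P \<Otimes>\<^sub>M noise_seq \<beta>)"
  proof -
    have "(\<lambda>p. quenched_pos (fst p) (snd p) n) \<in> GW P \<Otimes>\<^sub>M noise_seq \<beta> \<rightarrow>\<^sub>M count_space UNIV"
    proof (rule measurable_quenched_pos[where \<Omega> = fst and V = snd and \<beta> = \<beta>])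
      show "(\<lambda>p. fst p x) \<in> GW P \<Otimes>\<^sub>M noise_seq \<beta> \<rightarrow>\<^sub>M count_space UNIV" for x
        by (rule measurable_compose[OF measurable_fst measurable_GW_component])
      show "(\<lambda>p. snd p i) \<in> GW P \<Otimes>\<^sub>M noise_seq \<beta> \<rightarrow>\<^sub>M noise \<beta>" for i
        by (rule measurable_compose[OF measurable_snd measurable_component_singleton]) simp
    qed
    from measurable_sets[OF this, of A] show ?thesis by (simp add: vimage_def Int_def conj_commute)
  qed
  have F: "?F \<in> sets (?Z \<Otimes>\<^sub>M noise_seq \<beta>)"
  proof -
    have "(\<lambda>p. pos (fst p) (snd p) n) \<in> ?Z \<Otimes>\<^sub>M noise_seq \<beta> \<rightarrow>\<^sub>M count_space UNIV"
    proof (rule measurable_pos[where Z = fst and V = snd and \<beta> = \<beta>])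
      show "(\<lambda>p. fst p x) \<in> ?Z \<Otimes>\<^sub>M noise_seq \<beta> \<rightarrow>\<^sub>M count_space UNIV" for x
        by (rule measurable_compose[OF measurable_fst measurable_pmf_component])
      show "(\<lambda>p. snd p i) \<in> ?Z \<Otimes>\<^sub>M noise_seq \<beta> \<rightarrow>\<^sub>M noise \<beta>" for i
        by (rule measurable_compose[OF measurable_snd measurable_component_singleton]) simp
    qed
    from measurable_sets[OF this, of A] show ?thesis by (simp add: vimage_def Int_def conj_commute)
  qed
  have "emeasure (averaged_walk \<beta> P) {X. X n \<in> A} = (\<integral>\<^sup>+\<omega>. emeasure (walk \<beta> \<omega>) {X. X n \<in> A} \<partial>GW P)"
    unfolding averaged_walk_def using G.not_empty measurable_walk A by (rule emeasure_bind)
  also have "\<dots> = (\<integral>\<^sup>+\<omega>. emeasure (noise_seq \<beta>) (Pair \<omega> -` ?E) \<partial>GW P)"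
  proof (rule nn_integral_cong_AE)
    show "AE \<omega> in GW P. emeasure (walk \<beta> \<omega>) {X. X n \<in> A} = emeasure (noise_seq \<beta>) (Pair \<omega> -` ?E)"
      using AE_GW_pos[OF P] AE_space
    proof eventually_elim
      case (elim \<omega>)
      have qm: "(\<lambda>V. quenched_pos \<omega> V n) \<in> noise_seq \<beta> \<rightarrow>\<^sub>M count_space UNIV"
        by (rule measurable_quenched_pos[where \<Omega> = "\<lambda>_. \<omega>" and V = "\<lambda>V. V" and \<beta> = \<beta>])
           (auto intro: measurable_component_singleton)
      have "emeasure (walk \<beta> \<omega>) {X. X n \<in> A} =
          emeasure (distr (noise_seq \<beta>) (count_space UNIV) (\<lambda>V. quenched_pos \<omega> V n)) A"
        using elim by (simp only: emeasure_walk_marginal distr_quenched_pos[OF \<beta>, of \<omega>])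
      also have "\<dots> = emeasure (noise_seq \<beta>) (Pair \<omega> -` ?E)"
        using elim by (subst emeasure_distr[OF qm]) (auto simp: space_pair_measure intro!: arg_cong[where f = "emeasure _"])
      finally show ?case .
    qed
  qed
  also have "\<dots> = emeasure (GW P \<Otimes>\<^sub>M noise_seq \<beta>) ?E"
    using E by (rule V.emeasure_pair_measure_alt[symmetric])
  also have "\<dots> = (\<integral>\<^sup>+V. emeasure (GW P) ((\<lambda>\<omega>. (\<omega>, V)) -` ?E) \<partial>noise_seq \<beta>)"
    using E by (rule GV.emeasure_pair_measure_alt2)
  also have "\<dots> = (\<integral>\<^sup>+V. emeasure ?Z ((\<lambda>z. (z, V)) -` ?F) \<partial>noise_seq \<beta>)"
  proof (rule nn_integral_cong)
    fix V assume V: "V \<in> space (noise_seq \<beta>)"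
    have "(\<lambda>\<omega>. (\<omega>, V)) -` ?E = {\<omega> \<in> space (GW P). quenched_pos \<omega> V n \<in> A}"
      "(\<lambda>z. (z, V)) -` ?F = {z \<in> space ?Z. pos z V n \<in> A}"
      using V by (auto simp: space_pair_measure)
    then show "emeasure (GW P) ((\<lambda>\<omega>. (\<omega>, V)) -` ?E) = emeasure ?Z ((\<lambda>z. (z, V)) -` ?F)"
      by (simp only: emeasure_GW_quenched_pos)
  qed
  also have "\<dots> = emeasure (?Z \<Otimes>\<^sub>M noise_seq \<beta>) ?F"
    using F by (rule ZV.emeasure_pair_measure_alt2[symmetric])
  also have "\<dots> = emeasure (model \<beta> P) {\<xi>. model_pos \<xi> n \<in> A}"
  proof -
    have "{\<xi>. model_pos \<xi> n \<in> A} \<in> sets (model \<beta> P)"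
      using measurable_sets[OF measurable_pos[OF measurable_model_fst measurable_model_snd], of A]
      by (simp add: vimage_def)
    then show ?thesis by (rule emeasure_model_pair[symmetric, where R = "\<lambda>z V. pos z V n \<in> A"])
  qed
  finally show ?thesis .
qed

lemma AE_adjacent:
  assumes \<beta>: "\<beta> > 0" and P: "0 \<notin> set_pmf P"
  shows "AE X in averaged_walk \<beta> P. length (X (Suc n)) \<le> Suc (length (X n)) \<and> length (X n) \<le> Suc (length (X (Suc n)))"
proof -
  let ?R = "\<lambda>x y :: vertex. \<not> (length y \<le> Suc (length x) \<and> length x \<le> Suc (length y))"
  let ?U = "PiM (UNIV :: nat set) (\<lambda>_. count_space (UNIV :: vertex set))"
  interpret G: prob_space "GW P" by (rule prob_space_GW)
  have Rm: "(\<lambda>X. ?R (X n) (X (Suc n))) \<in> ?U \<rightarrow>\<^sub>M count_space UNIV"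
  proof (rule measurable_compose_countable[where f = "\<lambda>x X. ?R x (X (Suc n))" and g = "\<lambda>X. X n"])
    show "(\<lambda>X. ?R x (X (Suc n))) \<in> ?U \<rightarrow>\<^sub>M count_space UNIV" for x
      by (rule measurable_compose[of "\<lambda>X. X (Suc n)", OF measurable_component_singleton]) auto
    show "(\<lambda>X. X n) \<in> ?U \<rightarrow>\<^sub>M count_space UNIV"
      by (rule measurable_component_singleton) auto
  qed
  have R: "{X. ?R (X n) (X (Suc n))} \<in> sets ?U"
    using measurable_sets[OF Rm, of "{True}"] by (simp add: vimage_def space_PiM)
  have "emeasure (averaged_walk \<beta> P) {X. ?R (X n) (X (Suc n))} =
      (\<integral>\<^sup>+\<omega>. emeasure (walk \<beta> \<omega>) {X. ?R (X n) (X (Suc n))} \<partial>GW P)"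
    unfolding averaged_walk_def using G.not_empty measurable_walk R by (rule emeasure_bind)
  also have "\<dots> = (\<integral>\<^sup>+\<omega>. 0 \<partial>GW P)"
  proof (rule nn_integral_cong_AE)
    show "AE \<omega> in GW P. emeasure (walk \<beta> \<omega>) {X. ?R (X n) (X (Suc n))} = 0"
      using AE_GW_pos[OF P]
    proof eventually_elim
      case (elim \<omega>)
      have "emeasure (measure_pmf (step \<beta> \<omega> x)) {y. ?R x y} = 0" for x
      proof -
        have "\<not> ?R x y" if "y \<in> set_pmf (step \<beta> \<omega> x)" for y
        proof (cases "x = []")
          case True
          then show ?thesis using that elim by (auto simp: set_pmf_iff pmf_step_root children_def split: if_splits)
        next
          case False
          then show ?thesis using that \<beta> by (auto simp: set_pmf_iff pmf_step children_def split: if_splits)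
        qed
        then have "set_pmf (step \<beta> \<omega> x) \<inter> {y. ?R x y} = {}" by blast
        then show ?thesis by (simp add: measure_pmf.emeasure_eq_measure measure_pmf_zero_iff)
      qed
      note step0 = this
      have "emeasure (walk \<beta> \<omega>) {X. ?R (X n) (X (Suc n))} =
          (\<integral>\<^sup>+x. emeasure (measure_pmf (step \<beta> \<omega> x)) {y. ?R x y} \<partial>measure_pmf (walk_marginal \<beta> \<omega> n))"
        by (rule emeasure_walk_pair[of \<beta> \<omega> ?R n])
      also have "\<dots> = 0"
        by (simp only: step0 nn_integral_const mult_zero_left)
      finally show ?case .
    qed
  qed
  finally have 0: "emeasure (averaged_walk \<beta> P) {X. ?R (X n) (X (Suc n))} = 0" by simp
  have sets: "sets (averaged_walk \<beta> P) = sets ?U"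
    unfolding averaged_walk_def using G.not_empty
    by (intro sets_bind) (auto simp: sets_walk)
  show ?thesis
    by (rule AE_I[OF _ 0]) (use R sets in auto)
qed

section \<open>The law of large numbers\<close>

lemma distr_pair_snd:
  assumes M: "prob_space M" and N: "prob_space N"
  shows "distr (M \<Otimes>\<^sub>M N) N snd = N"
proof (rule measure_eqI)
  interpret M: prob_space M by fact
  interpret N: prob_space N by fact
  fix A assume A: "A \<in> sets (distr (M \<Otimes>\<^sub>M N) N snd)"
  have "snd -` A \<inter> space (M \<Otimes>\<^sub>M N) = space M \<times> A"
    using A sets.sets_into_space[of A N] by (auto simp: space_pair_measure)
  then show "emeasure (distr (M \<Otimes>\<^sub>M N) N snd) A = emeasure N A"
    using A by (simp add: emeasure_distr N.emeasure_pair_measure_Times M.emeasure_space_1)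
qed simp

lemma distr_model_noise: "distr (model \<beta> P) (noise_seq \<beta>) (\<lambda>\<xi> i. snd (\<xi> i)) = noise_seq \<beta>"
proof -
  interpret A: prob_space "measure_pmf P" by (rule measure_pmf.prob_space_axioms)
  interpret B: prob_space "noise \<beta>" by (rule prob_space_noise)
  interpret AB: pair_prob_space "measure_pmf P" "noise \<beta>" ..
  have "distr (model \<beta> P) (noise_seq \<beta>) (\<lambda>\<xi> i. snd (\<xi> i)) =
      PiM UNIV (\<lambda>_. distr (measure_pmf P \<Otimes>\<^sub>M noise \<beta>) (noise \<beta>) snd)"
    unfolding model_def by (rule PiM_map) (auto intro: AB.prob_space_axioms)
  then show ?thesis
    by (simp add: distr_pair_snd[OF measure_pmf.prob_space_axioms prob_space_noise])
qed

lemma measure_model_noise: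
  assumes "E \<in> sets (noise_seq \<beta>)"
  shows "measure (model \<beta> P) {\<xi>. (\<lambda>i. snd (\<xi> i)) \<in> E} = measure (noise_seq \<beta>) E"
    and "{\<xi>. (\<lambda>i. snd (\<xi> i)) \<in> E} \<in> sets (model \<beta> P)"
proof -
  have m: "(\<lambda>\<xi> i. snd (\<xi> i)) \<in> model \<beta> P \<rightarrow>\<^sub>M noise_seq \<beta>"
    by (rule measurable_PiM_single') (auto intro: measurable_model_snd)
  have "measure (distr (model \<beta> P) (noise_seq \<beta>) (\<lambda>\<xi> i. snd (\<xi> i))) E = measure (model \<beta> P) {\<xi>. (\<lambda>i. snd (\<xi> i)) \<in> E}"
    using assms by (subst measure_distr[OF m]) (auto simp: vimage_def)
  then show "measure (model \<beta> P) {\<xi>. (\<lambda>i. snd (\<xi> i)) \<in> E} = measure (noise_seq \<beta>) E"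
    by (simp add: distr_model_noise)
  show "{\<xi>. (\<lambda>i. snd (\<xi> i)) \<in> E} \<in> sets (model \<beta> P)"
    using measurable_sets[OF m assms] by (simp add: vimage_def)
qed

definition increment :: "(nat \<Rightarrow> nat \<times> noise) \<Rightarrow> nat \<Rightarrow> real" where
  "increment \<xi> n = real (length (model_pos \<xi> (Suc n))) - real (length (model_pos \<xi> n))"

lemma abs_increment: "\<bar>increment \<xi> n\<bar> \<le> 1"
  unfolding increment_def pos_Suc
  using length_move[of "snd (\<xi> n)" _ "model_pos \<xi> n"] by (smt (verit) of_nat_Suc)

lemma sum_increment: "(\<Sum>i<n. increment \<xi> i) = real (length (model_pos \<xi> n))"
  by (induction n) (auto simp: increment_def)

lemma increment_cong: "(\<And>i. i < Suc n \<Longrightarrow> \<xi> i = \<xi>' i) \<Longrightarrow> increment \<xi> n = increment \<xi>' n"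
  unfolding increment_def by (intro arg_cong2[where f = "(-)"] arg_cong[where f = "\<lambda>x. real (length x)"] pos_cong) auto

lemma measurable_model_pos: "(\<lambda>\<xi>. model_pos \<xi> n) \<in> model \<beta> P \<rightarrow>\<^sub>M count_space UNIV"
  by (rule measurable_pos[OF measurable_model_fst measurable_model_snd])

lemma measurable_increment [measurable]: "(\<lambda>\<xi>. increment \<xi> n) \<in> borel_measurable (model \<beta> P)"
proof -
  have [measurable]: "(\<lambda>\<xi>. real (length (model_pos \<xi> n))) \<in> borel_measurable (model \<beta> P)" for n
    by (rule measurable_compose[OF measurable_model_pos]) simp
  show ?thesis unfolding increment_def by measurable
qed

text \<open>
  Seen from a cut time \<open>t \<ge> a\<close>, the walk started at time \<open>0\<close> and the walk started afresh at time \<open>a\<close>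
  are the same.
\<close>

lemma increment_shift:
  assumes "a \<le> t" "t \<le> n" "cut_time (up (\<lambda>i. snd (\<xi> i))) t (Suc n)"
  shows "increment \<xi> n = increment (\<lambda>i. \<xi> (a + i)) (n - a)"
proof -
  have step: "increment \<xi> n = increment (\<lambda>i. \<xi> (t + i)) (n - t)"
    if "t \<le> n" "cut_time (up (\<lambda>i. snd (\<xi> i))) t (Suc n)" for \<xi> :: "nat \<Rightarrow> nat \<times> noise" and t n
  proof -
    have s: "t + Suc (n - t) = Suc n" "t + (n - t) = n" using that by auto
    show ?thesis
      using pos_shift[OF that(2), of "Suc (n - t)" "\<lambda>i. fst (\<xi> i)"]
        pos_shift[OF that(2), of "n - t" "\<lambda>i. fst (\<xi> i)"] that(1)
      unfolding s increment_def by simp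
  qed
  have "increment (\<lambda>i. \<xi> (a + i)) (n - a) = increment (\<lambda>i. \<xi> (a + (t - a + i))) (n - a - (t - a))"
  proof (rule step)
    have "Suc (n - a) = Suc n - a" using assms by simp
    then show "cut_time (up (\<lambda>i. snd (\<xi> (a + i)))) (t - a) (Suc (n - a))"
      using cut_time_shift[OF assms(3,1)] by simp
  qed (use assms in auto)
  also have "\<dots> = increment (\<lambda>i. \<xi> (t + i)) (n - t)"
    using assms(1,2) by (simp flip: add.assoc)
  finally show ?thesis using step[OF assms(2,3)] by simp
qed

lemma sum_power_diff_le:
  fixes g :: real
  assumes "0 \<le> g" "g < 1"
  shows "(\<Sum>i\<le>n. g ^ (n - i)) \<le> 1 / (1 - g)"
proof -
  have "(\<Sum>i\<le>n. g ^ (n - i)) = (\<Sum>i\<le>n. g ^ i)"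
    by (rule sum.reindex_bij_witness[of _ "\<lambda>i. n - i" "\<lambda>i. n - i"]) auto
  also have "\<dots> \<le> (\<Sum>i. g ^ i)"
    using assms by (intro sum_le_suminf summable_geometric) auto
  also have "\<dots> = 1 / (1 - g)" using assms by (simp add: suminf_geometric)
  finally show ?thesis .
qed

lemma sum_power_diff_lessThan_le:
  fixes g :: real
  assumes "0 \<le> g" "g < 1"
  shows "(\<Sum>i<n. g ^ (n - i)) \<le> 1 / (1 - g)"
proof -
  have "(\<Sum>i<n. g ^ (n - i)) \<le> (\<Sum>i\<le>n. g ^ (n - i))"
    using assms by (intro sum_mono2) auto
  with sum_power_diff_le[OF assms, of n] show ?thesis by linarith
qed

lemma sum_power_dist_le:
  fixes g :: real
  assumes "0 \<le> g" "g < 1"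
  shows "(\<Sum>j<n. g ^ (if i \<le> j then j - i else i - j)) \<le> 2 / (1 - g)"
proof -
  have "(\<Sum>j<n. g ^ (if i \<le> j then j - i else i - j)) =
     (\<Sum>j\<in>{..<n} \<inter> {..<i}. g ^ (if i \<le> j then j - i else i - j)) + (\<Sum>j\<in>{..<n} - {..<i}. g ^ (if i \<le> j then j - i else i - j))"
    by (rule sum.Int_Diff) simp
  also have "(\<Sum>j\<in>{..<n} \<inter> {..<i}. g ^ (if i \<le> j then j - i else i - j)) \<le> (\<Sum>j\<le>i. g ^ (i - j))"
    using assms by (intro order_trans[OF eq_refl[OF sum.cong[OF refl]] sum_mono2]) auto
  also have "\<dots> \<le> 1 / (1 - g)" by (rule sum_power_diff_le[OF assms])
  also have "(\<Sum>j\<in>{..<n} - {..<i}. g ^ (if i \<le> j then j - i else i - j)) = (\<Sum>k\<in>{..<n - i}. g ^ k)"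
    by (rule sum.reindex_bij_witness[of _ "\<lambda>k. i + k" "\<lambda>j. j - i"]) auto
  also have "\<dots> \<le> (\<Sum>i. g ^ i)"
    using assms by (intro sum_le_suminf summable_geometric) auto
  also have "\<dots> = 1 / (1 - g)" using assms by (simp add: suminf_geometric)
  finally show ?thesis by simp
qed

text \<open>
  Between consecutive squares near \<open>n\<close> there are only about \<open>2 sqrt n\<close> steps.
\<close>

lemma interpolate_limit:
  fixes L :: "nat \<Rightarrow> real"
  assumes step: "\<And>n. \<bar>L (Suc n) - L n\<bar> \<le> 1" and v: "\<bar>v\<bar> \<le> 1"
    and lim: "(\<lambda>k. L (k\<^sup>2) / real (k\<^sup>2)) \<longlonglongrightarrow> v"
  shows "(\<lambda>n. L n / real n) \<longlonglongrightarrow> v"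
proof -
  (* The square of r n is the largest square up to n. *)
  define r where "r n = nat \<lfloor>sqrt (real n)\<rfloor>" for n
  have r: "(r n)\<^sup>2 \<le> n" "n \<le> (r n)\<^sup>2 + 2 * r n" for n
  proof -
    have f: "real (r n) \<le> sqrt (real n)" "sqrt (real n) < real (r n) + 1"
      unfolding r_def by auto
    have "(real (r n))\<^sup>2 \<le> (sqrt (real n))\<^sup>2" using f by (intro power_mono) auto
    then have "real ((r n)\<^sup>2) \<le> real n" by simp
    then show "(r n)\<^sup>2 \<le> n" by (simp only: of_nat_le_iff)
    have "(sqrt (real n))\<^sup>2 < (real (r n) + 1)\<^sup>2" using f by (intro power_strict_mono) auto
    then have "real n < real ((r n + 1)\<^sup>2)" by (simp add: add.commute)
    then have "n < (r n + 1)\<^sup>2" by (simp only: of_nat_less_iff)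
    then show "n \<le> (r n)\<^sup>2 + 2 * r n" by (simp add: power2_eq_square)
  qed
  have lip: "\<bar>L (a + d) - L a\<bar> \<le> real d" for a d
  proof (induction d)
    case (Suc d)
    then show ?case using step[of "a + d"] by simp
  qed simp
  have r_top: "filterlim r at_top at_top"
    unfolding r_def
    by (intro filterlim_compose[OF filterlim_nat_sequentially filterlim_compose[OF filterlim_floor_sequentially]]
        filterlim_compose[OF sqrt_at_top] filterlim_real_sequentially)
  have bound: "\<bar>L n / real n - v\<bar> \<le> \<bar>L ((r n)\<^sup>2) / real ((r n)\<^sup>2) - v\<bar> + 4 / real (r n)" if "r n > 0" for n
  proof -
    define k where "k = r n"
    define d where "d = n - k\<^sup>2"
    have k: "k > 0" using that by (simp add: k_def)
    have n: "n = k\<^sup>2 + d" "d \<le> 2 * k" using r[of n] by (auto simp: k_def d_def)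
    have k2: "real (k\<^sup>2) > 0" using k by simp
    have np: "real n \<ge> real (k\<^sup>2)" using n by simp
    have "\<bar>L n - real n * v\<bar> \<le> \<bar>L (k\<^sup>2) - real (k\<^sup>2) * v\<bar> + \<bar>L (k\<^sup>2 + d) - L (k\<^sup>2)\<bar> + \<bar>real d * v\<bar>"
      unfolding n(1) by (simp add: algebra_simps)
    also have "\<bar>real d * v\<bar> \<le> real d" using v by (simp add: abs_mult mult_left_le)
    also have "\<bar>L (k\<^sup>2 + d) - L (k\<^sup>2)\<bar> \<le> real d" by (rule lip)
    finally have *: "\<bar>L n - real n * v\<bar> \<le> \<bar>L (k\<^sup>2) - real (k\<^sup>2) * v\<bar> + 4 * real k"
      using n(2) by simp
    have rn: "real n > 0" using np k2 by linarith
    then have "L n / real n - v = (L n - real n * v) / real n"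
      by (simp add: field_simps)
    then have "\<bar>L n / real n - v\<bar> = \<bar>L n - real n * v\<bar> / real n"
      by (simp add: abs_divide)
    also have "\<dots> \<le> (\<bar>L (k\<^sup>2) - real (k\<^sup>2) * v\<bar> + 4 * real k) / real n"
      using * by (intro divide_right_mono) auto
    also have "\<dots> \<le> (\<bar>L (k\<^sup>2) - real (k\<^sup>2) * v\<bar> + 4 * real k) / real (k\<^sup>2)"
      using np k2 rn by (intro divide_left_mono mult_pos_pos) auto
    also have "\<dots> = \<bar>L (k\<^sup>2) - real (k\<^sup>2) * v\<bar> / real (k\<^sup>2) + 4 / real k"
      using k by (simp add: add_divide_distrib power2_eq_square)
    also have "\<bar>L (k\<^sup>2) - real (k\<^sup>2) * v\<bar> / real (k\<^sup>2) = \<bar>L (k\<^sup>2) / real (k\<^sup>2) - v\<bar>"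
    proof -
      have "L (k\<^sup>2) / real (k\<^sup>2) - v = (L (k\<^sup>2) - real (k\<^sup>2) * v) / real (k\<^sup>2)"
        using k by (simp add: field_simps)
      then show ?thesis by (simp add: abs_divide)
    qed
    finally show ?thesis by (simp add: k_def)
  qed
  have "(\<lambda>n. L ((r n)\<^sup>2) / real ((r n)\<^sup>2)) \<longlonglongrightarrow> v"
    by (rule filterlim_compose[OF lim r_top])
  then have "(\<lambda>n. \<bar>L ((r n)\<^sup>2) / real ((r n)\<^sup>2) - v\<bar>) \<longlonglongrightarrow> 0"
    by (intro tendsto_rabs_zero) (simp add: LIM_zero)
  moreover have "(\<lambda>n. 4 / real (r n)) \<longlonglongrightarrow> 0"
    by (intro tendsto_divide_0[OF tendsto_const] filterlim_at_top_imp_at_infinity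
        filterlim_compose[OF filterlim_real_sequentially r_top])
  ultimately have "(\<lambda>n. \<bar>L ((r n)\<^sup>2) / real ((r n)\<^sup>2) - v\<bar> + 4 / real (r n)) \<longlonglongrightarrow> 0"
    by (auto dest: tendsto_add)
  then have "(\<lambda>n. L n / real n - v) \<longlonglongrightarrow> 0"
  proof (rule Lim_null_comparison[rotated])
    have "\<forall>\<^sub>F n in sequentially. r n > 0"
      using filterlim_at_top[THEN iffD1, OF r_top, THEN spec, of 1] by (simp add: Suc_le_eq)
    then show "\<forall>\<^sub>F n in sequentially. norm (L n / real n - v) \<le> \<bar>L ((r n)\<^sup>2) / real ((r n)\<^sup>2) - v\<bar> + 4 / real (r n)"
      by eventually_elim (use bound in auto)
  qed
  then show ?thesis by (simp add: LIM_zero_iff)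
qed

lemma model_back_sets: "{\<xi>. steps_back (\<lambda>i. fst (\<xi> i)) (\<lambda>i. snd (\<xi> i)) n} \<in> sets (model \<beta> P)"
proof -
  have "(\<lambda>\<xi>. steps_back (\<lambda>i. fst (\<xi> i)) (\<lambda>i. snd (\<xi> i)) n) \<in> model \<beta> P \<rightarrow>\<^sub>M count_space UNIV"
    by (rule measurable_back[OF measurable_model_fst measurable_model_snd])
  from measurable_sets[OF this, of "{True}"] show ?thesis by (simp add: vimage_def)
qed

context
  fixes \<beta> :: real and P :: "nat pmf"
  assumes \<beta>: "\<beta> > 23 / 4"
begin

lemma sequence_space_model: "sequence_space (measure_pmf P \<Otimes>\<^sub>M noise \<beta>)"
proof -
  interpret A: prob_space "measure_pmf P" by (rule measure_pmf.prob_space_axioms)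
  interpret B: prob_space "noise \<beta>" by (rule prob_space_noise)
  interpret AB: pair_prob_space "measure_pmf P" "noise \<beta>" ..
  show ?thesis unfolding sequence_space_def by (intro product_prob_spaceI AB.prob_space_axioms)
qed

lemma prob_space_model: "prob_space (model \<beta> P)"
proof -
  interpret T: sequence_space "measure_pmf P \<Otimes>\<^sub>M noise \<beta>" by (rule sequence_space_model)
  show ?thesis unfolding model_def by (rule T.P.prob_space_axioms)
qed

interpretation \<Omega>: prob_space "model \<beta> P" by (rule prob_space_model)

lemma model_total: "measure (model \<beta> P) UNIV = 1"
  using \<Omega>.prob_space by simp

lemmas model_shift = sequence_space.shift_measurable[OF sequence_space_model, folded model_def]
lemmas model_past_future = sequence_space.integral_past_future[OF sequence_space_model, folded model_def]
lemmas model_integral_shift = sequence_space.integral_shift[OF sequence_space_model, folded model_def]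

lemma integrable_increment: "integrable (model \<beta> P) (\<lambda>\<xi>. increment \<xi> n)"
  by (rule \<Omega>.integrable_const_bound[of _ 1]) (auto simp: abs_increment)

text \<open>
  The increment at time \<open>n\<close> depends on the randomness since time \<open>a\<close> alone, unless there is no cut time in
  between.
\<close>

lemma increment_localized:
  assumes "a \<le> n"
  shows "(\<integral>\<xi>. \<bar>increment \<xi> n - increment (\<lambda>i. \<xi> (a + i)) (n - a)\<bar> \<partial>model \<beta> P) \<le> 6 * (26/27) ^ (n - a)"
proof -
  let ?B = "{V. \<forall>t. a < t \<longrightarrow> t \<le> n \<longrightarrow> \<not> cut_time (up V) t (Suc n)}"
  have "(\<lambda>V. \<forall>t. a < t \<longrightarrow> t \<le> n \<longrightarrow> \<not> cut_time (up V) t (Suc n)) \<in> noise_seq \<beta> \<rightarrow>\<^sub>M count_space UNIV"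
  proof (rule measurable_ups_seq[where f = "\<lambda>e. \<forall>t. a < t \<longrightarrow> t \<le> n \<longrightarrow> \<not> cut_time e t (Suc n)" and n = "Suc n"])
    fix e e' :: "nat \<Rightarrow> bool" assume "\<And>i. i < Suc n \<Longrightarrow> e i = e' i"
    then have "cut_time e t (Suc n) = cut_time e' t (Suc n)" for t by (rule cut_time_cong)
    then show "(\<forall>t. a < t \<longrightarrow> t \<le> n \<longrightarrow> \<not> cut_time e t (Suc n)) = (\<forall>t. a < t \<longrightarrow> t \<le> n \<longrightarrow> \<not> cut_time e' t (Suc n))"
      by simp
  qed
  from measurable_sets[OF this, of "{True}"] have B: "?B \<in> sets (noise_seq \<beta>)"
    by (simp add: vimage_def space_PiM)
  let ?C = "{\<xi>. (\<lambda>i. snd (\<xi> i)) \<in> ?B}"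
  have C: "?C \<in> sets (model \<beta> P)" "measure (model \<beta> P) ?C \<le> 3 * (26/27) ^ (n - a)"
    using measure_model_noise[OF B, of P] prob_no_early_cut[OF \<beta> assms] by simp_all
  have m: "(\<lambda>\<xi>. increment (\<lambda>i. \<xi> (a + i)) (n - a)) \<in> borel_measurable (model \<beta> P)"
    by (rule measurable_compose[OF model_shift measurable_increment])
  have "(\<integral>\<xi>. \<bar>increment \<xi> n - increment (\<lambda>i. \<xi> (a + i)) (n - a)\<bar> \<partial>model \<beta> P) \<le> (\<integral>\<xi>. 2 * indicator ?C \<xi> \<partial>model \<beta> P)"
  proof (rule integral_mono)
    show "integrable (model \<beta> P) (\<lambda>\<xi>. \<bar>increment \<xi> n - increment (\<lambda>i. \<xi> (a + i)) (n - a)\<bar>)"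
    proof (rule \<Omega>.integrable_const_bound[of _ 2])
      show "AE \<xi> in model \<beta> P. norm \<bar>increment \<xi> n - increment (\<lambda>i. \<xi> (a + i)) (n - a)\<bar> \<le> 2"
      proof (rule AE_I2)
        fix \<xi> show "norm \<bar>increment \<xi> n - increment (\<lambda>i. \<xi> (a + i)) (n - a)\<bar> \<le> 2"
          using abs_increment[of \<xi> n] abs_increment[of "\<lambda>i. \<xi> (a + i)" "n - a"] by simp
      qed
    qed (use m in measurable)
    show "integrable (model \<beta> P) (\<lambda>\<xi>. 2 * indicator ?C \<xi> :: real)"
      using C by (intro integrable_mult_right) (simp add: \<Omega>.emeasure_eq_measure)
    fix \<xi>
    show "\<bar>increment \<xi> n - increment (\<lambda>i. \<xi> (a + i)) (n - a)\<bar> \<le> 2 * indicator ?C \<xi>"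
    proof (cases "\<xi> \<in> ?C")
      case True
      then show ?thesis
        using abs_increment[of \<xi> n] abs_increment[of "\<lambda>i. \<xi> (a + i)" "n - a"] by simp
    next
      case False
      then obtain t where "a < t" "t \<le> n" "cut_time (up (\<lambda>i. snd (\<xi> i))) t (Suc n)" by auto
      then have "increment \<xi> n = increment (\<lambda>i. \<xi> (a + i)) (n - a)"
        by (intro increment_shift[where t = t]) auto
      then show ?thesis by simp
    qed
  qed
  also have "\<dots> = 2 * measure (model \<beta> P) ?C"
    using C by simp
  also have "\<dots> \<le> 6 * (26/27) ^ (n - a)" using C by simp
  finally show ?thesis .
qed

definition mean_increment :: "nat \<Rightarrow> real" where
  "mean_increment n = (\<integral>\<xi>. increment \<xi> n \<partial>model \<beta> P)"

lemma integrable_increment_shift: "integrable (model \<beta> P) (\<lambda>\<xi>. increment (\<lambda>i. \<xi> (a + i)) n)"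
  by (rule \<Omega>.integrable_const_bound[of _ 1])
     (auto simp: abs_increment intro: measurable_compose[OF model_shift measurable_increment])

lemma mean_increment_shift: "(\<integral>\<xi>. increment (\<lambda>i. \<xi> (a + i)) n \<partial>model \<beta> P) = mean_increment n"
  unfolding mean_increment_def by (rule model_integral_shift[where C = 1]) (auto simp: abs_increment)

text \<open>
  The restarted walk has the same law as the original one, so the means form a Cauchy sequence.
\<close>

lemma mean_increment_diff: 
  assumes "k \<le> n"
  shows "\<bar>mean_increment n - mean_increment k\<bar> \<le> 6 * (26/27) ^ k"
proof -
  have "mean_increment n - mean_increment k = (\<integral>\<xi>. increment \<xi> n - increment (\<lambda>i. \<xi> (n - k + i)) k \<partial>model \<beta> P)"
    by (subst Bochner_Integration.integral_diff[OF integrable_increment integrable_increment_shift]) (simp add: mean_increment_shift mean_increment_def)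
  also have "\<bar>\<dots>\<bar> \<le> (\<integral>\<xi>. \<bar>increment \<xi> n - increment (\<lambda>i. \<xi> (n - k + i)) k\<bar> \<partial>model \<beta> P)"
    by (rule integral_abs_bound)
  also have "\<dots> \<le> 6 * (26/27) ^ k"
    using increment_localized[of "n - k" n] assms by simp
  finally show ?thesis .
qed

definition limit_speed :: real where "limit_speed = lim mean_increment"

lemma mean_increment_tendsto: "mean_increment \<longlonglongrightarrow> limit_speed"
proof -
  have "Cauchy mean_increment"
  proof (rule metric_CauchyI)
    fix e :: real assume "e > 0"
    have "(\<lambda>k. 6 * (26/27 :: real) ^ k) \<longlonglongrightarrow> 6 * 0"
      by (intro tendsto_intros LIMSEQ_realpow_zero) auto
    then have "\<forall>\<^sub>F k in sequentially. 6 * (26/27 :: real) ^ k < e / 2"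
      by (rule order_tendstoD(2)) (use \<open>e > 0\<close> in simp)
    then obtain K where K: "6 * (26/27 :: real) ^ K < e / 2"
      by (auto simp: eventually_sequentially)
    show "\<exists>M. \<forall>m\<ge>M. \<forall>n\<ge>M. dist (mean_increment m) (mean_increment n) < e"
    proof (intro exI allI impI)
      fix m n assume "m \<ge> K" "n \<ge> K"
      with mean_increment_diff[of K m] mean_increment_diff[of K n] K show "dist (mean_increment m) (mean_increment n) < e"
        by (simp add: dist_real_def)
    qed
  qed
  then show ?thesis unfolding limit_speed_def by (simp add: Cauchy_convergent_iff convergent_LIMSEQ_iff)
qed

lemma mean_increment_lim_diff: "\<bar>mean_increment k - limit_speed\<bar> \<le> 6 * (26/27) ^ k"
proof (rule LIMSEQ_le_const2)
  show "(\<lambda>n. \<bar>mean_increment k - mean_increment n\<bar>) \<longlonglongrightarrow> \<bar>mean_increment k - limit_speed\<bar>"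
    by (intro tendsto_intros mean_increment_tendsto)
  show "\<exists>N. \<forall>n\<ge>N. \<bar>mean_increment k - mean_increment n\<bar> \<le> 6 * (26/27) ^ k"
    using mean_increment_diff[of k] by (auto simp: abs_minus_commute)
qed

lemma abs_mean_increment: "\<bar>mean_increment n\<bar> \<le> 1"
proof -
  have "\<bar>mean_increment n\<bar> \<le> (\<integral>\<xi>. \<bar>increment \<xi> n\<bar> \<partial>model \<beta> P)"
    unfolding mean_increment_def by (rule integral_abs_bound)
  also have "\<dots> \<le> (\<integral>\<xi>. 1 \<partial>model \<beta> P)"
    using integrable_increment by (intro integral_mono) (auto simp: abs_increment)
  finally show ?thesis by (simp add: model_total)
qed

lemma abs_limit_speed: "\<bar>limit_speed\<bar> \<le> 1"
  using tendsto_rabs[OF mean_increment_tendsto] by (rule LIMSEQ_le_const2) (use abs_mean_increment in auto)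

lemma integrable_increment_mult: "integrable (model \<beta> P) (\<lambda>\<xi>. (increment \<xi> i - c) * (increment \<xi> j - d))"
proof (rule \<Omega>.integrable_const_bound[of _ "(1 + \<bar>c\<bar>) * (1 + \<bar>d\<bar>)"])
  show "AE \<xi> in model \<beta> P. norm ((increment \<xi> i - c) * (increment \<xi> j - d)) \<le> (1 + \<bar>c\<bar>) * (1 + \<bar>d\<bar>)"
  proof (rule AE_I2)
    fix \<xi>
    have "\<bar>increment \<xi> i - c\<bar> \<le> 1 + \<bar>c\<bar>" "\<bar>increment \<xi> j - d\<bar> \<le> 1 + \<bar>d\<bar>"
      using abs_increment[of \<xi> i] abs_increment[of \<xi> j] by auto
    then show "norm ((increment \<xi> i - c) * (increment \<xi> j - d)) \<le> (1 + \<bar>c\<bar>) * (1 + \<bar>d\<bar>)"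
      by (simp add: abs_mult mult_mono)
  qed
qed measurable

text \<open>
  The increment at time \<open>j\<close> is replaced by that of the walk restarted at time \<open>Suc i\<close>, which is independent of
  the increment at time \<open>i\<close>.
\<close>

lemma cov_bound_less:
  assumes "i < j"
  shows "\<bar>\<integral>\<xi>. (increment \<xi> i - limit_speed) * (increment \<xi> j - limit_speed) \<partial>model \<beta> P\<bar> \<le> 50 * (26/27) ^ (j - i)"
proof -
  (* The increment at time i uses the randomness of the steps up to i, hence the restart at Suc i. *)
  define a where "a = Suc i"
  define v where "v = limit_speed"
  have a: "a \<le> j" "j - a = j - i - 1" using assms by (auto simp: a_def)
  let ?D = "\<lambda>\<xi>. increment (\<lambda>k. \<xi> (a + k)) (j - a)"
  have Dm: "?D \<in> borel_measurable (model \<beta> P)"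
    by (rule measurable_compose[OF model_shift measurable_increment])
  let ?g = "(26/27 :: real) ^ (j - a)"
  have F: "\<bar>increment \<xi> i - v\<bar> \<le> 2" for \<xi>
    using abs_increment[of \<xi> i] abs_limit_speed unfolding v_def by linarith
  have indep: "(\<integral>\<xi>. (increment \<xi> i - v) * ?D \<xi> \<partial>model \<beta> P) = (mean_increment i - v) * mean_increment (j - a)"
  proof -
    have "(\<integral>\<xi>. (increment \<xi> i - v) * ?D \<xi> \<partial>model \<beta> P) =
        (\<integral>\<xi>. increment \<xi> i - v \<partial>model \<beta> P) * (\<integral>\<xi>. increment \<xi> (j - a) \<partial>model \<beta> P)"
    proof (rule model_past_future[where F = "\<lambda>\<xi>. increment \<xi> i - v" and G = "\<lambda>\<xi>. increment \<xi> (j - a)" and B = 2 and C = 1])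
      show "increment \<omega> i - v = increment \<omega>' i - v" if "\<And>k. k < a \<Longrightarrow> \<omega> k = \<omega>' k" for \<omega> \<omega>'
        using increment_cong[of i \<omega> \<omega>'] that by (simp add: a_def)
    qed (use F abs_increment in auto)
    then show ?thesis using integrable_increment by (simp add: mean_increment_def model_total)
  qed
  have int1: "integrable (model \<beta> P) (\<lambda>\<xi>. (increment \<xi> i - v) * ?D \<xi>)"
  proof (rule \<Omega>.integrable_const_bound[of _ "2 * 1"])
    show "AE \<xi> in model \<beta> P. norm ((increment \<xi> i - v) * ?D \<xi>) \<le> 2 * 1"
    proof (rule AE_I2)
      fix \<xi>
      show "norm ((increment \<xi> i - v) * ?D \<xi>) \<le> 2 * 1"
        unfolding real_norm_def abs_mult using F[of \<xi>] abs_increment by (intro mult_mono) auto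
    qed
  qed (use Dm in measurable)
  have int2: "integrable (model \<beta> P) (\<lambda>\<xi>. (increment \<xi> i - v) * (increment \<xi> j - ?D \<xi>))"
    using Bochner_Integration.integrable_diff[OF integrable_increment_mult[of i v j 0] int1]
    by (simp add: right_diff_distrib)
  have int3: "integrable (model \<beta> P) (\<lambda>\<xi>. (increment \<xi> i - v) * (- v))"
    using integrable_increment by simp
  have "(\<integral>\<xi>. (increment \<xi> i - v) * (increment \<xi> j - v) \<partial>model \<beta> P) =
      (\<integral>\<xi>. ((increment \<xi> i - v) * ?D \<xi> + (increment \<xi> i - v) * (increment \<xi> j - ?D \<xi>)) + (increment \<xi> i - v) * (- v) \<partial>model \<beta> P)"
    by (intro Bochner_Integration.integral_cong refl) (simp add: algebra_simps)
  also have "\<dots> = ((\<integral>\<xi>. (increment \<xi> i - v) * ?D \<xi> \<partial>model \<beta> P) + (\<integral>\<xi>. (increment \<xi> i - v) * (increment \<xi> j - ?D \<xi>) \<partial>model \<beta> P))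
      + (\<integral>\<xi>. (increment \<xi> i - v) * (- v) \<partial>model \<beta> P)"
    using int1 int2 int3 by (simp only: Bochner_Integration.integral_add Bochner_Integration.integrable_add)
  also have "(\<integral>\<xi>. (increment \<xi> i - v) * (- v) \<partial>model \<beta> P) = (mean_increment i - v) * (- v)"
    using integrable_increment by (simp add: mean_increment_def model_total)
  finally have "(\<integral>\<xi>. (increment \<xi> i - v) * (increment \<xi> j - v) \<partial>model \<beta> P) =
      ((\<integral>\<xi>. (increment \<xi> i - v) * ?D \<xi> \<partial>model \<beta> P) + (\<integral>\<xi>. (increment \<xi> i - v) * (increment \<xi> j - ?D \<xi>) \<partial>model \<beta> P))
      + (mean_increment i - v) * (- v)" .
  moreover have "(mean_increment i - v) * (mean_increment (j - a) - v) = (mean_increment i - v) * mean_increment (j - a) + (mean_increment i - v) * (- v)"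
    by (simp add: algebra_simps)
  ultimately have eq: "(\<integral>\<xi>. (increment \<xi> i - v) * (increment \<xi> j - v) \<partial>model \<beta> P) =
      (mean_increment i - v) * (mean_increment (j - a) - v) + (\<integral>\<xi>. (increment \<xi> i - v) * (increment \<xi> j - ?D \<xi>) \<partial>model \<beta> P)"
    unfolding indep by linarith
  have "\<bar>\<integral>\<xi>. (increment \<xi> i - v) * (increment \<xi> j - ?D \<xi>) \<partial>model \<beta> P\<bar> \<le> (\<integral>\<xi>. \<bar>(increment \<xi> i - v) * (increment \<xi> j - ?D \<xi>)\<bar> \<partial>model \<beta> P)"
    by (rule integral_abs_bound)
  also have "\<dots> \<le> (\<integral>\<xi>. 2 * \<bar>increment \<xi> j - ?D \<xi>\<bar> \<partial>model \<beta> P)"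
  proof (rule integral_mono)
    show "integrable (model \<beta> P) (\<lambda>\<xi>. \<bar>(increment \<xi> i - v) * (increment \<xi> j - ?D \<xi>)\<bar>)"
      using int2 by (rule integrable_abs)
    show "integrable (model \<beta> P) (\<lambda>\<xi>. 2 * \<bar>increment \<xi> j - ?D \<xi>\<bar>)"
      by (intro integrable_mult_right integrable_abs Bochner_Integration.integrable_diff integrable_increment integrable_increment_shift)
    show "\<bar>(increment \<xi> i - v) * (increment \<xi> j - ?D \<xi>)\<bar> \<le> 2 * \<bar>increment \<xi> j - ?D \<xi>\<bar>" for \<xi>
      unfolding abs_mult using F by (intro mult_right_mono) auto
  qed
  also have "\<dots> \<le> 12 * ?g"
    using increment_localized[OF a(1)] by simp
  finally have 1: "\<bar>\<integral>\<xi>. (increment \<xi> i - v) * (increment \<xi> j - ?D \<xi>) \<partial>model \<beta> P\<bar> \<le> 12 * ?g" .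
  have "\<bar>(mean_increment i - v) * (mean_increment (j - a) - v)\<bar> \<le> 6 * (6 * ?g)"
    unfolding abs_mult
  proof (rule mult_mono)
    have "(26/27 :: real) ^ i \<le> 1" by (intro power_le_one) auto
    then show "\<bar>mean_increment i - v\<bar> \<le> 6" using mean_increment_lim_diff[of i] by (simp add: v_def)
    show "\<bar>mean_increment (j - a) - v\<bar> \<le> 6 * ?g" using mean_increment_lim_diff[of "j - a"] by (simp add: v_def)
  qed auto
  with 1 eq have "\<bar>\<integral>\<xi>. (increment \<xi> i - v) * (increment \<xi> j - v) \<partial>model \<beta> P\<bar> \<le> 48 * ?g" by linarith
  also have "48 * ?g \<le> 50 * (26/27) ^ (j - i)"
  proof -
    have "j - i = Suc (j - a)" using assms by (simp add: a_def)
    then show ?thesis by simp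
  qed
  finally show ?thesis by (simp add: v_def)
qed

lemma cov_bound:
  "\<bar>\<integral>\<xi>. (increment \<xi> i - limit_speed) * (increment \<xi> j - limit_speed) \<partial>model \<beta> P\<bar> \<le> 50 * (26/27) ^ (if i \<le> j then j - i else i - j)"
proof -
  consider "i < j" | "j < i" | "i = j" by linarith
  then show ?thesis
  proof cases
    case 1
    then show ?thesis using cov_bound_less[of i j] by simp
  next
    case 2
    then show ?thesis using cov_bound_less[of j i] by (simp add: mult.commute)
  next
    case 3
    have "\<bar>\<integral>\<xi>. (increment \<xi> i - limit_speed) * (increment \<xi> j - limit_speed) \<partial>model \<beta> P\<bar> \<le> (\<integral>\<xi>. \<bar>(increment \<xi> i - limit_speed) * (increment \<xi> j - limit_speed)\<bar> \<partial>model \<beta> P)"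
      by (rule integral_abs_bound)
    also have "\<dots> \<le> (\<integral>\<xi>. 2 * 2 \<partial>model \<beta> P)"
    proof (rule integral_mono)
      fix \<xi>
      have "\<bar>increment \<xi> k - limit_speed\<bar> \<le> 2" for k
        using abs_increment[of \<xi> k] abs_limit_speed by linarith
      then show "\<bar>(increment \<xi> i - limit_speed) * (increment \<xi> j - limit_speed)\<bar> \<le> 2 * 2"
        unfolding abs_mult by (intro mult_mono) auto
    qed (auto intro: integrable_increment_mult)
    finally show ?thesis using 3 by (simp add: model_total)
  qed
qed

lemma second_moment:
  "integrable (model \<beta> P) (\<lambda>\<xi>. (real (length (model_pos \<xi> n)) - real n * limit_speed)\<^sup>2)"
  "(\<integral>\<xi>. (real (length (model_pos \<xi> n)) - real n * limit_speed)\<^sup>2 \<partial>model \<beta> P) \<le> 2700 * real n"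
proof -
  let ?X = "\<lambda>i \<xi>. increment \<xi> i - limit_speed"
  have eq: "(real (length (model_pos \<xi> n)) - real n * limit_speed)\<^sup>2 = (\<Sum>i<n. \<Sum>j<n. ?X i \<xi> * ?X j \<xi>)" for \<xi>
  proof -
    have "real (length (model_pos \<xi> n)) - real n * limit_speed = (\<Sum>i<n. ?X i \<xi>)"
      by (simp add: sum_subtractf sum_increment)
    then show ?thesis by (simp add: power2_eq_square sum_product)
  qed
  show "integrable (model \<beta> P) (\<lambda>\<xi>. (real (length (model_pos \<xi> n)) - real n * limit_speed)\<^sup>2)"
    unfolding eq by (intro Bochner_Integration.integrable_sum integrable_increment_mult)
  have "(\<integral>\<xi>. (real (length (model_pos \<xi> n)) - real n * limit_speed)\<^sup>2 \<partial>model \<beta> P) =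
      (\<Sum>i<n. \<Sum>j<n. \<integral>\<xi>. ?X i \<xi> * ?X j \<xi> \<partial>model \<beta> P)"
    unfolding eq by (simp add: Bochner_Integration.integral_sum Bochner_Integration.integrable_sum integrable_increment_mult)
  also have "\<dots> \<le> (\<Sum>i<n. \<Sum>j<n. 50 * (26/27) ^ (if i \<le> j then j - i else i - j))"
    by (intro sum_mono order_trans[OF abs_ge_self cov_bound])
  also have "\<dots> = (\<Sum>i<n. 50 * (\<Sum>j<n. (26/27) ^ (if i \<le> j then j - i else i - j)))"
    by (simp only: sum_distrib_left)
  also have "\<dots> \<le> (\<Sum>i<n. 50 * (2 / (1 - 26/27)))"
    by (intro sum_mono mult_left_mono sum_power_dist_le) auto
  finally show "(\<integral>\<xi>. (real (length (model_pos \<xi> n)) - real n * limit_speed)\<^sup>2 \<partial>model \<beta> P) \<le> 2700 * real n"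
    by simp
qed

text \<open>
  Chebyshev's inequality for the driven walk, whose position has the averaged law.
\<close>

lemma deviation:
  assumes P: "0 \<notin> set_pmf P" and n: "n > 0" and e: "e > 0"
  shows "measure (averaged_walk \<beta> P) {X. e \<le> \<bar>real (length (X n)) / real n - limit_speed\<bar>} \<le> 2700 / e\<^sup>2 / real n"
proof -
  let ?A = "{x :: vertex. e \<le> \<bar>real (length x) / real n - limit_speed\<bar>}"
  have "measure (averaged_walk \<beta> P) {X. X n \<in> ?A} = measure (model \<beta> P) {\<xi>. model_pos \<xi> n \<in> ?A}"
    using emeasure_averaged_walk[OF _ P, of \<beta> n ?A] \<beta> by (simp add: measure_def)
  also have "\<dots> \<le> measure (model \<beta> P) {\<xi> \<in> space (model \<beta> P). (e * real n)\<^sup>2 \<le> (real (length (model_pos \<xi> n)) - real n * limit_speed)\<^sup>2}"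
  proof (rule \<Omega>.finite_measure_mono)
    show "{\<xi>. model_pos \<xi> n \<in> ?A} \<subseteq> {\<xi> \<in> space (model \<beta> P). (e * real n)\<^sup>2 \<le> (real (length (model_pos \<xi> n)) - real n * limit_speed)\<^sup>2}"
    proof safe
      fix \<xi> assume "e \<le> \<bar>real (length (model_pos \<xi> n)) / real n - limit_speed\<bar>"
      then have "e * real n \<le> \<bar>real (length (model_pos \<xi> n)) / real n - limit_speed\<bar> * real n"
        by (intro mult_right_mono) auto
      also have "\<dots> = \<bar>(real (length (model_pos \<xi> n)) / real n - limit_speed) * real n\<bar>"
        by (simp add: abs_mult)
      also have "(real (length (model_pos \<xi> n)) / real n - limit_speed) * real n = real (length (model_pos \<xi> n)) - real n * limit_speed"
        using n by (simp add: field_simps)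
      finally have "\<bar>e * real n\<bar> \<le> \<bar>real (length (model_pos \<xi> n)) - real n * limit_speed\<bar>"
        using e n by simp
      then show "(e * real n)\<^sup>2 \<le> (real (length (model_pos \<xi> n)) - real n * limit_speed)\<^sup>2"
        by (rule abs_le_square_iff[THEN iffD1])
    qed simp
    have [measurable]: "(\<lambda>\<xi>. real (length (model_pos \<xi> n))) \<in> borel_measurable (model \<beta> P)"
      by (rule measurable_compose[OF measurable_model_pos]) simp
    show "{\<xi> \<in> space (model \<beta> P). (e * real n)\<^sup>2 \<le> (real (length (model_pos \<xi> n)) - real n * limit_speed)\<^sup>2} \<in> sets (model \<beta> P)"
      by measurable
  qed
  also have "\<dots> \<le> (\<integral>\<xi>. (real (length (model_pos \<xi> n)) - real n * limit_speed)\<^sup>2 \<partial>model \<beta> P) / (e * real n)\<^sup>2"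
    using n e second_moment(1) by (intro integral_Markov_inequality_measure[where A = "{}"]) auto
  also have "\<dots> \<le> 2700 * real n / (e * real n)\<^sup>2"
    using second_moment(2) by (intro divide_right_mono) auto
  also have "\<dots> = 2700 / e\<^sup>2 / real n"
    using n e by (simp add: power2_eq_square)
  finally show ?thesis by simp
qed

text \<open>
  The bound in \<open>deviation\<close> is summable along the squares, and the Lipschitz property of the distance fills the
  gaps.
\<close>

lemma speed_limit:
  assumes P: "0 \<notin> set_pmf P"
  shows "AE X in averaged_walk \<beta> P. (\<lambda>n. real (length (X n)) / real n) \<longlonglongrightarrow> limit_speed"
proof -
  interpret A: prob_space "averaged_walk \<beta> P" by (rule prob_space_averaged_walk)
  let ?U = "PiM (UNIV :: nat set) (\<lambda>_. count_space (UNIV :: vertex set))"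
  have sets: "sets (averaged_walk \<beta> P) = sets ?U"
    unfolding averaged_walk_def using prob_space.not_empty[OF prob_space_GW]
    by (intro sets_bind) (auto simp: sets_walk)
  have space: "space (averaged_walk \<beta> P) = UNIV"
    using sets_eq_imp_space_eq[OF sets] by (simp add: space_PiM)
  have close: "AE X in averaged_walk \<beta> P. \<forall>\<^sub>F k in sequentially.
      \<bar>real (length (X (k\<^sup>2))) / real (k\<^sup>2) - limit_speed\<bar> < e" if e: "e > 0" for e
  proof -
    let ?A = "\<lambda>k. {X :: nat \<Rightarrow> vertex. e \<le> \<bar>real (length (X (k\<^sup>2))) / real (k\<^sup>2) - limit_speed\<bar>}"
    have m: "?A k \<in> sets (averaged_walk \<beta> P)" for k
    proof -
      have "(\<lambda>X. X (k\<^sup>2)) \<in> ?U \<rightarrow>\<^sub>M count_space UNIV"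
        by (rule measurable_component_singleton) simp
      from measurable_sets[OF this, of "{x. e \<le> \<bar>real (length x) / real (k\<^sup>2) - limit_speed\<bar>}"]
      show ?thesis by (simp add: sets vimage_def space_PiM)
    qed
    have "summable (\<lambda>k. measure (averaged_walk \<beta> P) (?A k))"
    proof (rule summable_comparison_test')
      show "summable (\<lambda>k. 2700 / e\<^sup>2 * inverse ((real k) ^ 2))"
        by (intro summable_mult inverse_power_summable) simp
      show "norm (measure (averaged_walk \<beta> P) (?A k)) \<le> 2700 / e\<^sup>2 * inverse ((real k) ^ 2)" if "k \<ge> 1" for k
        using deviation[OF P, of "k\<^sup>2" e] that e by (simp add: divide_inverse)
    qed
    from borel_cantelli_AE1[OF m _ this]
    have "AE X in averaged_walk \<beta> P. \<forall>\<^sub>F k in sequentially. X \<in> space (averaged_walk \<beta> P) - ?A k"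
      by (simp add: A.emeasure_eq_measure)
    then show ?thesis
      by (rule AE_mp) (auto intro!: AE_I2 elim: eventually_mono simp: not_le)
  qed
  have "AE X in averaged_walk \<beta> P. \<forall>m. \<forall>\<^sub>F k in sequentially.
      \<bar>real (length (X (k\<^sup>2))) / real (k\<^sup>2) - limit_speed\<bar> < 1 / real (Suc m)"
    unfolding AE_all_countable by (intro allI close) simp
  moreover have "AE X in averaged_walk \<beta> P. \<forall>n. length (X (Suc n)) \<le> Suc (length (X n)) \<and> length (X n) \<le> Suc (length (X (Suc n)))"
    unfolding AE_all_countable using AE_adjacent[OF _ P] \<beta> by simp
  ultimately show ?thesis
  proof eventually_elim
    case (elim X)
    show ?case
    proof (rule interpolate_limit)
      show "\<bar>real (length (X (Suc n))) - real (length (X n))\<bar> \<le> 1" for n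
        using elim(2)[rule_format, of n] by linarith
      show "\<bar>limit_speed\<bar> \<le> 1" by (rule abs_limit_speed)
      show "(\<lambda>k. real (length (X (k\<^sup>2))) / real (k\<^sup>2)) \<longlonglongrightarrow> limit_speed"
      proof (rule tendstoI)
        fix e :: real assume "e > 0"
        then obtain m where "inverse (real (Suc m)) < e" using reals_Archimedean by blast
        then have m: "1 / real (Suc m) < e" by (simp add: inverse_eq_divide)
        from elim(1)[rule_format, of m]
        show "\<forall>\<^sub>F k in sequentially. dist (real (length (X (k\<^sup>2))) / real (k\<^sup>2)) limit_speed < e"
          by eventually_elim (use m in \<open>simp add: dist_real_def\<close>)
      qed
    qed
  qed
qed

lemma speed_eq_limit_speed:
  assumes P: "0 \<notin> set_pmf P"
  shows "speed \<beta> P = limit_speed"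
  unfolding speed_def
proof (rule the_equality)
  interpret A: prob_space "averaged_walk \<beta> P" by (rule prob_space_averaged_walk)
  show "AE X in averaged_walk \<beta> P. (\<lambda>n. real (length (X n)) / real n) \<longlonglongrightarrow> limit_speed"
    by (rule speed_limit[OF P])
  fix v assume "AE X in averaged_walk \<beta> P. (\<lambda>n. real (length (X n)) / real n) \<longlonglongrightarrow> v"
  with speed_limit[OF P] have "AE X in averaged_walk \<beta> P. v = limit_speed"
    by eventually_elim (rule LIMSEQ_unique)
  then show "v = limit_speed" by simp
qed

text \<open>
  An increment is \<open>1\<close> or \<open>-1\<close> according to the marks, except at the root, where the walk is with exponentially
  small probability.
\<close>

lemma speed_eq_back_limit:
  assumes P: "0 \<notin> set_pmf P"
  shows "(\<lambda>n. 1 - 2 * measure (model \<beta> P) {\<xi>. steps_back (\<lambda>i. fst (\<xi> i)) (\<lambda>i. snd (\<xi> i)) n}) \<longlonglongrightarrow> speed \<beta> P"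
proof -
  let ?B = "\<lambda>n. {\<xi>. steps_back (\<lambda>i. fst (\<xi> i)) (\<lambda>i. snd (\<xi> i)) n}"
  let ?N = "\<lambda>n. {\<xi>. (\<lambda>i. snd (\<xi> i)) \<in> {V. no_cut (up V) 0 n}}"
  have N: "?N n \<in> sets (model \<beta> P)" "measure (model \<beta> P) (?N n) = measure (noise_seq \<beta>) {V. no_cut (up V) 0 n}" for n
    using measure_model_noise[OF no_cut_sets[of 0 n], where P = P and \<beta> = \<beta>] by simp_all
  have bound: "norm (mean_increment n - (1 - 2 * measure (model \<beta> P) (?B n))) \<le> 2 * (1000 * (1 / (1 + \<beta>)) * (99/100) ^ (2 * n))" if "n > 0" for n
  proof -
    have ind: "integrable (model \<beta> P) (indicator A :: _ \<Rightarrow> real)" if "A \<in> sets (model \<beta> P)" for A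
      using that by (simp add: \<Omega>.emeasure_eq_measure)
    have intB: "integrable (model \<beta> P) (\<lambda>\<xi>. 1 - 2 * indicator (?B n) \<xi> :: real)"
      using ind[OF model_back_sets] by simp
    have "mean_increment n - (1 - 2 * measure (model \<beta> P) (?B n)) = (\<integral>\<xi>. increment \<xi> n - (1 - 2 * indicator (?B n) \<xi>) \<partial>model \<beta> P)"
      using integrable_increment ind[OF model_back_sets] model_back_sets
      by (subst Bochner_Integration.integral_diff[OF integrable_increment intB]) (simp add: mean_increment_def model_total)
    also have "\<bar>\<dots>\<bar> \<le> (\<integral>\<xi>. \<bar>increment \<xi> n - (1 - 2 * indicator (?B n) \<xi>)\<bar> \<partial>model \<beta> P)"
      by (rule integral_abs_bound)
    also have "\<dots> \<le> (\<integral>\<xi>. 2 * indicator (?N n) \<xi> \<partial>model \<beta> P)"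
    proof (rule integral_mono)
      show "integrable (model \<beta> P) (\<lambda>\<xi>. \<bar>increment \<xi> n - (1 - 2 * indicator (?B n) \<xi>)\<bar>)"
        using Bochner_Integration.integrable_diff[OF integrable_increment intB] by (rule integrable_abs)
      show "integrable (model \<beta> P) (\<lambda>\<xi>. 2 * indicator (?N n) \<xi> :: real)"
        using ind[OF N(1)] by simp
      fix \<xi>
      show "\<bar>increment \<xi> n - (1 - 2 * indicator (?B n) \<xi>)\<bar> \<le> (2 * indicator (?N n) \<xi> :: real)"
      proof (cases "model_pos \<xi> n = []")
        case False
        have "of_int (int (length (model_pos \<xi> (Suc n))) - int (length (model_pos \<xi> n))) = increment \<xi> n"
          by (simp add: increment_def)
        with length_move_eq[OF False, of "snd (\<xi> n)" "fst (\<xi> (first_visit (\<lambda>i. fst (\<xi> i)) (\<lambda>i. snd (\<xi> i)) n))"]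
        have "increment \<xi> n = 1 - 2 * indicator (?B n) \<xi>"
          by (auto simp: pos_Suc steps_back_def indicator_def split: if_splits)
        then show ?thesis by (simp add: indicator_def)
      next
        case True
        have "\<not> cut_time (up (\<lambda>i. snd (\<xi> i))) t n" if "0 < t" for t
        proof
          assume c: "cut_time (up (\<lambda>i. snd (\<xi> i))) t n"
          then have "height (up (\<lambda>i. snd (\<xi> i))) 0 < height (up (\<lambda>i. snd (\<xi> i))) t"
            "height (up (\<lambda>i. snd (\<xi> i))) t \<le> height (up (\<lambda>i. snd (\<xi> i))) n"
            using that by (auto simp: cut_time_def)
          with length_pos_diff[of 0 n "\<lambda>i. snd (\<xi> i)" "\<lambda>i. fst (\<xi> i)"] True show False by simp
        qed
        then have "\<xi> \<in> ?N n" by (auto simp: no_cut_def)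
        then show ?thesis
          using abs_increment[of \<xi> n] by (auto simp: indicator_def)
      qed
    qed
    also have "\<dots> = 2 * measure (model \<beta> P) (?N n)" using N(1) by simp
    also have "\<dots> \<le> 2 * (1000 * (1 / (1 + \<beta>)) * (99/100) ^ (2 * n))"
      using N(2) prob_no_cut[OF \<beta> that] by simp
    finally show ?thesis by simp
  qed
  have "(\<lambda>n. mean_increment n - (1 - 2 * measure (model \<beta> P) (?B n))) \<longlonglongrightarrow> 0"
  proof (rule Lim_null_comparison)
    show "\<forall>\<^sub>F n in sequentially. norm (mean_increment n - (1 - 2 * measure (model \<beta> P) (?B n))) \<le> 2 * (1000 * (1 / (1 + \<beta>)) * (99/100) ^ (2 * n))"
      using eventually_gt_at_top[of 0] by eventually_elim (rule bound)
    have "(\<lambda>n. 2 * (1000 * (1 / (1 + \<beta>)) * ((99/100)\<^sup>2) ^ n)) \<longlonglongrightarrow> 2 * (1000 * (1 / (1 + \<beta>)) * 0)"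
      by (intro tendsto_intros LIMSEQ_realpow_zero) (auto simp: power2_eq_square)
    then show "(\<lambda>n. 2 * (1000 * (1 / (1 + \<beta>)) * (99/100) ^ (2 * n))) \<longlonglongrightarrow> 0"
      by (simp add: power_mult)
  qed
  from tendsto_diff[OF mean_increment_tendsto this] show ?thesis
    by (simp add: speed_eq_limit_speed[OF P])
qed

end

section \<open>Comparison of the speeds\<close>

lemma prob_steps_back_model:
  shows "(\<lambda>z. measure (noise_seq \<beta>) {V. steps_back z V n}) \<in> borel_measurable (PiM UNIV (\<lambda>_. measure_pmf P))"
    and "measure (model \<beta> P) {\<xi>. steps_back (\<lambda>i. fst (\<xi> i)) (\<lambda>i. snd (\<xi> i)) n} =
      (\<integral>z. measure (noise_seq \<beta>) {V. steps_back z V n} \<partial>PiM UNIV (\<lambda>_. measure_pmf P))"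
proof -
  let ?Z = "PiM UNIV (\<lambda>_ :: nat. measure_pmf P)"
  interpret V: prob_space "noise_seq \<beta>" by (rule prob_space_noise_seq)
  interpret Z: prob_space ?Z by (intro prob_space_PiM measure_pmf.prob_space_axioms)
  let ?E = "{p \<in> space (?Z \<Otimes>\<^sub>M noise_seq \<beta>). steps_back (fst p) (snd p) n}"
  have E: "?E \<in> sets (?Z \<Otimes>\<^sub>M noise_seq \<beta>)"
  proof -
    have "(\<lambda>p. steps_back (fst p) (snd p) n) \<in> ?Z \<Otimes>\<^sub>M noise_seq \<beta> \<rightarrow>\<^sub>M count_space UNIV"
    proof (rule measurable_back[where Z = fst and V = snd and \<beta> = \<beta>])
      show "(\<lambda>p. fst p x) \<in> ?Z \<Otimes>\<^sub>M noise_seq \<beta> \<rightarrow>\<^sub>M count_space UNIV" for x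
        by (rule measurable_compose[OF measurable_fst measurable_pmf_component])
      show "(\<lambda>p. snd p i) \<in> ?Z \<Otimes>\<^sub>M noise_seq \<beta> \<rightarrow>\<^sub>M noise \<beta>" for i
        by (rule measurable_compose[OF measurable_snd measurable_component_singleton]) simp
    qed
    then show ?thesis by (simp add: pred_def)
  qed
  have sec: "Pair z -` ?E = {V. steps_back z V n}" for z
    by (auto simp: space_pair_measure space_PiM)
  have em: "(\<lambda>z. emeasure (noise_seq \<beta>) {V. steps_back z V n}) \<in> borel_measurable ?Z"
    using V.measurable_emeasure_Pair[OF E] by (simp only: sec)
  then show m: "(\<lambda>z. measure (noise_seq \<beta>) {V. steps_back z V n}) \<in> borel_measurable ?Z"
    unfolding measure_def by measurable
  let ?B = "{\<xi>. steps_back (\<lambda>i. fst (\<xi> i)) (\<lambda>i. snd (\<xi> i)) n}"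
  have "emeasure (model \<beta> P) ?B = emeasure (?Z \<Otimes>\<^sub>M noise_seq \<beta>) ?E"
    by (rule emeasure_model_pair[OF model_back_sets])
  also have "\<dots> = (\<integral>\<^sup>+z. emeasure (noise_seq \<beta>) (Pair z -` ?E) \<partial>?Z)"
    using E by (rule V.emeasure_pair_measure_alt)
  also have "\<dots> = (\<integral>\<^sup>+z. ennreal (measure (noise_seq \<beta>) {V. steps_back z V n}) \<partial>?Z)"
    by (simp only: sec V.emeasure_eq_measure)
  finally show "measure (model \<beta> P) ?B = (\<integral>z. measure (noise_seq \<beta>) {V. steps_back z V n} \<partial>?Z)"
    using m by (subst integral_eq_nn_integral) (auto simp: measure_def)
qed

text \<open>
  Any coupling of the two offspring sequences may be used, because the comparison is made for fixed offspring
  sequences.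
\<close>

lemma prob_steps_back_diff_le:
  assumes W: "prob_space W"
    and Z1: "Z1 \<in> W \<rightarrow>\<^sub>M PiM UNIV (\<lambda>_. measure_pmf P1)" "distr W (PiM UNIV (\<lambda>_. measure_pmf P1)) Z1 = PiM UNIV (\<lambda>_. measure_pmf P1)"
    and Z2: "Z2 \<in> W \<rightarrow>\<^sub>M PiM UNIV (\<lambda>_. measure_pmf P2)" "distr W (PiM UNIV (\<lambda>_. measure_pmf P2)) Z2 = PiM UNIV (\<lambda>_. measure_pmf P2)"
    and H: "integrable W H"
    and le: "AE w in W. measure (noise_seq \<beta>) {V. steps_back (Z1 w) V n} - measure (noise_seq \<beta>) {V. steps_back (Z2 w) V n} \<le> H w"
  shows "measure (model \<beta> P1) {\<xi>. steps_back (\<lambda>i. fst (\<xi> i)) (\<lambda>i. snd (\<xi> i)) n} -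
    measure (model \<beta> P2) {\<xi>. steps_back (\<lambda>i. fst (\<xi> i)) (\<lambda>i. snd (\<xi> i)) n} \<le> (\<integral>w. H w \<partial>W)"
proof -
  interpret W: prob_space W by fact
  interpret V: prob_space "noise_seq \<beta>" by (rule prob_space_noise_seq)
  let ?b = "\<lambda>z. measure (noise_seq \<beta>) {V. steps_back z V n}"
  have 1: "measure (model \<beta> P) {\<xi>. steps_back (\<lambda>i. fst (\<xi> i)) (\<lambda>i. snd (\<xi> i)) n} = (\<integral>w. ?b (Z w) \<partial>W)"
    and 2: "integrable W (\<lambda>w. ?b (Z w))"
    if Z: "Z \<in> W \<rightarrow>\<^sub>M PiM UNIV (\<lambda>_. measure_pmf P)" "distr W (PiM UNIV (\<lambda>_. measure_pmf P)) Z = PiM UNIV (\<lambda>_. measure_pmf P)" for Z P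
  proof -
    show "measure (model \<beta> P) {\<xi>. steps_back (\<lambda>i. fst (\<xi> i)) (\<lambda>i. snd (\<xi> i)) n} = (\<integral>w. ?b (Z w) \<partial>W)"
      unfolding prob_steps_back_model(2)
      by (subst Z(2)[symmetric], rule integral_distr[OF Z(1) prob_steps_back_model(1)])
    show "integrable W (\<lambda>w. ?b (Z w))"
      by (rule W.integrable_const_bound[of _ 1])
         (auto intro!: measurable_compose[OF Z(1) prob_steps_back_model(1)])
  qed
  have "(\<integral>w. ?b (Z1 w) \<partial>W) - (\<integral>w. ?b (Z2 w) \<partial>W) = (\<integral>w. ?b (Z1 w) - ?b (Z2 w) \<partial>W)"
    using 2[OF Z1] 2[OF Z2] by simp
  also have "\<dots> \<le> (\<integral>w. H w \<partial>W)"
    using 2[OF Z1] 2[OF Z2] H le by (intro integral_mono_AE) auto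
  finally show ?thesis by (simp only: 1[OF Z1] 1[OF Z2])
qed

lemma back_prob_bounds: "\<beta> > 0 \<Longrightarrow> 0 \<le> back_prob \<beta> k \<and> back_prob \<beta> k \<le> 1"
  by (auto simp: back_prob_def add_nonneg_nonneg divide_le_eq_1)

lemma back_prob_diff_le:
  assumes "\<beta> > 0" "1 \<le> a" "1 \<le> b"
  shows "max 0 (back_prob \<beta> a - back_prob \<beta> b) \<le> 1 / \<beta> * ((1 / real a - 1 / real b) * of_bool (a < b))"
proof (cases "a < b")
  case True
  have pos: "1 + \<beta> * real k > 0" for k using assms by (simp add: add_pos_nonneg)
  have "back_prob \<beta> a - back_prob \<beta> b = \<beta> * (real b - real a) / ((1 + \<beta> * real a) * (1 + \<beta> * real b))"
    using pos[of a] pos[of b] by (simp add: back_prob_def diff_frac_eq algebra_simps)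
  also have "\<dots> \<le> \<beta> * (real b - real a) / ((\<beta> * real a) * (\<beta> * real b))"
    using assms True pos[of a] pos[of b]
    by (intro divide_left_mono mult_mono mult_nonneg_nonneg mult_pos_pos) auto
  also have "\<dots> = 1 / \<beta> * (1 / real a - 1 / real b)"
    using assms by (simp add: field_simps)
  finally have "back_prob \<beta> a - back_prob \<beta> b \<le> 1 / \<beta> * (1 / real a - 1 / real b)" .
  moreover have "0 \<le> 1 / \<beta> * (1 / real a - 1 / real b)"
    using assms True by (intro mult_nonneg_nonneg) (auto simp: field_simps)
  ultimately show ?thesis using True by simp
next
  case False
  have "back_prob \<beta> a \<le> back_prob \<beta> b"
    unfolding back_prob_def using assms False by (intro divide_left_mono mult_pos_pos add_pos_nonneg) auto
  with False show ?thesis by simp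
qed

text \<open>
  The gain at a new vertex, from \<open>1 + \<beta> k \<le> (1 + \<beta>) k\<close>.
\<close>

lemma back_prob_diff_ge:
  assumes "\<beta> > 0" "1 \<le> b" "b \<le> a"
  shows "\<beta> / (1 + \<beta>)\<^sup>2 * (1 / real b - 1 / real a) \<le> back_prob \<beta> b - back_prob \<beta> a"
proof -
  have pos: "1 + \<beta> * real k > 0" for k using assms by (simp add: add_pos_nonneg)
  have le: "1 + \<beta> * real k \<le> (1 + \<beta>) * real k" if "1 \<le> k" for k
    using that by (simp add: algebra_simps)
  have "\<beta> / (1 + \<beta>)\<^sup>2 * (1 / real b - 1 / real a) = \<beta> * (real a - real b) / (((1 + \<beta>) * real a) * ((1 + \<beta>) * real b))"
    using assms by (simp add: field_simps power2_eq_square)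
  also have "\<dots> \<le> \<beta> * (real a - real b) / ((1 + \<beta> * real a) * (1 + \<beta> * real b))"
    using assms pos[of a] pos[of b]
    by (intro divide_left_mono mult_mono le mult_pos_pos mult_nonneg_nonneg) auto
  also have "\<dots> = back_prob \<beta> b - back_prob \<beta> a"
    using pos[of a] pos[of b] by (simp add: back_prob_def diff_frac_eq algebra_simps)
  finally show ?thesis .
qed

lemma abs_inverse_diff_le_1: "\<bar>1 / real a - 1 / real b\<bar> \<le> 1"
proof -
  have "0 \<le> 1 / real a" "1 / real a \<le> 1" "0 \<le> 1 / real b" "1 / real b \<le> 1"
    by (auto simp: divide_le_eq_1)
  then show ?thesis by linarith
qed

lemma AE_seq_ge_1:
  fixes P :: "nat pmf"
  assumes "0 \<notin> set_pmf P"
  shows "AE z in PiM UNIV (\<lambda>_ :: nat. measure_pmf P). \<forall>i. 1 \<le> z i"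
proof -
  have "AE z in PiM UNIV (\<lambda>_ :: nat. measure_pmf P). 1 \<le> z i" for i
  proof (rule AE_PiM_component[where P = "\<lambda>k. 1 \<le> k"])
    show "AE k in measure_pmf P. 1 \<le> k"
    proof (rule AE_pmfI)
      fix k assume "k \<in> set_pmf P"
      with assms have "k \<noteq> 0" by metis
      then show "1 \<le> k" by simp
    qed
  qed (auto simp: measure_pmf.prob_space_axioms)
  then show ?thesis by (simp add: AE_all_countable)
qed

lemma integral_component:
  fixes f :: "'a \<Rightarrow> real"
  shows "(\<integral>z. f (z (i :: nat)) \<partial>PiM UNIV (\<lambda>_. measure_pmf P)) = measure_pmf.expectation P f"
proof -
  have "measure_pmf.expectation P f = (\<integral>x. f x \<partial>distr (PiM UNIV (\<lambda>_. measure_pmf P)) (measure_pmf P) (\<lambda>z. z i))"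
    by (subst distr_PiM_component) (auto simp: measure_pmf.prob_space_axioms)
  also have "\<dots> = (\<integral>z. f (z i) \<partial>PiM UNIV (\<lambda>_. measure_pmf P))"
    by (rule integral_distr) (auto intro: measurable_component_singleton)
  finally show ?thesis ..
qed

lemma measurable_seq_component:
  fixes f :: "'a \<Rightarrow> real"
  shows "(\<lambda>z. f (z i)) \<in> borel_measurable (PiM UNIV (\<lambda>_. measure_pmf P))"
proof -
  have "(\<lambda>z. z i) \<in> PiM UNIV (\<lambda>_. measure_pmf P) \<rightarrow>\<^sub>M measure_pmf P"
    by (rule measurable_component_singleton) simp
  then show ?thesis by (rule measurable_compose) simp
qed

lemma sum_weights_eq:
  fixes B :: real
  assumes "0 \<le> c" "0 \<le> B"
  shows "(\<Sum>i\<in>I. \<Sum>l\<in>I. c * (99/100) ^ (n - i) * (99/100) ^ (n - l) * B) =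
    c * B * (\<Sum>i\<in>I. (99/100) ^ (n - i))\<^sup>2"
proof -
  have "(\<Sum>i\<in>I. (99/100 :: real) ^ (n - i))\<^sup>2 = (\<Sum>i\<in>I. \<Sum>l\<in>I. (99/100) ^ (n - i) * (99/100) ^ (n - l))"
    by (simp add: power2_eq_square sum_product)
  then show ?thesis
    by (simp add: sum_distrib_left mult_ac)
qed

lemma integral_pair_component:
  fixes h :: "nat \<times> nat \<Rightarrow> real" and P1 P2 :: "nat pmf"
  assumes h: "\<And>x. 0 \<le> h x" "\<And>x. h x \<le> C"
  defines "W \<equiv> PiM UNIV (\<lambda>_ :: nat. measure_pmf P1) \<Otimes>\<^sub>M PiM UNIV (\<lambda>_ :: nat. measure_pmf P2)"
  shows "(\<lambda>w. h (fst w i, snd w l)) \<in> borel_measurable W"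
    and "(\<integral>w. h (fst w i, snd w l) \<partial>W) = measure_pmf.expectation (pair_pmf P1 P2) h"
proof -
  let ?A = "PiM UNIV (\<lambda>_ :: nat. measure_pmf P1)" and ?B = "PiM UNIV (\<lambda>_ :: nat. measure_pmf P2)"
  interpret A: prob_space ?A by (intro prob_space_PiM measure_pmf.prob_space_axioms)
  interpret B: prob_space ?B by (intro prob_space_PiM measure_pmf.prob_space_axioms)
  interpret W: pair_prob_space ?A ?B ..
  have m1: "(\<lambda>w. h (a, snd w l)) \<in> borel_measurable W" for a
    unfolding W_def by (rule measurable_compose[OF measurable_compose[OF measurable_snd measurable_pmf_component]]) simp
  show m: "(\<lambda>w. h (fst w i, snd w l)) \<in> borel_measurable W"
    by (rule measurable_compose_countable[where f = "\<lambda>a w. h (a, snd w l)" and g = "\<lambda>w. fst w i", OF m1])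
       (unfold W_def, rule measurable_compose[OF measurable_fst measurable_pmf_component])
  have "(\<integral>\<^sup>+w. ennreal (h (fst w i, snd w l)) \<partial>W) = (\<integral>\<^sup>+z1. \<integral>\<^sup>+z2. ennreal (h (z1 i, z2 l)) \<partial>?B \<partial>?A)"
    using m unfolding W_def by (subst B.nn_integral_fst[symmetric]) auto
  also have "\<dots> = (\<integral>\<^sup>+z1. \<integral>\<^sup>+b. ennreal (h (z1 i, b)) \<partial>measure_pmf P2 \<partial>?A)"
  proof (rule nn_integral_cong)
    fix z1 :: "nat \<Rightarrow> nat"
    have "(\<integral>\<^sup>+b. ennreal (h (z1 i, b)) \<partial>measure_pmf P2) =
        (\<integral>\<^sup>+b. ennreal (h (z1 i, b)) \<partial>distr ?B (measure_pmf P2) (\<lambda>z. z l))"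
      by (subst distr_PiM_component) (auto simp: measure_pmf.prob_space_axioms)
    also have "\<dots> = (\<integral>\<^sup>+z2. ennreal (h (z1 i, z2 l)) \<partial>?B)"
      by (rule nn_integral_distr) (auto intro: measurable_component_singleton)
    finally show "(\<integral>\<^sup>+z2. ennreal (h (z1 i, z2 l)) \<partial>?B) = (\<integral>\<^sup>+b. ennreal (h (z1 i, b)) \<partial>measure_pmf P2)" ..
  qed
  also have "\<dots> = (\<integral>\<^sup>+a. \<integral>\<^sup>+b. ennreal (h (a, b)) \<partial>measure_pmf P2 \<partial>measure_pmf P1)"
  proof -
    have "(\<integral>\<^sup>+a. \<integral>\<^sup>+b. ennreal (h (a, b)) \<partial>measure_pmf P2 \<partial>measure_pmf P1) =
        (\<integral>\<^sup>+a. \<integral>\<^sup>+b. ennreal (h (a, b)) \<partial>measure_pmf P2 \<partial>distr ?A (measure_pmf P1) (\<lambda>z. z i))"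
      by (subst distr_PiM_component) (auto simp: measure_pmf.prob_space_axioms)
    also have "\<dots> = (\<integral>\<^sup>+z1. \<integral>\<^sup>+b. ennreal (h (z1 i, b)) \<partial>measure_pmf P2 \<partial>?A)"
      by (rule nn_integral_distr) (auto intro: measurable_component_singleton)
    finally show ?thesis ..
  qed
  also have "\<dots> = (\<integral>\<^sup>+x. ennreal (h x) \<partial>measure_pmf (pair_pmf P1 P2))"
    by (simp add: nn_integral_pair_pmf')
  finally show "(\<integral>w. h (fst w i, snd w l) \<partial>W) = measure_pmf.expectation (pair_pmf P1 P2) h"
    using h(1) m by (simp add: integral_eq_nn_integral)
qed

lemma integrable_pmf_bounded:
  fixes f :: "'a \<Rightarrow> real"
  assumes "\<And>x. x \<in> set_pmf p \<Longrightarrow> \<bar>f x\<bar> \<le> C"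
  shows "integrable (measure_pmf p) f"
  by (rule measure_pmf.integrable_const_bound[of _ C]) (auto simp: AE_measure_pmf_iff assms)

lemma weights_sum:
  "(\<Sum>i\<le>n. (99/100 :: real) ^ (n - i))\<^sup>2 \<le> 10000" "(\<Sum>i<n. (99/100 :: real) ^ (n - i))\<^sup>2 \<le> 10000"
proof -
  have "(\<Sum>i\<le>n. (99/100 :: real) ^ (n - i)) \<le> 100" "(\<Sum>i<n. (99/100 :: real) ^ (n - i)) \<le> 100"
    using sum_power_diff_le[of "99/100" n] sum_power_diff_lessThan_le[of "99/100" n] by auto
  then have "(\<Sum>i\<le>n. (99/100 :: real) ^ (n - i))\<^sup>2 \<le> 100\<^sup>2" "(\<Sum>i<n. (99/100 :: real) ^ (n - i))\<^sup>2 \<le> 100\<^sup>2"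
    by (intro power_mono sum_nonneg; simp)+
  then show "(\<Sum>i\<le>n. (99/100 :: real) ^ (n - i))\<^sup>2 \<le> 10000" "(\<Sum>i<n. (99/100 :: real) ^ (n - i))\<^sup>2 \<le> 10000"
    by simp_all
qed

abbreviation model_back :: "real \<Rightarrow> nat pmf \<Rightarrow> nat \<Rightarrow> real" where
  "model_back \<beta> P n \<equiv> measure (model \<beta> P) {\<xi>. steps_back (\<lambda>i. fst (\<xi> i)) (\<lambda>i. snd (\<xi> i)) n}"

text \<open>
  The two offspring sequences are taken independent, so each pair of indices has the law of a pair of
  independent offspring numbers, equal indices included. The sums over the weights are at most
  \<open>100 = 1 / (1 - 99/100)\<close> each.
\<close>

lemma model_back_diff_indep:
  assumes \<beta>: "\<beta> > 23 / 4" and P: "0 \<notin> set_pmf P1" "0 \<notin> set_pmf P2" and n: "n \<ge> 1"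
  shows "model_back \<beta> P1 n - model_back \<beta> P2 n \<le>
    measure (noise_seq \<beta>) {V. cut_time (up V) n n} *
      (measure_pmf.expectation P1 (back_prob \<beta>) - measure_pmf.expectation P2 (back_prob \<beta>)) +
    10000000 * (1 / (1 + \<beta>)) * (1 / \<beta>) *
      measure_pmf.expectation (pair_pmf P1 P2) (\<lambda>(a, b). (1 / real a - 1 / real b) * of_bool (a < b))"
proof -
  let ?A = "PiM UNIV (\<lambda>_ :: nat. measure_pmf P1)" and ?B = "PiM UNIV (\<lambda>_ :: nat. measure_pmf P2)"
  let ?W = "?A \<Otimes>\<^sub>M ?B"
  interpret A: prob_space ?A by (intro prob_space_PiM measure_pmf.prob_space_axioms)
  interpret B: prob_space ?B by (intro prob_space_PiM measure_pmf.prob_space_axioms)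
  interpret W: pair_prob_space ?A ?B ..
  have \<beta>0: "\<beta> > 0" using \<beta> by simp
  let ?R = "measure (noise_seq \<beta>) {V. cut_time (up V) n n}"
  let ?p = "1 / (1 + \<beta>)"
  define h where "h = (\<lambda>(a, b). max 0 (back_prob \<beta> a - back_prob \<beta> b))"
  have h: "0 \<le> h x" "h x \<le> 1" for x
    using back_prob_bounds[OF \<beta>0, of "fst x"] back_prob_bounds[OF \<beta>0, of "snd x"] by (auto simp: h_def split: prod.splits)
  let ?S = "\<lambda>w. \<Sum>i\<le>n. \<Sum>l\<le>n. 1000 * ?p * (99/100) ^ (n - i) * (99/100) ^ (n - l) * h (fst w i, snd w l)"
  let ?G = "\<lambda>w :: (nat \<Rightarrow> nat) \<times> (nat \<Rightarrow> nat). ?R * (back_prob \<beta> (fst w n) - back_prob \<beta> (snd w n))"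
  have ih: "integrable ?W (\<lambda>w. h (fst w i, snd w l))" for i l
    using h integral_pair_component(1)[OF h, where i = i and l = l and ?P1.0 = P1 and ?P2.0 = P2]
    by (intro W.P.integrable_const_bound[of _ 1]) auto
  have d1: "distr ?W ?A fst = ?A" by (rule B.distr_pair_fst)
  have d2: "distr ?W ?B snd = ?B" by (rule distr_pair_snd[OF A.prob_space_axioms B.prob_space_axioms])
  have b1: "integrable ?W (\<lambda>w. back_prob \<beta> (fst w n))" "(\<integral>w. back_prob \<beta> (fst w n) \<partial>?W) = measure_pmf.expectation P1 (back_prob \<beta>)"
  proof -
    show "integrable ?W (\<lambda>w. back_prob \<beta> (fst w n))"
      using back_prob_bounds[OF \<beta>0]
      by (intro W.P.integrable_const_bound[of _ 1]) (auto intro!: measurable_compose[OF measurable_fst measurable_seq_component])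
    have "(\<integral>w. back_prob \<beta> (fst w n) \<partial>?W) = (\<integral>z. back_prob \<beta> (z n) \<partial>distr ?W ?A fst)"
      by (rule integral_distr[symmetric]) (auto intro: measurable_seq_component)
    then show "(\<integral>w. back_prob \<beta> (fst w n) \<partial>?W) = measure_pmf.expectation P1 (back_prob \<beta>)"
      by (simp only: d1 integral_component)
  qed
  have b2: "integrable ?W (\<lambda>w. back_prob \<beta> (snd w n))" "(\<integral>w. back_prob \<beta> (snd w n) \<partial>?W) = measure_pmf.expectation P2 (back_prob \<beta>)"
  proof -
    show "integrable ?W (\<lambda>w. back_prob \<beta> (snd w n))"
      using back_prob_bounds[OF \<beta>0]
      by (intro W.P.integrable_const_bound[of _ 1]) (auto intro!: measurable_compose[OF measurable_snd measurable_seq_component])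
    have "(\<integral>w. back_prob \<beta> (snd w n) \<partial>?W) = (\<integral>z. back_prob \<beta> (z n) \<partial>distr ?W ?B snd)"
      by (rule integral_distr[symmetric]) (auto intro: measurable_seq_component)
    then show "(\<integral>w. back_prob \<beta> (snd w n) \<partial>?W) = measure_pmf.expectation P2 (back_prob \<beta>)"
      by (simp only: d2 integral_component)
  qed
  have iS: "integrable ?W ?S"
    by (intro Bochner_Integration.integrable_sum integrable_mult_right ih)
  have iG: "integrable ?W ?G"
    by (intro integrable_mult_right Bochner_Integration.integrable_diff b1 b2)
  have "model_back \<beta> P1 n - model_back \<beta> P2 n \<le> (\<integral>w. ?G w + ?S w \<partial>?W)"
  proof (rule prob_steps_back_diff_le[OF W.P.prob_space_axioms measurable_fst d1 measurable_snd d2])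
    show "integrable ?W (\<lambda>w. ?G w + ?S w)" using iG iS by (rule Bochner_Integration.integrable_add)
    have "AE w in ?W. \<forall>i. 1 \<le> fst w i"
    proof (rule AE_distrD[of fst ?W ?A "\<lambda>z. \<forall>i. 1 \<le> z i"])
      show "AE z in distr ?W ?A fst. \<forall>i. 1 \<le> z i" unfolding d1 by (rule AE_seq_ge_1[OF P(1)])
    qed simp
    moreover have "AE w in ?W. \<forall>i. 1 \<le> snd w i"
    proof (rule AE_distrD[of snd ?W ?B "\<lambda>z. \<forall>i. 1 \<le> z i"])
      show "AE z in distr ?W ?B snd. \<forall>i. 1 \<le> z i" unfolding d2 by (rule AE_seq_ge_1[OF P(2)])
    qed simp
    ultimately show "AE w in ?W. measure (noise_seq \<beta>) {V. steps_back (fst w) V n} - measure (noise_seq \<beta>) {V. steps_back (snd w) V n} \<le> ?G w + ?S w"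
    proof eventually_elim
      case (elim w)
      have "1 \<le> fst w i" "1 \<le> snd w i" for i using elim by auto
      from prob_back_diff_le[OF \<beta>, of "fst w" n "snd w", OF this(1)[of n] this(2)[of n]] prob_overtaken_uncoupled[OF \<beta> n, of "fst w" "snd w", OF this]
      show ?case by (simp add: h_def)
    qed
  qed
  also have "\<dots> = (\<integral>w. ?G w \<partial>?W) + (\<integral>w. ?S w \<partial>?W)"
    using iG iS by (rule Bochner_Integration.integral_add)
  also have "(\<integral>w. ?G w \<partial>?W) = ?R * (measure_pmf.expectation P1 (back_prob \<beta>) - measure_pmf.expectation P2 (back_prob \<beta>))"
    using b1 b2 by simp
  also have "(\<integral>w. ?S w \<partial>?W) = (\<Sum>i\<le>n. \<Sum>l\<le>n. 1000 * ?p * (99/100) ^ (n - i) * (99/100) ^ (n - l) * measure_pmf.expectation (pair_pmf P1 P2) h)"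
  proof -
    have "(\<integral>w. c * h (fst w i, snd w l) \<partial>?W) = c * measure_pmf.expectation (pair_pmf P1 P2) h" for c i l
      unfolding integral_mult_right_zero by (intro arg_cong[where f = "(*) c"] integral_pair_component(2)[OF h])
    moreover have "(\<integral>w. ?S w \<partial>?W) = (\<Sum>i\<le>n. \<integral>w. (\<Sum>l\<le>n. 1000 * ?p * (99/100) ^ (n - i) * (99/100) ^ (n - l) * h (fst w i, snd w l)) \<partial>?W)"
      by (rule Bochner_Integration.integral_sum) (intro Bochner_Integration.integrable_sum integrable_mult_right ih)
    moreover have "\<dots> = (\<Sum>i\<le>n. \<Sum>l\<le>n. \<integral>w. 1000 * ?p * (99/100) ^ (n - i) * (99/100) ^ (n - l) * h (fst w i, snd w l) \<partial>?W)"
      by (intro sum.cong refl Bochner_Integration.integral_sum integrable_mult_right ih)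
    ultimately show ?thesis by (simp only:)
  qed
  also have "\<dots> = 1000 * ?p * measure_pmf.expectation (pair_pmf P1 P2) h * (\<Sum>i\<le>n. (99/100) ^ (n - i))\<^sup>2"
    using \<beta>0 h by (intro sum_weights_eq) auto
  also have "\<dots> \<le> 1000 * ?p * measure_pmf.expectation (pair_pmf P1 P2) h * 10000"
    using \<beta>0 h weights_sum(1)[of n] by (intro mult_left_mono mult_nonneg_nonneg) auto
  also have "measure_pmf.expectation (pair_pmf P1 P2) h \<le>
      measure_pmf.expectation (pair_pmf P1 P2) (\<lambda>x. 1 / \<beta> * (\<lambda>(a, b). (1 / real a - 1 / real b) * of_bool (a < b)) x)"
  proof (rule integral_mono_AE)
    show "integrable (measure_pmf (pair_pmf P1 P2)) h"
      by (rule integrable_pmf_bounded[of _ _ 1]) (use h in auto)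
    show "integrable (measure_pmf (pair_pmf P1 P2)) (\<lambda>x. 1 / \<beta> * (\<lambda>(a, b). (1 / real a - 1 / real b) * of_bool (a < b)) x)"
    proof (rule integrable_mult_right, rule integrable_pmf_bounded[of _ _ 1])
      fix x
      show "\<bar>(\<lambda>(a, b). (1 / real a - 1 / real b) * of_bool (a < b)) x\<bar> \<le> 1"
        using abs_inverse_diff_le_1[of "fst x" "snd x"] by (simp add: case_prod_beta)
    qed
    show "AE x in measure_pmf (pair_pmf P1 P2). h x \<le> 1 / \<beta> * (\<lambda>(a, b). (1 / real a - 1 / real b) * of_bool (a < b)) x"
    proof (rule AE_pmfI)
      fix x assume "x \<in> set_pmf (pair_pmf P1 P2)"
      then obtain a b where "x = (a, b)" "a \<in> set_pmf P1" "b \<in> set_pmf P2" by auto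
      moreover from this P have "1 \<le> a" "1 \<le> b" by (auto simp: Suc_le_eq intro!: gr0I)
      ultimately show "h x \<le> 1 / \<beta> * (\<lambda>(a, b). (1 / real a - 1 / real b) * of_bool (a < b)) x"
        using back_prob_diff_le[OF \<beta>0, of a b] by (simp add: h_def)
    qed
  qed
  also have "\<dots> = 1 / \<beta> * measure_pmf.expectation (pair_pmf P1 P2) (\<lambda>(a, b). (1 / real a - 1 / real b) * of_bool (a < b))"
    by simp
  finally show ?thesis using \<beta>0 by (simp add: mult_left_mono divide_right_mono mult_ac)
qed

text \<open>
  The offspring sequences consist of independent copies of the monotone coupling.
\<close>

lemma model_back_diff_coupled:
  assumes \<beta>: "\<beta> > 23 / 4" and P: "0 \<notin> set_pmf P1" "0 \<notin> set_pmf P2"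
    and Q: "map_pmf fst Q = P1" "map_pmf snd Q = P2" "AE x in measure_pmf Q. snd x \<le> fst x"
  shows "model_back \<beta> P1 n - model_back \<beta> P2 n \<le>
    measure (noise_seq \<beta>) {V. cut_time (up V) n n} *
      (measure_pmf.expectation P1 (back_prob \<beta>) - measure_pmf.expectation P2 (back_prob \<beta>)) +
    20000000 * (1 / (1 + \<beta>))\<^sup>2 * measure_pmf.expectation Q (\<lambda>x. 1 - real (snd x) / real (fst x))"
proof -
  let ?W = "PiM UNIV (\<lambda>_ :: nat. measure_pmf Q)"
  let ?A = "PiM UNIV (\<lambda>_ :: nat. measure_pmf P1)" and ?B = "PiM UNIV (\<lambda>_ :: nat. measure_pmf P2)"
  interpret W: prob_space ?W by (intro prob_space_PiM measure_pmf.prob_space_axioms)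
  have \<beta>0: "\<beta> > 0" using \<beta> by simp
  let ?R = "measure (noise_seq \<beta>) {V. cut_time (up V) n n}"
  let ?p = "1 / (1 + \<beta>)"
  let ?f = "\<lambda>w i. fst (w i)" and ?s = "\<lambda>w i. snd (w i)"
  have m1: "?f \<in> ?W \<rightarrow>\<^sub>M ?A" and m2: "?s \<in> ?W \<rightarrow>\<^sub>M ?B"
    by (rule measurable_PiM_single'; auto simp: space_PiM intro!: measurable_compose[OF measurable_component_singleton])+
  have d1: "distr ?W ?A ?f = ?A"
  proof -
    have "distr ?W ?A ?f = PiM UNIV (\<lambda>_. distr (measure_pmf Q) (measure_pmf P1) fst)"
      by (rule PiM_map) (auto simp: measure_pmf.prob_space_axioms)
    also have "distr (measure_pmf Q) (measure_pmf P1) fst = measure_pmf P1"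
      unfolding Q(1)[symmetric] map_pmf_rep_eq by (rule distr_cong) auto
    finally show ?thesis .
  qed
  have d2: "distr ?W ?B ?s = ?B"
  proof -
    have "distr ?W ?B ?s = PiM UNIV (\<lambda>_. distr (measure_pmf Q) (measure_pmf P2) snd)"
      by (rule PiM_map) (auto simp: measure_pmf.prob_space_axioms)
    also have "distr (measure_pmf Q) (measure_pmf P2) snd = measure_pmf P2"
      unfolding Q(2)[symmetric] map_pmf_rep_eq by (rule distr_cong) auto
    finally show ?thesis .
  qed
  have pos: "AE x in measure_pmf Q. 1 \<le> snd x \<and> snd x \<le> fst x"
    using Q(3) P(2) unfolding AE_measure_pmf_iff Q(2)[symmetric] by (force simp: Suc_le_eq intro!: gr0I)
  let ?q = "\<lambda>x. 1 - real (snd x) / real (fst x)"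
  have qb: "\<bar>?q x\<bar> \<le> 1" if "x \<in> set_pmf Q" for x
  proof -
    have "1 \<le> snd x \<and> snd x \<le> fst x" using pos that by (simp add: AE_measure_pmf_iff)
    then show ?thesis by (auto simp: field_simps)
  qed
  have iq0: "integrable (measure_pmf Q) ?q" using qb by (rule integrable_pmf_bounded)
  have iq: "integrable ?W (\<lambda>w. ?q (w r))" for r
  proof -
    have "integrable (distr ?W (measure_pmf Q) (\<lambda>w. w r)) ?q"
      by (subst distr_PiM_component) (auto simp: measure_pmf.prob_space_axioms iq0)
    then show ?thesis
      by (subst (asm) integrable_distr_eq) (auto intro: measurable_component_singleton)
  qed
  let ?S = "\<lambda>w. \<Sum>s<n. \<Sum>r<n. 1000 * ?p * (99/100) ^ (n - s) * (99/100) ^ (n - r) * (?p * (2 * ?q (w r)))"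
  let ?G = "\<lambda>w :: nat \<Rightarrow> nat \<times> nat. ?R * (back_prob \<beta> (fst (w n)) - back_prob \<beta> (snd (w n)))"
  have b: "integrable ?W (\<lambda>w. back_prob \<beta> (g (w n)))" for g :: "nat \<times> nat \<Rightarrow> nat"
    using back_prob_bounds[OF \<beta>0]
    by (intro W.integrable_const_bound[of _ 1]) (auto intro!: measurable_seq_component[where f = "\<lambda>x. back_prob \<beta> (g x)"])
  have iS: "integrable ?W ?S"
    by (intro Bochner_Integration.integrable_sum integrable_mult_right iq)
  have iG: "integrable ?W ?G"
    by (intro integrable_mult_right Bochner_Integration.integrable_diff b)
  have "model_back \<beta> P1 n - model_back \<beta> P2 n \<le> (\<integral>w. ?G w + ?S w \<partial>?W)"
  proof (rule prob_steps_back_diff_le[OF W.prob_space_axioms m1 d1 m2 d2])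
    show "integrable ?W (\<lambda>w. ?G w + ?S w)" using iG iS by (rule Bochner_Integration.integrable_add)
    have "AE w in ?W. 1 \<le> snd (w i) \<and> snd (w i) \<le> fst (w i)" for i
      by (rule AE_PiM_component[where P = "\<lambda>x. 1 \<le> snd x \<and> snd x \<le> fst x"]) (use pos in \<open>auto simp: measure_pmf.prob_space_axioms\<close>)
    then have "AE w in ?W. \<forall>i. 1 \<le> snd (w i) \<and> snd (w i) \<le> fst (w i)"
      by (simp add: AE_all_countable)
    then show "AE w in ?W. measure (noise_seq \<beta>) {V. steps_back (?f w) V n} - measure (noise_seq \<beta>) {V. steps_back (?s w) V n} \<le> ?G w + ?S w"
    proof eventually_elim
      case (elim w)
      have z: "1 \<le> snd (w i)" "snd (w i) \<le> fst (w i)" for i using elim by auto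
      have z1: "1 \<le> fst (w n)" using z[of n] by simp
      from prob_back_diff_le[OF \<beta>, of "?f w" n "?s w", OF z1 z(1)] prob_overtaken_coupled[OF \<beta>, of "?s w" "?f w" n, OF z]
      show ?case by simp
    qed
  qed
  also have "\<dots> = (\<integral>w. ?G w \<partial>?W) + (\<integral>w. ?S w \<partial>?W)"
    using iG iS by (rule Bochner_Integration.integral_add)
  also have "(\<integral>w. ?G w \<partial>?W) = ?R * (measure_pmf.expectation P1 (back_prob \<beta>) - measure_pmf.expectation P2 (back_prob \<beta>))"
  proof -
    have "(\<integral>w. ?G w \<partial>?W) = ?R * ((\<integral>w. back_prob \<beta> (fst (w n)) \<partial>?W) - (\<integral>w. back_prob \<beta> (snd (w n)) \<partial>?W))"
      using b[of fst] b[of snd] by simp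
    also have "(\<integral>w. back_prob \<beta> (fst (w n)) \<partial>?W) = measure_pmf.expectation P1 (back_prob \<beta>)"
      using integral_component[where f = "\<lambda>x. back_prob \<beta> (fst x)" and i = n and P = Q] by (simp add: Q(1)[symmetric])
    also have "(\<integral>w. back_prob \<beta> (snd (w n)) \<partial>?W) = measure_pmf.expectation P2 (back_prob \<beta>)"
      using integral_component[where f = "\<lambda>x. back_prob \<beta> (snd x)" and i = n and P = Q] by (simp add: Q(2)[symmetric])
    finally show ?thesis .
  qed
  also have "(\<integral>w. ?S w \<partial>?W) = (\<Sum>s<n. \<Sum>r<n. 1000 * ?p * (99/100) ^ (n - s) * (99/100) ^ (n - r) * (?p * (2 * measure_pmf.expectation Q ?q)))"
  proof -
    have iq': "(\<integral>w. c * (?p * (2 * ?q (w r))) \<partial>?W) = c * (?p * (2 * measure_pmf.expectation Q ?q))" for c r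
      by (simp only: integral_mult_right_zero integral_component[where f = ?q and P = Q])
    have "(\<integral>w. ?S w \<partial>?W) = (\<Sum>s<n. \<integral>w. (\<Sum>r<n. 1000 * ?p * (99/100) ^ (n - s) * (99/100) ^ (n - r) * (?p * (2 * ?q (w r)))) \<partial>?W)"
      by (rule Bochner_Integration.integral_sum) (intro Bochner_Integration.integrable_sum integrable_mult_right iq)
    also have "\<dots> = (\<Sum>s<n. \<Sum>r<n. \<integral>w. 1000 * ?p * (99/100) ^ (n - s) * (99/100) ^ (n - r) * (?p * (2 * ?q (w r))) \<partial>?W)"
      by (intro sum.cong refl Bochner_Integration.integral_sum integrable_mult_right iq)
    finally show ?thesis by (simp only: iq')
  qed
  also have "\<dots> = 1000 * ?p * (?p * (2 * measure_pmf.expectation Q ?q)) * (\<Sum>i<n. (99/100) ^ (n - i))\<^sup>2"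
  proof (rule sum_weights_eq)
    show "0 \<le> ?p * (2 * measure_pmf.expectation Q ?q)"
      using \<beta>0 pos by (intro mult_nonneg_nonneg integral_nonneg_AE) (auto elim!: AE_mp simp: field_simps)
  qed (use \<beta>0 in simp)
  also have "\<dots> \<le> 1000 * ?p * (?p * (2 * measure_pmf.expectation Q ?q)) * 10000"
    using \<beta>0 weights_sum(2)[of n] pos
    by (intro mult_left_mono mult_nonneg_nonneg integral_nonneg_AE) (auto elim!: AE_mp simp: field_simps)
  finally show ?thesis by (simp add: power2_eq_square mult_ac)
qed

text \<open>
  A monotone coupling of different laws cannot be concentrated on the diagonal.
\<close>

lemma inverse_gain_pos:
  assumes P: "0 \<notin> set_pmf P1" "0 \<notin> set_pmf P2" "P1 \<noteq> P2"
    and Q: "map_pmf fst Q = P1" "map_pmf snd Q = P2" "AE x in measure_pmf Q. snd x \<le> fst x"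
  shows "measure_pmf.expectation Q (\<lambda>x. 1 / real (snd x) - 1 / real (fst x)) > 0"
proof -
  let ?g = "\<lambda>x :: nat \<times> nat. 1 / real (snd x) - 1 / real (fst x)"
  have pos: "1 \<le> snd x \<and> snd x \<le> fst x" if "x \<in> set_pmf Q" for x
    using Q(3) P(2) that unfolding AE_measure_pmf_iff Q(2)[symmetric] by (force simp: Suc_le_eq intro!: gr0I)
  have nn: "0 \<le> ?g x" if "x \<in> set_pmf Q" for x
    using pos[OF that] by (simp add: frac_le)
  have int: "integrable (measure_pmf Q) ?g"
  proof (rule integrable_pmf_bounded)
    fix x :: "nat \<times> nat"
    show "\<bar>?g x\<bar> \<le> 1" by (rule abs_inverse_diff_le_1)
  qed
  have "measure_pmf.expectation Q ?g \<noteq> 0"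
  proof
    assume "measure_pmf.expectation Q ?g = 0"
    then have "AE x in measure_pmf Q. ?g x = 0"
      using int nn by (subst (asm) integral_nonneg_eq_0_iff_AE) (auto simp: AE_measure_pmf_iff)
    then have "fst x = snd x" if "x \<in> set_pmf Q" for x
      using that pos[OF that] by (auto simp: AE_measure_pmf_iff)
    then have "map_pmf fst Q = map_pmf snd Q" by (intro map_pmf_cong) auto
    with P(3) Q show False by simp
  qed
  moreover have "measure_pmf.expectation Q ?g \<ge> 0"
    using nn by (intro integral_nonneg_AE) (auto simp: AE_measure_pmf_iff)
  ultimately show ?thesis by simp
qed

lemma expectation_back_prob_diff:
  assumes \<beta>: "\<beta> > 23 / 4" and P: "0 \<notin> set_pmf P2"
    and Q: "map_pmf fst Q = P1" "map_pmf snd Q = P2" "AE x in measure_pmf Q. snd x \<le> fst x"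
  shows "measure_pmf.expectation P1 (back_prob \<beta>) - measure_pmf.expectation P2 (back_prob \<beta>) \<le>
    - (23 / 27 * (1 / (1 + \<beta>)) * measure_pmf.expectation Q (\<lambda>x. 1 / real (snd x) - 1 / real (fst x)))"
proof -
  let ?g = "\<lambda>x :: nat \<times> nat. 1 / real (snd x) - 1 / real (fst x)"
  have \<beta>0: "\<beta> > 0" using \<beta> by simp
  have pos: "1 \<le> snd x \<and> snd x \<le> fst x" if "x \<in> set_pmf Q" for x
    using Q(3) P that unfolding AE_measure_pmf_iff Q(2)[symmetric] by (force simp: Suc_le_eq intro!: gr0I)
  have int: "integrable (measure_pmf Q) ?g"
  proof (rule integrable_pmf_bounded)
    fix x :: "nat \<times> nat"
    show "\<bar>?g x\<bar> \<le> 1" by (rule abs_inverse_diff_le_1)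
  qed
  have b: "integrable (measure_pmf Q) (\<lambda>x. back_prob \<beta> (f x))" for f
    by (rule integrable_pmf_bounded[of _ _ 1]) (use back_prob_bounds[OF \<beta>0] in auto)
  have nn: "0 \<le> measure_pmf.expectation Q ?g"
  proof (intro integral_nonneg_AE AE_pmfI)
    show "0 \<le> ?g x" if "x \<in> set_pmf Q" for x
      using pos[OF that] by (simp add: frac_le)
  qed
  have "23 / 27 * (1 / (1 + \<beta>)) \<le> \<beta> / (1 + \<beta>) * (1 / (1 + \<beta>))"
    using \<beta> by (intro mult_right_mono) (auto simp: field_simps)
  also have "\<dots> = \<beta> / (1 + \<beta>)\<^sup>2" by (simp add: power2_eq_square)
  finally have "23 / 27 * (1 / (1 + \<beta>)) * measure_pmf.expectation Q ?g \<le> \<beta> / (1 + \<beta>)\<^sup>2 * measure_pmf.expectation Q ?g"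
    using nn by (rule mult_right_mono)
  also have "\<dots> = measure_pmf.expectation Q (\<lambda>x. \<beta> / (1 + \<beta>)\<^sup>2 * ?g x)"
    by simp
  also have "\<dots> \<le> measure_pmf.expectation Q (\<lambda>x. back_prob \<beta> (snd x) - back_prob \<beta> (fst x))"
  proof (rule integral_mono_AE)
    show "AE x in measure_pmf Q. \<beta> / (1 + \<beta>)\<^sup>2 * ?g x \<le> back_prob \<beta> (snd x) - back_prob \<beta> (fst x)"
      by (rule AE_pmfI, rule back_prob_diff_ge[OF \<beta>0 conjunct1[OF pos] conjunct2[OF pos]])
  qed (use int b in \<open>auto intro!: Bochner_Integration.integrable_diff\<close>)
  also have "\<dots> = measure_pmf.expectation P2 (back_prob \<beta>) - measure_pmf.expectation P1 (back_prob \<beta>)"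
    using b[of snd] b[of fst] by (simp add: Q(1)[symmetric] Q(2)[symmetric])
  finally show ?thesis by simp
qed

lemma speed_less:
  assumes \<beta>: "\<beta> > 23 / 4" and P: "0 \<notin> set_pmf P1" "0 \<notin> set_pmf P2" and e: "e > 0"
    and le: "\<And>n. n \<ge> 1 \<Longrightarrow> model_back \<beta> P1 n - model_back \<beta> P2 n \<le> - e"
  shows "speed \<beta> P2 < speed \<beta> P1"
proof -
  have "(\<lambda>n. (1 - 2 * model_back \<beta> P1 n) - (1 - 2 * model_back \<beta> P2 n)) \<longlonglongrightarrow> speed \<beta> P1 - speed \<beta> P2"
    by (intro tendsto_diff speed_eq_back_limit[OF \<beta>] P)
  moreover have "\<exists>N. \<forall>n\<ge>N. 2 * e \<le> (1 - 2 * model_back \<beta> P1 n) - (1 - 2 * model_back \<beta> P2 n)"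
    using le by (intro exI[of _ 1] allI impI) force
  ultimately have "2 * e \<le> speed \<beta> P1 - speed \<beta> P2"
    by (rule LIMSEQ_le_const)
  with e show ?thesis by simp
qed

theorem theorem1:
  shows "\<forall>\<delta>::real. \<delta> > 0 \<longrightarrow> (\<exists>c::real. c > 0 \<and>
    (\<forall>(P1::nat pmf) (P2::nat pmf) (Q::(nat \<times> nat) pmf).
      0 \<notin> set_pmf P1 \<longrightarrow> 0 \<notin> set_pmf P2 \<longrightarrow>
      stoch_dominates P1 P2 \<longrightarrow> P1 \<noteq> P2 \<longrightarrow> monotone_coupling Q P1 P2 \<longrightarrow>
      (\<forall>\<beta>::real. \<beta> > max (beta1 c P1 P2 Q) (23 / 4 + \<delta>) \<longrightarrow> speed \<beta> P1 > speed \<beta> P2)))"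
proof (intro allI impI)
  fix \<delta> :: real assume \<delta>: "\<delta> > 0"
  (* Any constant that exceeds the ratio of the constants in the loss and in the gain will do. *)
  define c :: real where "c = 1000000000"
  have main: "speed \<beta> P1 > speed \<beta> P2"
    if P: "0 \<notin> set_pmf P1" "0 \<notin> set_pmf P2" "P1 \<noteq> P2" and coup: "monotone_coupling Q P1 P2"
      and gt: "\<beta> > max (beta1 c P1 P2 Q) (23 / 4 + \<delta>)" for P1 P2 Q \<beta>
  proof -
    have \<beta>: "\<beta> > 23 / 4" "\<beta> > 0" using gt \<delta> by auto
    have Q: "map_pmf fst Q = P1" "map_pmf snd Q = P2" "AE x in measure_pmf Q. snd x \<le> fst x"
      using coup by (auto simp: monotone_coupling_def case_prod_beta)
    define d where "d = measure_pmf.expectation Q (\<lambda>x. 1 / real (snd x) - 1 / real (fst x))"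
    define A where "A = measure_pmf.expectation (pair_pmf P1 P2) (\<lambda>(a, b). (1 / real a - 1 / real b) * of_bool (a < b))"
    define B where "B = measure_pmf.expectation Q (\<lambda>x. 1 - real (snd x) / real (fst x))"
    define p where "p = 1 / (1 + \<beta>)"
    have p: "0 < p" "p < 1 / \<beta>" "1 / \<beta> \<le> 2 * p"
      using \<beta> by (auto simp: p_def field_simps)
    have d: "d > 0" unfolding d_def by (rule inverse_gain_pos[OF P Q])
    have B_eq: "measure_pmf.expectation Q (\<lambda>(z1, z2). real z2 * (1 / real z2 - 1 / real z1)) = B"
      unfolding B_def
    proof (rule integral_cong_AE)
      show "AE x in measure_pmf Q. (case x of (z1, z2) \<Rightarrow> real z2 * (1 / real z2 - 1 / real z1)) = 1 - real (snd x) / real (fst x)"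
      proof (rule AE_pmfI)
        fix x assume "x \<in> set_pmf Q"
        then have "snd x \<noteq> 0" using P(2) by (auto simp: Q(2)[symmetric])
        then show "(case x of (z1, z2) \<Rightarrow> real z2 * (1 / real z2 - 1 / real z1)) = 1 - real (snd x) / real (fst x)"
          by (simp add: case_prod_beta right_diff_distrib)
      qed
    qed auto
    have "beta1 c P1 P2 Q = c * min (A / d) (B / d + 1)"
      unfolding beta1_def Let_def A_def d_def B_eq by (simp only: case_prod_unfold)
    then have "c * (A / d) < \<beta> \<or> c * (B / d + 1) < \<beta>"
      using gt by (auto simp: min_def split: if_splits)
    moreover have "c * (B / d) < c * (B / d + 1)" by (simp add: c_def)
    ultimately consider "c * (A / d) < \<beta>" | "c * (B / d) < \<beta>" by linarith
    then have "c * (A / \<beta>) < d \<or> c * (B / \<beta>) < d"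
      by cases (use d \<beta>(2) in \<open>auto simp: field_simps\<close>)
    (* Whichever of the two terms attains the minimum, the corresponding loss is small. *)
    then consider (indep) "c * (A / \<beta>) < d" | (coupled) "c * (B / \<beta>) < d" by blast
    then show ?thesis
    proof cases
      case indep
      show ?thesis
      proof (rule speed_less[OF \<beta>(1) P(1,2)])
        show "0 < p * d * (1 / 100)" using p d by simp
        fix n :: nat assume n: "n \<ge> 1"
        let ?R = "measure (noise_seq \<beta>) {V. cut_time (up V) n n}"
        let ?D = "measure_pmf.expectation P1 (back_prob \<beta>) - measure_pmf.expectation P2 (back_prob \<beta>)"
        have D: "?D \<le> - (23 / 27 * p * d)"
          using expectation_back_prob_diff[OF \<beta>(1) P(2) Q] by (simp add: p_def d_def)
        have "model_back \<beta> P1 n - model_back \<beta> P2 n \<le> ?R * ?D + 10000000 * p * (1 / \<beta>) * A"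
          using model_back_diff_indep[OF \<beta>(1) P(1,2) n] by (simp add: p_def A_def)
        also have "?R * ?D \<le> ?R * (- (23 / 27 * p * d))" using D by (intro mult_left_mono) auto
        also have "\<dots> \<le> 9 / 100 * (- (23 / 27 * p * d))"
          using prob_record[OF \<beta>(1) n] p d by (intro mult_right_mono_neg) auto
        also have "10000000 * p * (1 / \<beta>) * A = p * (10000000 * (A / \<beta>))" by simp
        also have "\<dots> \<le> p * (d / 100)"
          using indep p by (intro mult_left_mono) (auto simp: c_def)
        finally show "model_back \<beta> P1 n - model_back \<beta> P2 n \<le> - (p * d * (1 / 100))"
          using mult_pos_pos[OF p(1) d] by (simp add: mult.commute)
      qed
    next
      case coupled
      show ?thesis
      proof (rule speed_less[OF \<beta>(1) P(1,2)])
        show "0 < p * d * (1 / 100)" using p d by simp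
        fix n :: nat assume n: "n \<ge> 1"
        let ?R = "measure (noise_seq \<beta>) {V. cut_time (up V) n n}"
        let ?D = "measure_pmf.expectation P1 (back_prob \<beta>) - measure_pmf.expectation P2 (back_prob \<beta>)"
        have D: "?D \<le> - (23 / 27 * p * d)"
          using expectation_back_prob_diff[OF \<beta>(1) P(2) Q] by (simp add: p_def d_def)
        have B: "0 \<le> B"
          unfolding B_def using Q(3)
          by (intro integral_nonneg_AE) (auto elim!: AE_mp simp: divide_le_eq_1)
        have "model_back \<beta> P1 n - model_back \<beta> P2 n \<le> ?R * ?D + 20000000 * p\<^sup>2 * B"
          using model_back_diff_coupled[OF \<beta>(1) P(1,2) Q] by (simp add: p_def B_def)
        also have "?R * ?D \<le> ?R * (- (23 / 27 * p * d))" using D by (intro mult_left_mono) auto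
        also have "\<dots> \<le> 9 / 100 * (- (23 / 27 * p * d))"
          using prob_record[OF \<beta>(1) n] p d by (intro mult_right_mono_neg) auto
        also have "20000000 * p\<^sup>2 * B = p * (20000000 * (p * B))" by (simp add: power2_eq_square)
        also have "\<dots> \<le> p * (20000000 * (1 / \<beta> * B))"
          using p B by (intro mult_left_mono mult_right_mono) auto
        also have "\<dots> \<le> p * (d / 50)"
          using coupled p by (intro mult_left_mono) (auto simp: c_def)
        finally show "model_back \<beta> P1 n - model_back \<beta> P2 n \<le> - (p * d * (1 / 100))"
          using mult_pos_pos[OF p(1) d] by (simp add: mult.commute)
      qed
    qed
  qed
  show "\<exists>c::real. c > 0 \<and>
    (\<forall>(P1::nat pmf) (P2::nat pmf) (Q::(nat \<times> nat) pmf).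
      0 \<notin> set_pmf P1 \<longrightarrow> 0 \<notin> set_pmf P2 \<longrightarrow>
      stoch_dominates P1 P2 \<longrightarrow> P1 \<noteq> P2 \<longrightarrow> monotone_coupling Q P1 P2 \<longrightarrow>
      (\<forall>\<beta>::real. \<beta> > max (beta1 c P1 P2 Q) (23 / 4 + \<delta>) \<longrightarrow> speed \<beta> P1 > speed \<beta> P2))"
    using main by (intro exI[of _ c]) (auto simp: c_def)
qed

end
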